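(* (1) Let $A$ be a basic non-semisimple Artin algebra with Jacobson radical $J$ such that for every simple left $A$-module $U$ the module $U^2=U\oplus U$ is (isomorphic to) a direct summand of the left socle $\mathrm{soc}_l(A)$ of $A$, and dually for every simple right $A$-module $S$ the module $S^2=S\oplus S$ is (isomorphic to) a direct summand of the right socle $\mathrm{soc}(A)$ of $A$. If all simple (right) $A$-modules are reflexive, then $A$ is selfinjective. (2) Let $A$ be a basic non-semisimple local Artin algebra. If the unique simple (right) $A$-module is reflexive, then $A$ is selfinjective.
   Context: Modules are finitely generated right modules unless stated otherwise. $\mathrm{soc}(A)$ denotes the socle of the right regular module $A_A$ and $\mathrm{soc}_l(A)$ the socle of the left regular module ${}_AA$. $(-)^{*}$ denotes the functor $\mathrm{Hom}_A(-,A)$, from right $A$-modules to left $A$-modules and from left $A$-modules to right $A$-modules. A module $M$ is reflexive if the canonical evaluation map $f_M : M \to M^{**}$, $f_M(m)(g)=g(m)$ for $m\in M$, $g\in M^{*}$, is an isomorphism. $A$ is selfinjective if the regular module $A$ is injective. *)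

theory Defs
  imports "HOL-Algebra.Ideal" "HOL-Algebra.Module"
begin

section \<open>Modules over a ring that need not be commutative\<close>

text \<open>
  The locale \<^locale>\<open>module\<close> requires a commutative ring of scalars, so only its record type and the
  locale \<^locale>\<open>submodule\<close> (which makes no assumption on the scalars) are used here. All notions are
  stated for left modules over an arbitrary ring. A right module over \<open>A\<close> is a left module over
  \<open>opposite_ring A\<close>, where \<open>a \<odot> m\<close> is what is usually written \<open>m a\<close>; for instance
  \<open>socle (opposite_ring A) (regular (opposite_ring A))\<close> is the right socle of \<open>A\<close>.
\<close>

definition opposite_ring :: "('a, 'e) ring_scheme \<Rightarrow> ('a, 'e) ring_scheme" where
  "opposite_ring A = A\<lparr>mult := (\<lambda>x y. y \<otimes>\<^bsub>A\<^esub> x)\<rparr>"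

lemma opposite_ring_opposite_ring: "opposite_ring (opposite_ring A) = A"
  by (cases A) (simp add: opposite_ring_def)

locale left_module = A?: ring A + M?: abelian_group M
  for A :: "('a, 'e) ring_scheme" (structure) and M :: "('a, 'm, 'f) module_scheme" (structure) +
  assumes smult_closed:
      "\<lbrakk>a \<in> carrier A; x \<in> carrier M\<rbrakk> \<Longrightarrow> a \<odot>\<^bsub>M\<^esub> x \<in> carrier M"
    and smult_l_distr:
      "\<lbrakk>a \<in> carrier A; b \<in> carrier A; x \<in> carrier M\<rbrakk> \<Longrightarrow>
        (a \<oplus>\<^bsub>A\<^esub> b) \<odot>\<^bsub>M\<^esub> x = a \<odot>\<^bsub>M\<^esub> x \<oplus>\<^bsub>M\<^esub> b \<odot>\<^bsub>M\<^esub> x"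
    and smult_r_distr:
      "\<lbrakk>a \<in> carrier A; x \<in> carrier M; y \<in> carrier M\<rbrakk> \<Longrightarrow>
        a \<odot>\<^bsub>M\<^esub> (x \<oplus>\<^bsub>M\<^esub> y) = a \<odot>\<^bsub>M\<^esub> x \<oplus>\<^bsub>M\<^esub> a \<odot>\<^bsub>M\<^esub> y"
    and smult_assoc:
      "\<lbrakk>a \<in> carrier A; b \<in> carrier A; x \<in> carrier M\<rbrakk> \<Longrightarrow>
        (a \<otimes>\<^bsub>A\<^esub> b) \<odot>\<^bsub>M\<^esub> x = a \<odot>\<^bsub>M\<^esub> (b \<odot>\<^bsub>M\<^esub> x)"
    and smult_one:
      "x \<in> carrier M \<Longrightarrow> \<one>\<^bsub>A\<^esub> \<odot>\<^bsub>M\<^esub> x = x"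

definition regular :: "('a, 'e) ring_scheme \<Rightarrow> ('a, 'a) module" where
  "regular A = \<lparr>carrier = carrier A, mult = (\<otimes>\<^bsub>A\<^esub>), one = \<one>\<^bsub>A\<^esub>,
                zero = \<zero>\<^bsub>A\<^esub>, add = (\<oplus>\<^bsub>A\<^esub>), smult = (\<otimes>\<^bsub>A\<^esub>)\<rparr>"

text \<open>Homomorphisms are extensional, so that equality of elements of \<open>Hom\<close> is equality of maps.\<close>

definition module_hom ::
  "('a, 'e) ring_scheme \<Rightarrow> ('a, 'm, 'f) module_scheme \<Rightarrow> ('a, 'n, 'g) module_scheme \<Rightarrow> ('m \<Rightarrow> 'n) set"
  where
  "module_hom A M N = {f \<in> carrier M \<rightarrow>\<^sub>E carrier N.
      (\<forall>x\<in>carrier M. \<forall>y\<in>carrier M. f (x \<oplus>\<^bsub>M\<^esub> y) = f x \<oplus>\<^bsub>N\<^esub> f y) \<and>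
      (\<forall>a\<in>carrier A. \<forall>x\<in>carrier M. f (a \<odot>\<^bsub>M\<^esub> x) = a \<odot>\<^bsub>N\<^esub> f x)}"

definition module_iso ::
  "('a, 'e) ring_scheme \<Rightarrow> ('a, 'm, 'f) module_scheme \<Rightarrow> ('a, 'n, 'g) module_scheme \<Rightarrow> ('m \<Rightarrow> 'n) set"
  where
  "module_iso A M N = {f \<in> module_hom A M N. bij_betw f (carrier M) (carrier N)}"

definition isomorphic ::
  "('a, 'e) ring_scheme \<Rightarrow> ('a, 'm, 'f) module_scheme \<Rightarrow> ('a, 'n, 'g) module_scheme \<Rightarrow> bool"
  where
  "isomorphic A M N \<longleftrightarrow> module_iso A M N \<noteq> {}"

definition simple_module :: "('a, 'e) ring_scheme \<Rightarrow> ('a, 'm, 'f) module_scheme \<Rightarrow> bool" where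
  "simple_module A M \<longleftrightarrow> left_module A M \<and> carrier M \<noteq> {\<zero>\<^bsub>M\<^esub>} \<and>
     (\<forall>H. submodule H A M \<longrightarrow> H = {\<zero>\<^bsub>M\<^esub>} \<or> H = carrier M)"

text \<open>The sum of all simple submodules, as the least submodule containing them.\<close>

definition socle :: "('a, 'e) ring_scheme \<Rightarrow> ('a, 'm, 'f) module_scheme \<Rightarrow> 'm set" where
  "socle A M = \<Inter>{H. submodule H A M \<and>
     (\<forall>S. submodule S A M \<and> simple_module A (M\<lparr>carrier := S\<rparr>) \<longrightarrow> S \<subseteq> H)}"

definition semisimple_module :: "('a, 'e) ring_scheme \<Rightarrow> ('a, 'm, 'f) module_scheme \<Rightarrow> bool" where
  "semisimple_module A M \<longleftrightarrow> left_module A M \<and> socle A M = carrier M"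

definition direct_sum ::
  "('a, 'm, 'f) module_scheme \<Rightarrow> ('a, 'n, 'g) module_scheme \<Rightarrow> ('a, 'm \<times> 'n) module" where
  "direct_sum M N =
     \<lparr>carrier = carrier M \<times> carrier N, mult = undefined, one = undefined,
      zero = (\<zero>\<^bsub>M\<^esub>, \<zero>\<^bsub>N\<^esub>),
      add = (\<lambda>(x, y) (x', y'). (x \<oplus>\<^bsub>M\<^esub> x', y \<oplus>\<^bsub>N\<^esub> y')),
      smult = (\<lambda>a (x, y). (a \<odot>\<^bsub>M\<^esub> x, a \<odot>\<^bsub>N\<^esub> y))\<rparr>"

definition direct_summand ::
  "'m set \<Rightarrow> ('a, 'e) ring_scheme \<Rightarrow> ('a, 'm, 'f) module_scheme \<Rightarrow> bool" where
  "direct_summand H A M \<longleftrightarrow> submodule H A M \<and>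
     (\<exists>K. submodule K A M \<and> H \<inter> K = {\<zero>\<^bsub>M\<^esub>} \<and> H <+>\<^bsub>M\<^esub> K = carrier M)"

definition indecomposable :: "('a, 'e) ring_scheme \<Rightarrow> ('a, 'm, 'f) module_scheme \<Rightarrow> bool" where
  "indecomposable A M \<longleftrightarrow> left_module A M \<and> carrier M \<noteq> {\<zero>\<^bsub>M\<^esub>} \<and>
     (\<forall>H. direct_summand H A M \<longrightarrow> H = {\<zero>\<^bsub>M\<^esub>} \<or> H = carrier M)"

definition internal_direct_sum ::
  "('a, 'e) ring_scheme \<Rightarrow> ('a, 'm, 'f) module_scheme \<Rightarrow> 'm set set \<Rightarrow> bool" where
  "internal_direct_sum A M P \<longleftrightarrow> finite P \<and> (\<forall>H\<in>P. submodule H A M) \<and>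
     (\<forall>x\<in>carrier M. \<exists>!p. p \<in> (\<Pi>\<^sub>E H\<in>P. H) \<and> x = (\<Oplus>\<^bsub>M\<^esub>H\<in>P. p H))"


section \<open>Duals and reflexivity\<close>

text \<open>
  For a left \<open>A\<close>-module \<open>M\<close>, the group \<open>Hom\<^sub>A(M, A)\<close> is a right \<open>A\<close>-module via \<open>(f a) m = f m \<cdot> a\<close>, that
  is, a left module over \<open>opposite_ring A\<close>. Applied to \<open>opposite_ring A\<close> in place of \<open>A\<close> this is
  the dual of a right \<open>A\<close>-module, with \<open>(a f) m = a \<cdot> f m\<close>. The double dual of a left \<open>A\<close>-module is
  a left module over \<open>opposite_ring (opposite_ring A)\<close>, which is \<open>A\<close>.
\<close>

definition dual ::
  "('a, 'e) ring_scheme \<Rightarrow> ('a, 'm, 'f) module_scheme \<Rightarrow> ('a, 'm \<Rightarrow> 'a) module" where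
  "dual A M =
     \<lparr>carrier = module_hom A M (regular A), mult = undefined, one = undefined,
      zero = (\<lambda>m\<in>carrier M. \<zero>\<^bsub>A\<^esub>),
      add = (\<lambda>f g. \<lambda>m\<in>carrier M. f m \<oplus>\<^bsub>A\<^esub> g m),
      smult = (\<lambda>a f. \<lambda>m\<in>carrier M. f m \<otimes>\<^bsub>A\<^esub> a)\<rparr>"

definition evaluation ::
  "('a, 'e) ring_scheme \<Rightarrow> ('a, 'm, 'f) module_scheme \<Rightarrow> 'm \<Rightarrow> ('m \<Rightarrow> 'a) \<Rightarrow> 'a" where
  "evaluation A M = (\<lambda>m\<in>carrier M. \<lambda>g\<in>carrier (dual A M). g m)"

definition reflexive :: "('a, 'e) ring_scheme \<Rightarrow> ('a, 'm, 'f) module_scheme \<Rightarrow> bool" where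
  "reflexive A M \<longleftrightarrow> evaluation A M \<in> module_iso A M (dual (opposite_ring A) (dual A M))"


section \<open>Injectivity\<close>

text \<open>
  A definition cannot quantify over types, so the carrier types of the test modules are parameters.
  A theorem that concludes injectivity for two unconstrained type variables asserts it with respect
  to all modules of all types.
\<close>

definition injective_module ::
  "'x itself \<Rightarrow> 'y itself \<Rightarrow> ('a, 'e) ring_scheme \<Rightarrow> ('a, 'm, 'f) module_scheme \<Rightarrow> bool" where
  "injective_module TX TY A Q \<longleftrightarrow> left_module A Q \<and>
     (\<forall>(X :: ('a, 'x) module) (Y :: ('a, 'y) module) i g.
        left_module A X \<and> left_module A Y \<and>
        i \<in> module_hom A X Y \<and> inj_on i (carrier X) \<and> g \<in> module_hom A X Q \<longrightarrow>
        (\<exists>h\<in>module_hom A Y Q. \<forall>x\<in>carrier X. h (i x) = g x))"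

definition selfinjective :: "'x itself \<Rightarrow> 'y itself \<Rightarrow> ('a, 'e) ring_scheme \<Rightarrow> bool" where
  "selfinjective TX TY A \<longleftrightarrow>
     injective_module TX TY (opposite_ring A) (regular (opposite_ring A))"


section \<open>Artin algebras\<close>

definition artinian_cring :: "('r, 'k) ring_scheme \<Rightarrow> bool" where
  "artinian_cring R \<longleftrightarrow> cring R \<and>
     (\<forall>I :: nat \<Rightarrow> 'r set. (\<forall>n. ideal (I n) R \<and> I (Suc n) \<subseteq> I n) \<longrightarrow> (\<exists>n. \<forall>m\<ge>n. I m = I n))"

text \<open>The library's locale \<^locale>\<open>algebra\<close> covers commutative algebras only.\<close>

locale artin_algebra = module R A + A?: ring A
  for R :: "('r, 'k) ring_scheme" (structure) and A :: "('r, 'a, 'l) module_scheme" (structure) +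
  assumes artinian: "artinian_cring R"
    and smult_mult_left:
      "\<lbrakk>r \<in> carrier R; x \<in> carrier A; y \<in> carrier A\<rbrakk> \<Longrightarrow>
        (r \<odot>\<^bsub>A\<^esub> x) \<otimes>\<^bsub>A\<^esub> y = r \<odot>\<^bsub>A\<^esub> (x \<otimes>\<^bsub>A\<^esub> y)"
    and smult_mult_right:
      "\<lbrakk>r \<in> carrier R; x \<in> carrier A; y \<in> carrier A\<rbrakk> \<Longrightarrow>
        x \<otimes>\<^bsub>A\<^esub> (r \<odot>\<^bsub>A\<^esub> y) = r \<odot>\<^bsub>A\<^esub> (x \<otimes>\<^bsub>A\<^esub> y)"
    and finitely_generated:
      "\<exists>X. finite X \<and> X \<subseteq> carrier A \<and>
        (\<forall>a\<in>carrier A. \<exists>c\<in>X \<rightarrow> carrier R. a = (\<Oplus>\<^bsub>A\<^esub>x\<in>X. c x \<odot>\<^bsub>A\<^esub> x))"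

definition semisimple_ring :: "('a, 'e) ring_scheme \<Rightarrow> bool" where
  "semisimple_ring A \<longleftrightarrow> semisimple_module (opposite_ring A) (regular (opposite_ring A))"

text \<open>The right regular module is a direct sum of pairwise non-isomorphic indecomposables.\<close>

definition basic_ring :: "('a, 'e) ring_scheme \<Rightarrow> bool" where
  "basic_ring A \<longleftrightarrow> (\<exists>P. internal_direct_sum (opposite_ring A) (regular (opposite_ring A)) P \<and>
     (\<forall>H\<in>P. indecomposable (opposite_ring A) ((regular (opposite_ring A))\<lparr>carrier := H\<rparr>)) \<and>
     (\<forall>H\<in>P. \<forall>K\<in>P. H \<noteq> K \<longrightarrow>
        \<not> isomorphic (opposite_ring A) ((regular (opposite_ring A))\<lparr>carrier := H\<rparr>)
                                       ((regular (opposite_ring A))\<lparr>carrier := K\<rparr>)))"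

definition maximal_right_ideal :: "'a set \<Rightarrow> ('a, 'e) ring_scheme \<Rightarrow> bool" where
  "maximal_right_ideal I A \<longleftrightarrow>
     submodule I (opposite_ring A) (regular (opposite_ring A)) \<and> I \<noteq> carrier A \<and>
     (\<forall>K. submodule K (opposite_ring A) (regular (opposite_ring A)) \<and> I \<subseteq> K \<longrightarrow>
        K = I \<or> K = carrier A)"

definition local_ring :: "('a, 'e) ring_scheme \<Rightarrow> bool" where
  "local_ring A \<longleftrightarrow> ring A \<and> (\<exists>!I. maximal_right_ideal I A)"

definition regular_socle :: "('a, 'e) ring_scheme \<Rightarrow> ('a, 'a) module" where
  "regular_socle A = (regular A)\<lparr>carrier := socle A (regular A)\<rparr>"

definition square_in_regular_socle ::
  "('a, 'e) ring_scheme \<Rightarrow> ('a, 'm, 'f) module_scheme \<Rightarrow> bool" where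
  "square_in_regular_socle A U \<longleftrightarrow>
     (\<exists>H. direct_summand H A (regular_socle A) \<and>
          isomorphic A (direct_sum U U) ((regular_socle A)\<lparr>carrier := H\<rparr>))"


section \<open>Representatives of the simple modules\<close>

text \<open>
  By the following lemma, quantifying over the simple modules with elements of type \<open>'a set\<close>
  reaches every simple module over a ring with elements of type \<open>'a\<close>, up to isomorphism.
\<close>

lemma simple_representative:
  fixes A :: "('a, 'e) ring_scheme" and S :: "('a, 's, 'f) module_scheme"
  assumes "simple_module A S"
  shows "\<exists>T :: ('a, 'a set) module. simple_module A T \<and> isomorphic A S T"
proof -
  interpret left_module A S using assms by (simp add: simple_module_def)
  obtain m where m: "m \<in> carrier S" "m \<noteq> \<zero>\<^bsub>S\<^esub>"
    using assms M.zero_closed by (auto simp: simple_module_def simp del: M.zero_closed)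
  define \<psi> where "\<psi> x = {a \<in> carrier A. a \<odot>\<^bsub>S\<^esub> m = x}" for x
  have z: "a \<odot>\<^bsub>S\<^esub> \<zero>\<^bsub>S\<^esub> = \<zero>\<^bsub>S\<^esub>" if "a \<in> carrier A" for a
    using smult_r_distr[OF that M.zero_closed M.zero_closed] smult_closed[OF that M.zero_closed]
    by (metis M.add.r_cancel_one M.zero_closed M.r_zero)
  have z': "\<zero>\<^bsub>A\<^esub> \<odot>\<^bsub>S\<^esub> x = \<zero>\<^bsub>S\<^esub>" if "x \<in> carrier S" for x
    using smult_l_distr[OF A.zero_closed A.zero_closed that] smult_closed[OF A.zero_closed that]
    by (metis M.add.r_cancel_one A.zero_closed A.r_zero)
  have neg: "\<ominus>\<^bsub>S\<^esub> (a \<odot>\<^bsub>S\<^esub> x) = (\<ominus>\<^bsub>A\<^esub> a) \<odot>\<^bsub>S\<^esub> x" if "x \<in> carrier S" "a \<in> carrier A" for a x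
    using that smult_l_distr[of "\<ominus>\<^bsub>A\<^esub> a" a x] z'[of x] smult_closed
    by (intro M.minus_equality) (auto simp: A.l_neg)
  let ?H = "(\<lambda>a. a \<odot>\<^bsub>S\<^esub> m) ` carrier A"
  have "submodule ?H A S"
  proof (intro submodule.intro submodule_axioms.intro subgroup.intro, goal_cases)
    case (4 x)
    then show ?case using neg[OF m(1)] by (auto simp flip: a_inv_def)
  next
    case 3
    then show ?case using z'[OF m(1)] by (auto intro!: image_eqI[of _ _ "\<zero>\<^bsub>A\<^esub>"])
  qed (auto simp: m smult_closed simp flip: smult_l_distr smult_assoc)
  moreover have "m \<in> ?H" using m smult_one by (metis image_eqI one_closed)
  ultimately have H: "?H = carrier S" using assms m by (auto simp: simple_module_def)
  have inj: "inj_on \<psi> (carrier S)"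
  proof (rule inj_onI)
    fix x y assume xy: "x \<in> carrier S" "y \<in> carrier S" "\<psi> x = \<psi> y"
    then obtain a where "a \<in> carrier A" "x = a \<odot>\<^bsub>S\<^esub> m" using H by blast
    then have "a \<in> \<psi> x" "a \<odot>\<^bsub>S\<^esub> m = x" by (simp_all add: \<psi>_def)
    moreover from this(1) have "a \<odot>\<^bsub>S\<^esub> m = y" unfolding xy(3) by (simp add: \<psi>_def)
    ultimately show "x = y" by simp
  qed
  define i where "i = the_inv_into (carrier S) \<psi>"
  have i[simp]: "i (\<psi> x) = x" if "x \<in> carrier S" for x
    using inj that by (simp add: i_def the_inv_into_f_f)
  define T :: "('a, 'a set) module" where
    "T = \<lparr>carrier = \<psi> ` carrier S, mult = undefined, one = undefined, zero = \<psi> \<zero>\<^bsub>S\<^esub>,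
          add = (\<lambda>x y. \<psi> (i x \<oplus>\<^bsub>S\<^esub> i y)), smult = (\<lambda>a x. \<psi> (a \<odot>\<^bsub>S\<^esub> i x))\<rparr>"
  have T[simp]: "carrier T = \<psi> ` carrier S" "\<zero>\<^bsub>T\<^esub> = \<psi> \<zero>\<^bsub>S\<^esub>" "x \<oplus>\<^bsub>T\<^esub> y = \<psi> (i x \<oplus>\<^bsub>S\<^esub> i y)"
    "a \<odot>\<^bsub>T\<^esub> x = \<psi> (a \<odot>\<^bsub>S\<^esub> i x)" for x y a by (simp_all add: T_def)
  have ag: "abelian_group T"
  proof (rule abelian_groupI, goal_cases)
    case (6 x)
    then obtain y where y: "y \<in> carrier S" "x = \<psi> y" by auto
    then show ?case by (intro bexI[of _ "\<psi> (\<ominus>\<^bsub>S\<^esub> y)"]) (auto simp: M.l_neg)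
  qed (auto simp: M.a_ac)
  have T_mod: "left_module A T"
    unfolding left_module_def left_module_axioms_def
    by (auto simp: ag ring_axioms smult_closed smult_l_distr smult_r_distr smult_assoc smult_one)
  have ainv: "\<ominus>\<^bsub>T\<^esub> (\<psi> y) = \<psi> (\<ominus>\<^bsub>S\<^esub> y)" if "y \<in> carrier S" for y
    using that by (intro abelian_group.minus_equality[OF ag]) (auto simp: M.l_neg)
  have "H = {\<zero>\<^bsub>T\<^esub>} \<or> H = carrier T" if HT: "submodule H A T" for H
  proof -
    interpret H: submodule H A T by fact
    have sub: "H \<subseteq> \<psi> ` carrier S" using H.subset by simp
    let ?K = "{x \<in> carrier S. \<psi> x \<in> H}"
    have HK: "H = \<psi> ` ?K" using sub by auto
    have "submodule ?K A S"
    proof (intro submodule.intro submodule_axioms.intro subgroup.intro, goal_cases)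
      case (2 x y)
      then show ?case using H.m_closed[of "\<psi> x" "\<psi> y"] by auto
    next
      case 3
      then show ?case using H.one_closed by auto
    next
      case (4 x)
      then show ?case using H.m_inv_closed[of "\<psi> x"] ainv[of x] by (auto simp flip: a_inv_def simp del: T)
    next
      case (5 a x)
      then show ?case using H.smult_closed[of a "\<psi> x"] by (auto simp: smult_closed)
    qed auto
    then have "?K = {\<zero>\<^bsub>S\<^esub>} \<or> ?K = carrier S" using assms by (auto simp: simple_module_def)
    then show ?thesis using HK by auto
  qed
  moreover have "carrier T \<noteq> {\<zero>\<^bsub>T\<^esub>}"
    using m inj M.zero_closed by (auto dest: inj_onD)
  ultimately have "simple_module A T" using T_mod by (simp add: simple_module_def)
  moreover have "restrict \<psi> (carrier S) \<in> module_iso A S T"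
    using inj by (auto simp: module_iso_def module_hom_def smult_closed bij_betw_def inj_on_restrict_eq)
  ultimately show ?thesis unfolding isomorphic_def by blast
qed

end

theory Submission
  imports Defs
begin

text \<open>
  Write \<open>l\<close> and \<open>r\<close> for left and right annihilators in \<open>A\<close>. If \<open>A\<close> is basic or local, every maximal
  right ideal \<open>N\<close> is two-sided with \<open>A/N\<close> a division ring. For \<open>S = A/N\<close> the dual \<open>S*\<close> is the left ideal
  \<open>l N\<close>, and if \<open>S\<close> is reflexive, every homomorphism \<open>l N \<rightarrow> A\<close> is right multiplication by an
  element of \<open>A\<close>. Take a simple quotient \<open>A/M\<close> of \<open>l N\<close> and suppose \<open>r M \<noteq> 0\<close>. The homomorphisms
  \<open>l N \<rightarrow> A/M \<rightarrow> A\<close> then being right multiplications forces \<open>l N = A x\<close> to be simple with \<open>r M = x A\<close>,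
  so \<open>r M \<subseteq> A x\<close>, and \<open>A x\<close> is too small to contain two independent copies of \<open>A/M\<close>. Hence the
  hypotheses of the first part are contradictory. In the local case both annihilators of the radical
  equal \<open>A x = x A\<close>; then all right ideals satisfy \<open>r (l I) = I\<close>, homomorphisms \<open>I \<rightarrow> A\<close> are
  left multiplications, and Baer's criterion applies.
\<close>

section \<open>One-sided ideals\<close>

text \<open>Reflexivity of a right module only speaks of maps out of the left ideal l N, that is, of
  products \<open>x c\<close>. Two-sidedness of N brings this back to the left:
  \<open>c n \<in> N\<close> makes l N closed under right multiplication, so r M = x A is contained
  in l N = A x. For a full matrix ring A / N this fails, which is why the argument needs A / N to be
  a division ring.

  The two parts differ in where r M \<noteq> 0 comes from. In the first, the two copies of A / M in
  the left socle supply it and at the same time contradict the conclusion. In the second, M is the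
  only maximal right ideal, and a generator of a minimal nonzero principal left ideal is annihilated
  by M; as then N = M, the single element x describes both annihilators of M.

  Its role is taken by minimal members: of families of principal ideals, where minimality reads
  \<open>x = c b x\<close>, and of families of right ideals violating a property.\<close>

abbreviation left_ideal :: "'a set \<Rightarrow> ('a, 'e) ring_scheme \<Rightarrow> bool" where
  "left_ideal I A \<equiv> submodule I A (regular A)"

abbreviation right_ideal :: "'a set \<Rightarrow> ('a, 'e) ring_scheme \<Rightarrow> bool" where
  "right_ideal I A \<equiv> submodule I (opposite_ring A) (regular (opposite_ring A))"

lemma opposite_ring_simps [simp]:
  "carrier (opposite_ring A) = carrier A" "x \<otimes>\<^bsub>opposite_ring A\<^esub> y = y \<otimes>\<^bsub>A\<^esub> x"
  "\<one>\<^bsub>opposite_ring A\<^esub> = \<one>\<^bsub>A\<^esub>" "\<zero>\<^bsub>opposite_ring A\<^esub> = \<zero>\<^bsub>A\<^esub>"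
  "x \<oplus>\<^bsub>opposite_ring A\<^esub> y = x \<oplus>\<^bsub>A\<^esub> y" "\<ominus>\<^bsub>opposite_ring A\<^esub> x = \<ominus>\<^bsub>A\<^esub> x"
  "x \<ominus>\<^bsub>opposite_ring A\<^esub> y = x \<ominus>\<^bsub>A\<^esub> y"
  by (simp_all add: opposite_ring_def a_minus_def a_inv_def m_inv_def)

lemma regular_simps [simp]:
  "carrier (regular A) = carrier A" "x \<odot>\<^bsub>regular A\<^esub> y = x \<otimes>\<^bsub>A\<^esub> y"
  "\<zero>\<^bsub>regular A\<^esub> = \<zero>\<^bsub>A\<^esub>" "x \<oplus>\<^bsub>regular A\<^esub> y = x \<oplus>\<^bsub>A\<^esub> y" "\<ominus>\<^bsub>regular A\<^esub> x = \<ominus>\<^bsub>A\<^esub> x"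
  by (simp_all add: regular_def a_inv_def m_inv_def)

context ring
begin

text \<open>The source of left-right symmetry: a fact on right ideals is the fact on left ideals for
  \<open>opposite_ring R\<close>, with \<open>opposite_ring_simps\<close> turning the products
  round.\<close>

lemma ring_opposite: "ring (opposite_ring R)"
proof (rule ringI)
  show "abelian_group (opposite_ring R)"
    by (rule abelian_groupI) (auto simp: a_ac intro!: bexI[of _ "\<ominus> _"] l_neg)
  show "monoid (opposite_ring R)"
    by (rule monoidI) (auto simp: m_assoc)
qed (auto simp: l_distr r_distr)

lemma regular_module: "left_module R (regular R)"
proof -
  have "abelian_group (regular R)"
    by (rule abelian_groupI) (auto simp: a_ac intro!: bexI[of _ "\<ominus> _"] l_neg)
  then show ?thesis
    by (auto simp: left_module_def left_module_axioms_def ring_axioms l_distr r_distr m_assoc)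
qed

text \<open>Multiplication by \<open>\<ominus> \<one>\<close> supplies closure under negation, so no
  premise asks for it.\<close>

lemma left_idealI:
  assumes "I \<subseteq> carrier R" "\<zero> \<in> I" "\<And>x y. x \<in> I \<Longrightarrow> y \<in> I \<Longrightarrow> x \<oplus> y \<in> I"
    "\<And>a x. a \<in> carrier R \<Longrightarrow> x \<in> I \<Longrightarrow> a \<otimes> x \<in> I"
  shows "left_ideal I R"
proof (intro submodule.intro submodule_axioms.intro subgroup.intro, goal_cases)
  case (4 x)
  then have "\<ominus> x = \<ominus> \<one> \<otimes> x" using assms(1) by (auto simp: l_minus)
  then have "\<ominus>\<^bsub>regular R\<^esub> x \<in> I" using 4 assms(4)[of "\<ominus> \<one>" x] by simp
  then show ?case by (simp add: a_inv_def)
qed (use assms in auto)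

lemma right_idealI:
  assumes "I \<subseteq> carrier R" "\<zero> \<in> I" "\<And>x y. x \<in> I \<Longrightarrow> y \<in> I \<Longrightarrow> x \<oplus> y \<in> I"
    "\<And>a x. a \<in> carrier R \<Longrightarrow> x \<in> I \<Longrightarrow> x \<otimes> a \<in> I"
  shows "right_ideal I R"
  by (rule ring.left_idealI[OF ring_opposite]) (use assms in auto)

lemma left_idealD:
  assumes "left_ideal I R"
  shows "I \<subseteq> carrier R" "x \<in> I \<Longrightarrow> x \<in> carrier R" "\<zero> \<in> I"
    "x \<in> I \<Longrightarrow> y \<in> I \<Longrightarrow> x \<oplus> y \<in> I" "x \<in> I \<Longrightarrow> y \<in> I \<Longrightarrow> x \<ominus> y \<in> I"
    "a \<in> carrier R \<Longrightarrow> x \<in> I \<Longrightarrow> a \<otimes> x \<in> I"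
proof -
  interpret I: submodule I R "regular R" by fact
  show sub: "I \<subseteq> carrier R" using I.subset by simp
  show "x \<in> I \<Longrightarrow> x \<in> carrier R" using sub by blast
  show "\<zero> \<in> I" using I.one_closed by simp
  show add: "x \<in> I \<Longrightarrow> y \<in> I \<Longrightarrow> x \<oplus> y \<in> I" for x y using I.m_closed[of x y] by simp
  show mult: "a \<in> carrier R \<Longrightarrow> x \<in> I \<Longrightarrow> a \<otimes> x \<in> I" for a x using I.smult_closed[of a x] by simp
  show "x \<ominus> y \<in> I" if "x \<in> I" "y \<in> I"
  proof -
    have "\<ominus> \<one> \<otimes> y = \<ominus> y" using that(2) sub by (simp add: l_minus subset_iff)
    then show ?thesis using add[OF that(1) mult[of "\<ominus> \<one>" y]] that(2) by (simp add: a_minus_def)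
  qed
qed

lemma right_idealD:
  assumes "right_ideal I R"
  shows "I \<subseteq> carrier R" "x \<in> I \<Longrightarrow> x \<in> carrier R" "\<zero> \<in> I"
    "x \<in> I \<Longrightarrow> y \<in> I \<Longrightarrow> x \<oplus> y \<in> I" "x \<in> I \<Longrightarrow> y \<in> I \<Longrightarrow> x \<ominus> y \<in> I"
    "a \<in> carrier R \<Longrightarrow> x \<in> I \<Longrightarrow> x \<otimes> a \<in> I"
  using ring.left_idealD[OF ring_opposite assms] by simp_all

section \<open>Maximal one-sided ideals\<close>

lemma left_ideal_chain_Union:
  assumes "\<C> \<noteq> {}" "\<And>I. I \<in> \<C> \<Longrightarrow> left_ideal I R" "\<And>I K. I \<in> \<C> \<Longrightarrow> K \<in> \<C> \<Longrightarrow> I \<subseteq> K \<or> K \<subseteq> I"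
  shows "left_ideal (\<Union>\<C>) R"
proof (rule left_idealI)
  show "\<Union>\<C> \<subseteq> carrier R" using assms(2) left_idealD(1) by blast
  show "\<zero> \<in> \<Union>\<C>" using assms(1,2) left_idealD(3) by blast
  show "x \<oplus> y \<in> \<Union>\<C>" if xy: "x \<in> \<Union>\<C>" "y \<in> \<Union>\<C>" for x y
  proof -
    obtain I K where "I \<in> \<C>" "K \<in> \<C>" "x \<in> I" "y \<in> K" using xy by blast
    then show ?thesis
      using assms(3)[of I K] left_idealD(4)[OF assms(2), of I x y] left_idealD(4)[OF assms(2), of K x y]
      by blast
  qed
  show "a \<otimes> x \<in> \<Union>\<C>" if "a \<in> carrier R" "x \<in> \<Union>\<C>" for a x
    using that left_idealD(6)[OF assms(2)] by (meson Union_iff)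
qed

text \<open>Zorn's lemma relative to a bound P and a point x. With P the whole ring and x = \<one>
  it yields maximal ideals; with P a left ideal it yields the K for which P / K turns out to be
  simple.\<close>

lemma left_ideal_maximal_avoiding:
  assumes K0: "left_ideal K0 R" "K0 \<subseteq> P" "x \<notin> K0"
  obtains K where "left_ideal K R" "K0 \<subseteq> K" "K \<subseteq> P" "x \<notin> K"
    "\<And>L. left_ideal L R \<Longrightarrow> K \<subseteq> L \<Longrightarrow> L \<subseteq> P \<Longrightarrow> x \<notin> L \<Longrightarrow> L = K"
proof -
  let ?F = "{K. left_ideal K R \<and> K0 \<subseteq> K \<and> K \<subseteq> P \<and> x \<notin> K}"
  have "\<Union>\<C> \<in> ?F" if C: "\<C> \<noteq> {}" "subset.chain ?F \<C>" for \<C>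
  proof -
    have sub: "\<C> \<subseteq> ?F" and tot: "\<And>I K. I \<in> \<C> \<Longrightarrow> K \<in> \<C> \<Longrightarrow> I \<subseteq> K \<or> K \<subseteq> I"
      using C(2) by (auto simp: subset_chain_def)
    have "left_ideal (\<Union>\<C>) R" using C(1) sub tot by (intro left_ideal_chain_Union) auto
    moreover have "K0 \<subseteq> \<Union>\<C>" using C(1) sub by blast
    ultimately show ?thesis using sub by auto
  qed
  then have "\<exists>M\<in>?F. \<forall>X\<in>?F. M \<subseteq> X \<longrightarrow> X = M" using assms by (intro subset_Zorn_nonempty) auto
  then obtain M where M: "M \<in> ?F" "\<forall>X\<in>?F. M \<subseteq> X \<longrightarrow> X = M" by blast
  show ?thesis
  proof (rule that[of M])
    fix L assume "left_ideal L R" "M \<subseteq> L" "L \<subseteq> P" "x \<notin> L"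
    moreover from this M(1) have "L \<in> ?F" by auto
    ultimately show "L = M" using M(2) by blast
  qed (use M(1) in simp_all)
qed

lemma right_ideal_maximal_avoiding:
  assumes "right_ideal K0 R" "K0 \<subseteq> P" "x \<notin> K0"
  obtains K where "right_ideal K R" "K0 \<subseteq> K" "K \<subseteq> P" "x \<notin> K"
    "\<And>L. right_ideal L R \<Longrightarrow> K \<subseteq> L \<Longrightarrow> L \<subseteq> P \<Longrightarrow> x \<notin> L \<Longrightarrow> L = K"
  by (rule ring.left_ideal_maximal_avoiding[OF ring_opposite assms]) (rule that)

lemma right_ideal_one: "right_ideal I R \<Longrightarrow> \<one> \<in> I \<longleftrightarrow> I = carrier R"
  using right_idealD(1)[of I] right_idealD(6)[of I _ \<one>] by auto

lemma maximal_right_ideal_exists: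
  assumes "right_ideal I R" "\<one> \<notin> I"
  obtains N where "maximal_right_ideal N R" "I \<subseteq> N"
proof -
  obtain N where N: "right_ideal N R" "I \<subseteq> N" "N \<subseteq> carrier R" "\<one> \<notin> N"
    "\<And>L. right_ideal L R \<Longrightarrow> N \<subseteq> L \<Longrightarrow> L \<subseteq> carrier R \<Longrightarrow> \<one> \<notin> L \<Longrightarrow> L = N"
    using right_ideal_maximal_avoiding[OF assms(1) right_idealD(1)[OF assms(1)] assms(2)] by metis
  have "maximal_right_ideal N R"
    unfolding maximal_right_ideal_def
  proof (intro conjI allI impI)
    show "N \<noteq> carrier R" using N(4) by auto
    fix L assume "right_ideal L R \<and> N \<subseteq> L"
    then show "L = N \<or> L = carrier R" using N(5)[of L] right_ideal_one[of L] right_idealD(1)[of L] by argo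
  qed (rule N(1))
  then show ?thesis using N that by blast
qed

lemma left_ideal_add_principal:
  assumes "left_ideal K R" "x \<in> carrier R"
  shows "left_ideal {k \<oplus> a \<otimes> x |k a. k \<in> K \<and> a \<in> carrier R} R"
proof (rule left_idealI)
  note K = left_idealD[OF assms(1)]
  show "{k \<oplus> a \<otimes> x |k a. k \<in> K \<and> a \<in> carrier R} \<subseteq> carrier R" using K(2) assms(2) by auto
  have "\<zero> = \<zero> \<oplus> \<zero> \<otimes> x" using assms(2) by simp
  then show "\<zero> \<in> {k \<oplus> a \<otimes> x |k a. k \<in> K \<and> a \<in> carrier R}" using K(3) by blast
next
  note K = left_idealD[OF assms(1)]
  fix y z assume "y \<in> {k \<oplus> a \<otimes> x |k a. k \<in> K \<and> a \<in> carrier R}"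
    "z \<in> {k \<oplus> a \<otimes> x |k a. k \<in> K \<and> a \<in> carrier R}"
  then obtain k a l b where "y = k \<oplus> a \<otimes> x" "z = l \<oplus> b \<otimes> x" "k \<in> K" "l \<in> K"
    "a \<in> carrier R" "b \<in> carrier R" by blast
  moreover from this have "y \<oplus> z = (k \<oplus> l) \<oplus> (a \<oplus> b) \<otimes> x"
    using K(2) assms(2) by (simp add: l_distr a_ac)
  ultimately show "y \<oplus> z \<in> {k \<oplus> a \<otimes> x |k a. k \<in> K \<and> a \<in> carrier R}"
    using K(4) by blast
next
  note K = left_idealD[OF assms(1)]
  fix b y assume b: "b \<in> carrier R" and "y \<in> {k \<oplus> a \<otimes> x |k a. k \<in> K \<and> a \<in> carrier R}"
  then obtain k a where "y = k \<oplus> a \<otimes> x" "k \<in> K" "a \<in> carrier R" by blast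
  moreover from this have "b \<otimes> y = b \<otimes> k \<oplus> (b \<otimes> a) \<otimes> x"
    using b K(2) assms(2) by (simp add: r_distr m_assoc)
  ultimately show "b \<otimes> y \<in> {k \<oplus> a \<otimes> x |k a. k \<in> K \<and> a \<in> carrier R}"
    using b K(6) by blast
qed

lemma left_ideal_add_principal_supset:
  assumes "left_ideal K R" "x \<in> carrier R"
  shows "x \<in> {k \<oplus> a \<otimes> x |k a. k \<in> K \<and> a \<in> carrier R}"
    "K \<subseteq> {k \<oplus> a \<otimes> x |k a. k \<in> K \<and> a \<in> carrier R}"
proof -
  note K = left_idealD[OF assms(1)]
  have "x = \<zero> \<oplus> \<one> \<otimes> x" using assms(2) by simp
  then show "x \<in> {k \<oplus> a \<otimes> x |k a. k \<in> K \<and> a \<in> carrier R}" using K(3) by blast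
  have "k = k \<oplus> \<zero> \<otimes> x" if "k \<in> K" for k using assms(2) K(2)[OF that] by simp
  then show "K \<subseteq> {k \<oplus> a \<otimes> x |k a. k \<in> K \<and> a \<in> carrier R}" by blast
qed

lemma right_ideal_add_principal:
  assumes "right_ideal K R" "x \<in> carrier R"
  shows "right_ideal {k \<oplus> x \<otimes> a |k a. k \<in> K \<and> a \<in> carrier R} R"
  using ring.left_ideal_add_principal[OF ring_opposite assms(1)] assms(2) by simp

lemma right_ideal_add_principal_supset:
  assumes "right_ideal K R" "x \<in> carrier R"
  shows "x \<in> {k \<oplus> x \<otimes> a |k a. k \<in> K \<and> a \<in> carrier R}"
    "K \<subseteq> {k \<oplus> x \<otimes> a |k a. k \<in> K \<and> a \<in> carrier R}"
  using ring.left_ideal_add_principal_supset[OF ring_opposite assms(1)] assms(2) by simp_all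

lemma maximal_right_idealD:
  assumes "maximal_right_ideal N R"
  shows "right_ideal N R" "\<one> \<notin> N"
    "u \<in> carrier R \<Longrightarrow> u \<notin> N \<Longrightarrow> v \<in> carrier R \<Longrightarrow> \<exists>a\<in>carrier R. v \<ominus> u \<otimes> a \<in> N"
proof -
  show N: "right_ideal N R" using assms by (simp add: maximal_right_ideal_def)
  show "\<one> \<notin> N" using assms right_ideal_one[OF N] by (simp add: maximal_right_ideal_def)
  assume u: "u \<in> carrier R" "u \<notin> N" and v: "v \<in> carrier R"
  define L where "L = {k \<oplus> u \<otimes> a |k a. k \<in> N \<and> a \<in> carrier R}"
  have "right_ideal L R" "u \<in> L" "N \<subseteq> L"
    unfolding L_def using right_ideal_add_principal[OF N u(1)] right_ideal_add_principal_supset[OF N u(1)] .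
  then have "L = carrier R" using assms u(2) unfolding maximal_right_ideal_def by blast
  then obtain k a where "v = k \<oplus> u \<otimes> a" "k \<in> N" "a \<in> carrier R" using v unfolding L_def by blast
  moreover from this have "v \<ominus> u \<otimes> a = k" using right_idealD(2)[OF N] u(1) by (simp add: a_minus_def a_assoc r_neg)
  ultimately show "\<exists>a\<in>carrier R. v \<ominus> u \<otimes> a \<in> N" by metis
qed

end

text \<open>The minimum condition instead of descending chains, because each use picks a minimal
  member of a family: of principal ideals or of counterexamples.\<close>

definition artinian_left :: "('a, 'e) ring_scheme \<Rightarrow> bool" where
  "artinian_left A \<longleftrightarrow>
     (\<forall>F. F \<noteq> {} \<and> (\<forall>I\<in>F. left_ideal I A) \<longrightarrow> (\<exists>I\<in>F. \<forall>K\<in>F. K \<subseteq> I \<longrightarrow> K = I))"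

lemma artinian_leftD:
  assumes "artinian_left A" "F \<noteq> {}" "\<And>I. I \<in> F \<Longrightarrow> left_ideal I A"
  shows "\<exists>I\<in>F. \<forall>K\<in>F. K \<subseteq> I \<longrightarrow> K = I"
  using assms by (simp add: artinian_left_def)

text \<open>A maximal right ideal satisfies this iff it is two-sided, and then the quotient is a division ring.\<close>

definition completely_prime_maximal :: "'a set \<Rightarrow> ('a, 'e) ring_scheme \<Rightarrow> bool" where
  "completely_prime_maximal N A \<longleftrightarrow>
     (\<forall>a\<in>carrier A. \<forall>n\<in>N. a \<otimes>\<^bsub>A\<^esub> n \<in> N) \<and>
     (\<forall>a\<in>carrier A - N. \<exists>b\<in>carrier A. b \<otimes>\<^bsub>A\<^esub> a \<ominus>\<^bsub>A\<^esub> \<one>\<^bsub>A\<^esub> \<in> N)"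

definition left_annihilator :: "('a, 'e) ring_scheme \<Rightarrow> 'a set \<Rightarrow> 'a set" where
  "left_annihilator A N = {x \<in> carrier A. \<forall>n\<in>N. x \<otimes>\<^bsub>A\<^esub> n = \<zero>\<^bsub>A\<^esub>}"

text \<open>Surjectivity of the restriction map from A = Hom(A, A) to Hom(P, A). Plain functions
  suffice, since only their values on P matter; this is the shape that Baer's criterion asks for.
  Over \<open>opposite_ring A\<close> it concerns right ideals and left multiplications.\<close>

definition homs_are_right_multiplications :: "'a set \<Rightarrow> ('a, 'e) ring_scheme \<Rightarrow> bool" where
  "homs_are_right_multiplications P A \<longleftrightarrow> (\<forall>\<phi>\<in>P \<rightarrow> carrier A.
     (\<forall>x\<in>P. \<forall>y\<in>P. \<phi> (x \<oplus>\<^bsub>A\<^esub> y) = \<phi> x \<oplus>\<^bsub>A\<^esub> \<phi> y) \<and>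
     (\<forall>a\<in>carrier A. \<forall>x\<in>P. \<phi> (a \<otimes>\<^bsub>A\<^esub> x) = a \<otimes>\<^bsub>A\<^esub> \<phi> x) \<longrightarrow>
     (\<exists>c\<in>carrier A. \<forall>x\<in>P. \<phi> x = x \<otimes>\<^bsub>A\<^esub> c))"

lemma homs_are_right_multiplicationsD:
  assumes "homs_are_right_multiplications P A" "\<phi> \<in> P \<rightarrow> carrier A"
    "\<And>x y. x \<in> P \<Longrightarrow> y \<in> P \<Longrightarrow> \<phi> (x \<oplus>\<^bsub>A\<^esub> y) = \<phi> x \<oplus>\<^bsub>A\<^esub> \<phi> y"
    "\<And>a x. a \<in> carrier A \<Longrightarrow> x \<in> P \<Longrightarrow> \<phi> (a \<otimes>\<^bsub>A\<^esub> x) = a \<otimes>\<^bsub>A\<^esub> \<phi> x"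
  shows "\<exists>c\<in>carrier A. \<forall>x\<in>P. \<phi> x = x \<otimes>\<^bsub>A\<^esub> c"
  using assms unfolding homs_are_right_multiplications_def by blast

section \<open>Minimal principal ideals and simple quotients of left ideals\<close>

context ring
begin

lemma left_ideal_principal:
  assumes "x \<in> carrier R"
  shows "left_ideal {a \<otimes> x |a. a \<in> carrier R} R"
proof -
  have 0: "left_ideal {\<zero>} R" by (rule left_idealI) auto
  have 1: "{k \<oplus> a \<otimes> x |k a. k \<in> {\<zero>} \<and> a \<in> carrier R} = {a \<otimes> x |a. a \<in> carrier R}"
    using assms by (force intro!: Collect_cong)
  show ?thesis using left_ideal_add_principal[OF 0 assms] by (simp only: 1)
qed

lemma right_ideal_principal:
  assumes "x \<in> carrier R"
  shows "right_ideal {x \<otimes> a |a. a \<in> carrier R} R"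
  using ring.left_ideal_principal[OF ring_opposite] assms by simp

text \<open>Minimality of \<open>R x\<close> among the principal left ideals with generator in X, in
  terms of elements: \<open>R b x \<subseteq> R x\<close> must be an equality once
  \<open>b x\<close> lies in X.\<close>

lemma artinian_principal_left:
  assumes "artinian_left R" "X \<noteq> {}" "X \<subseteq> carrier R"
  shows "\<exists>x\<in>X. \<forall>b\<in>carrier R. b \<otimes> x \<in> X \<longrightarrow> (\<exists>c\<in>carrier R. x = c \<otimes> (b \<otimes> x))"
proof -
  define p where "p x = {a \<otimes> x |a. a \<in> carrier R}" for x
  have self: "x \<in> p x" if "x \<in> X" for x
    using that assms(3) l_one[of x] unfolding p_def by (metis (mono_tags, lifting) mem_Collect_eq one_closed subsetD)
  have "\<exists>I\<in>p ` X. \<forall>K\<in>p ` X. K \<subseteq> I \<longrightarrow> K = I"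
  proof (rule artinian_leftD[OF assms(1)])
    show "left_ideal I R" if "I \<in> p ` X" for I
      using that assms(3) left_ideal_principal unfolding p_def by auto
  qed (use assms(2) in simp)
  then obtain x where x: "x \<in> X" "\<forall>y\<in>X. p y \<subseteq> p x \<longrightarrow> p y = p x" by auto
  have "\<exists>c\<in>carrier R. x = c \<otimes> (b \<otimes> x)" if b: "b \<in> carrier R" "b \<otimes> x \<in> X" for b
  proof -
    have "p (b \<otimes> x) \<subseteq> p x"
    proof
      fix y assume "y \<in> p (b \<otimes> x)"
      then obtain a where a: "a \<in> carrier R" "y = a \<otimes> (b \<otimes> x)" unfolding p_def by blast
      then have "y = (a \<otimes> b) \<otimes> x" using b x(1) assms(3) by (simp add: m_assoc subset_iff)
      then show "y \<in> p x" using a b unfolding p_def by blast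
    qed
    then have "x \<in> p (b \<otimes> x)" using x b(2) self by blast
    then show ?thesis unfolding p_def by blast
  qed
  then show ?thesis using x(1) by blast
qed

lemma artinian_principal_right:
  assumes "artinian_left (opposite_ring R)" "X \<noteq> {}" "X \<subseteq> carrier R"
  shows "\<exists>x\<in>X. \<forall>b\<in>carrier R. x \<otimes> b \<in> X \<longrightarrow> (\<exists>c\<in>carrier R. x = (x \<otimes> b) \<otimes> c)"
  using ring.artinian_principal_left[OF ring_opposite assms(1,2)] assms(3) by simp

lemma minus_add_cancel: "x \<in> carrier R \<Longrightarrow> y \<in> carrier R \<Longrightarrow> (x \<ominus> y) \<oplus> y = x"
  by (simp add: a_minus_def a_assoc l_neg)

text \<open>
  Nakayama's lemma in disguise: with \<open>j A\<close> minimal among the principal right ideals that do not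
  annihilate \<open>P\<close>, the maximal right ideals containing the right annihilator of \<open>j\<close> satisfy \<open>N P \<noteq> P\<close>.
\<close>

lemma left_ideal_maximal_sub:
  assumes art: "artinian_left (opposite_ring R)"
    and cpm: "\<And>N. maximal_right_ideal N R \<Longrightarrow> completely_prime_maximal N R"
    and P: "left_ideal P R" "P \<noteq> {\<zero>}"
  obtains N K x where "maximal_right_ideal N R" "left_ideal K R" "K \<subseteq> P" "x \<in> P" "x \<notin> K"
    "\<And>n p. n \<in> N \<Longrightarrow> p \<in> P \<Longrightarrow> n \<otimes> p \<in> K"
    "P = {k \<oplus> a \<otimes> x |k a. k \<in> K \<and> a \<in> carrier R}"
proof -
  note PD = left_idealD[OF P(1)]
  define X where "X = {j \<in> carrier R. \<exists>p\<in>P. j \<otimes> p \<noteq> \<zero>}"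
  obtain p0 where "p0 \<in> P" "p0 \<noteq> \<zero>" using P PD(3) by blast
  then have "\<one> \<in> X" using PD(2) unfolding X_def by auto
  moreover have "X \<subseteq> carrier R" unfolding X_def by auto
  ultimately obtain j where j: "j \<in> X"
    and jmin: "\<And>b. b \<in> carrier R \<Longrightarrow> j \<otimes> b \<in> X \<Longrightarrow> \<exists>c\<in>carrier R. j = (j \<otimes> b) \<otimes> c"
    using artinian_principal_right[OF art, of X] by blast
  then have jc: "j \<in> carrier R" and "j \<noteq> \<zero>" using PD(2) unfolding X_def by auto
  let ?r = "{a \<in> carrier R. j \<otimes> a = \<zero>}"
  have "right_ideal ?r R"
    by (rule right_idealI) (use jc in \<open>auto simp: r_distr m_assoc[symmetric]\<close>)
  moreover have "\<one> \<notin> ?r" using jc \<open>j \<noteq> \<zero>\<close> by simp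
  ultimately obtain N where N: "maximal_right_ideal N R" "?r \<subseteq> N"
    using maximal_right_ideal_exists by blast
  note ND = right_idealD[OF maximal_right_idealD(1)[OF N(1)]]
  note Nl = cpm[OF N(1), unfolded completely_prime_maximal_def]
  \<comment> \<open>If \<open>j n\<close> did not annihilate P, minimality would give
    \<open>j = j n c\<close>. Then \<open>\<one> - n c\<close> annihilates j from the right and so
    lies in N, as \<open>n c\<close> does, whence \<one> \<in> N.\<close>
  have jN: "j \<otimes> n \<otimes> p = \<zero>" if n: "n \<in> N" "p \<in> P" for n p
  proof (rule ccontr)
    assume "j \<otimes> n \<otimes> p \<noteq> \<zero>"
    then obtain c where c: "c \<in> carrier R" "(j \<otimes> n) \<otimes> c = j"
      using jmin[of n] n ND(2) jc unfolding X_def by force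
    have "j \<otimes> (\<one> \<ominus> n \<otimes> c) = j \<ominus> (j \<otimes> n) \<otimes> c"
      using jc n(1) ND(2) c(1) by (simp add: a_minus_def r_distr r_minus m_assoc)
    then have "j \<otimes> (\<one> \<ominus> n \<otimes> c) = \<zero>" using c(2) jc by (simp add: a_minus_def r_neg)
    then have "\<one> \<ominus> n \<otimes> c \<in> N" using N(2) c(1) ND(2)[OF n(1)] by (simp add: subset_iff)
    then have "(\<one> \<ominus> n \<otimes> c) \<oplus> n \<otimes> c \<in> N" using n(1) c(1) ND(4,6) by blast
    then show False using maximal_right_idealD(2)[OF N(1)] n(1) c(1) ND(2) by (simp add: minus_add_cancel)
  qed
  \<comment> \<open>The factor \<open>a\<close> makes K0 a left ideal. Since N also absorbs left
    multiplication, \<open>j a n p\<close> is covered by \<open>jN\<close>, so N P \<subseteq> K0,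
    while K0 \<noteq> P because j does not annihilate P.\<close>
  define K0 where "K0 = {p \<in> P. \<forall>a\<in>carrier R. j \<otimes> a \<otimes> p = \<zero>}"
  have K0: "left_ideal K0 R"
  proof (rule left_idealI)
    fix b x assume "b \<in> carrier R" "x \<in> K0"
    then show "b \<otimes> x \<in> K0"
      using jc PD(2,6) unfolding K0_def by (auto simp: m_assoc) (metis m_assoc m_closed)
  qed (use PD jc in \<open>auto simp: K0_def r_distr\<close>)
  have NK0: "n \<otimes> p \<in> K0" if "n \<in> N" "p \<in> P" for n p
  proof -
    have "j \<otimes> a \<otimes> (n \<otimes> p) = j \<otimes> (a \<otimes> n) \<otimes> p" if "a \<in> carrier R" for a
      using that \<open>n \<in> N\<close> \<open>p \<in> P\<close> ND(2) PD(2) jc by (simp add: m_assoc)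
    then show ?thesis unfolding K0_def using that jN Nl PD(6) ND(2) by auto
  qed
  have "\<exists>p\<in>P. j \<otimes> p \<noteq> \<zero>" using j by (simp add: X_def)
  then obtain x where x: "x \<in> P" "j \<otimes> \<one> \<otimes> x \<noteq> \<zero>" using jc by auto
  then have xK0: "x \<notin> K0" unfolding K0_def by blast
  have "K0 \<subseteq> P" by (auto simp: K0_def)
  obtain K where K: "left_ideal K R" "K0 \<subseteq> K" "K \<subseteq> P" "x \<notin> K"
    "\<And>L. left_ideal L R \<Longrightarrow> K \<subseteq> L \<Longrightarrow> L \<subseteq> P \<Longrightarrow> x \<notin> L \<Longrightarrow> L = K"
    using left_ideal_maximal_avoiding[OF K0 \<open>K0 \<subseteq> P\<close> xK0] by metis
  note KD = left_idealD[OF K(1)]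
  have xc: "x \<in> carrier R" using x PD by blast
  \<comment> \<open>Maximality of K only says that every y \<in> P outside K satisfies
    \<open>x = k + a y\<close>. As N P \<subseteq> K, the coefficient a lies outside N, and an
    inverse b modulo N solves this for y.\<close>
  have "y \<in> {k \<oplus> a \<otimes> x |k a. k \<in> K \<and> a \<in> carrier R}" if y: "y \<in> P" for y
  proof (cases "y \<in> K")
    case True
    then show ?thesis using left_ideal_add_principal_supset(2)[OF K(1) xc] by blast
  next
    case False
    define L where "L = {k \<oplus> a \<otimes> y |k a. k \<in> K \<and> a \<in> carrier R}"
    have yc: "y \<in> carrier R" using y PD by blast
    have "left_ideal L R" "y \<in> L" "K \<subseteq> L"
      unfolding L_def using left_ideal_add_principal[OF K(1) yc] left_ideal_add_principal_supset[OF K(1) yc] .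
    moreover have "L \<subseteq> P"
    proof
      fix z assume "z \<in> L"
      then obtain k a where "z = k \<oplus> a \<otimes> y" "k \<in> K" "a \<in> carrier R" unfolding L_def by blast
      then show "z \<in> P" using K(3) y PD(4,6) by blast
    qed
    ultimately have "x \<in> L" using K(5)[of L] False by metis
    then obtain k a where ka: "x = k \<oplus> a \<otimes> y" "k \<in> K" "a \<in> carrier R"
      unfolding L_def by blast
    have "a \<notin> N"
    proof
      assume "a \<in> N"
      then have "a \<otimes> y \<in> K" using NK0 y K(2) by blast
      then show False using ka K(4) KD(4) by blast
    qed
    then obtain b where b: "b \<in> carrier R" "b \<otimes> a \<ominus> \<one> \<in> N" using Nl ka(3) by blast
    have "(b \<otimes> a \<ominus> \<one>) \<otimes> y \<in> K" by (rule subsetD[OF K(2) NK0[OF b(2) y]])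
    moreover have "b \<otimes> k \<in> K" by (rule KD(6)[OF b(1) ka(2)])
    ultimately have "\<zero> \<ominus> (b \<otimes> k \<oplus> (b \<otimes> a \<ominus> \<one>) \<otimes> y) \<in> K" by (intro KD(3-5))
    moreover have "y = (\<zero> \<ominus> (b \<otimes> k \<oplus> (b \<otimes> a \<ominus> \<one>) \<otimes> y)) \<oplus> b \<otimes> x"
      using ka(1) ka(3) b(1) yc KD(2)[OF ka(2)]
      by (simp add: a_minus_def r_distr l_distr minus_add l_minus m_assoc a_ac r_neg r_neg1 r_neg2 l_neg)
    ultimately show ?thesis using b(1) by blast
  qed
  moreover have "{k \<oplus> a \<otimes> x |k a. k \<in> K \<and> a \<in> carrier R} \<subseteq> P" using K(3) x PD(4,6) by blast
  ultimately have "P = {k \<oplus> a \<otimes> x |k a. k \<in> K \<and> a \<in> carrier R}" by blast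
  with that[OF N(1) K(1,3) x(1) K(4)] NK0 K(2) show ?thesis by blast
qed

end

section \<open>Simple modules and reflexivity\<close>

context left_module
begin

lemma smult_zero_right: "a \<in> carrier A \<Longrightarrow> a \<odot>\<^bsub>M\<^esub> \<zero>\<^bsub>M\<^esub> = \<zero>\<^bsub>M\<^esub>"
  using smult_r_distr[of a "\<zero>\<^bsub>M\<^esub>" "\<zero>\<^bsub>M\<^esub>"] smult_closed[of a "\<zero>\<^bsub>M\<^esub>"]
  by (metis M.add.r_cancel_one M.zero_closed M.r_zero)

lemma smult_zero_left: "x \<in> carrier M \<Longrightarrow> \<zero>\<^bsub>A\<^esub> \<odot>\<^bsub>M\<^esub> x = \<zero>\<^bsub>M\<^esub>"
  using smult_l_distr[of "\<zero>\<^bsub>A\<^esub>" "\<zero>\<^bsub>A\<^esub>" x] smult_closed[of "\<zero>\<^bsub>A\<^esub>" x]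
  by (metis M.add.r_cancel_one A.zero_closed A.r_zero)

lemma smult_minus_one: "x \<in> carrier M \<Longrightarrow> (\<ominus>\<^bsub>A\<^esub> \<one>\<^bsub>A\<^esub>) \<odot>\<^bsub>M\<^esub> x = \<ominus>\<^bsub>M\<^esub> x"
  using smult_l_distr[of "\<ominus>\<^bsub>A\<^esub> \<one>\<^bsub>A\<^esub>" "\<one>\<^bsub>A\<^esub>" x] smult_zero_left[of x] smult_closed[of "\<ominus>\<^bsub>A\<^esub> \<one>\<^bsub>A\<^esub>" x]
  by (simp add: smult_one A.l_neg M.minus_equality)

lemma smult_diff_eq_zero:
  assumes "a \<in> carrier A" "b \<in> carrier A" "x \<in> carrier M"
  shows "(a \<ominus>\<^bsub>A\<^esub> b) \<odot>\<^bsub>M\<^esub> x = \<zero>\<^bsub>M\<^esub> \<longleftrightarrow> a \<odot>\<^bsub>M\<^esub> x = b \<odot>\<^bsub>M\<^esub> x"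
proof -
  have "((a \<ominus>\<^bsub>A\<^esub> b) \<oplus>\<^bsub>A\<^esub> b) \<odot>\<^bsub>M\<^esub> x = (a \<ominus>\<^bsub>A\<^esub> b) \<odot>\<^bsub>M\<^esub> x \<oplus>\<^bsub>M\<^esub> b \<odot>\<^bsub>M\<^esub> x"
    using assms by (simp add: smult_l_distr)
  then have eq: "a \<odot>\<^bsub>M\<^esub> x = (a \<ominus>\<^bsub>A\<^esub> b) \<odot>\<^bsub>M\<^esub> x \<oplus>\<^bsub>M\<^esub> b \<odot>\<^bsub>M\<^esub> x"
    using assms by (simp add: A.minus_add_cancel)
  have "u = \<zero>\<^bsub>M\<^esub> \<longleftrightarrow> u \<oplus>\<^bsub>M\<^esub> v = v" if "u \<in> carrier M" "v \<in> carrier M" for u v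
    using that by simp
  from this[of "(a \<ominus>\<^bsub>A\<^esub> b) \<odot>\<^bsub>M\<^esub> x" "b \<odot>\<^bsub>M\<^esub> x"] show ?thesis
    unfolding eq using assms smult_closed by simp
qed

lemma submoduleI:
  assumes "H \<subseteq> carrier M" "\<zero>\<^bsub>M\<^esub> \<in> H" "\<And>x y. x \<in> H \<Longrightarrow> y \<in> H \<Longrightarrow> x \<oplus>\<^bsub>M\<^esub> y \<in> H"
    "\<And>a x. a \<in> carrier A \<Longrightarrow> x \<in> H \<Longrightarrow> a \<odot>\<^bsub>M\<^esub> x \<in> H"
  shows "submodule H A M"
proof (intro submodule.intro submodule_axioms.intro subgroup.intro, goal_cases)
  case (4 x)
  then have "\<ominus>\<^bsub>M\<^esub> x \<in> H" using assms(1) assms(4)[of "\<ominus>\<^bsub>A\<^esub> \<one>\<^bsub>A\<^esub>" x] smult_minus_one[of x] by auto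
  then show ?case by (simp add: a_inv_def)
qed (use assms in auto)

lemma left_ideal_image_submodule:
  assumes K: "left_ideal K A" and s: "s \<in> carrier M"
  shows "submodule ((\<lambda>a. a \<odot>\<^bsub>M\<^esub> s) ` K) A M"
proof (rule submoduleI)
  note KD = A.left_idealD[OF K]
  show "(\<lambda>a. a \<odot>\<^bsub>M\<^esub> s) ` K \<subseteq> carrier M" using KD(2) s smult_closed by auto
  show "\<zero>\<^bsub>M\<^esub> \<in> (\<lambda>a. a \<odot>\<^bsub>M\<^esub> s) ` K" using KD(3) smult_zero_left[OF s] by (metis imageI)
next
  note KD = A.left_idealD[OF K]
  fix x y assume "x \<in> (\<lambda>a. a \<odot>\<^bsub>M\<^esub> s) ` K" "y \<in> (\<lambda>a. a \<odot>\<^bsub>M\<^esub> s) ` K"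
  then obtain a b where ab: "a \<in> K" "b \<in> K" "x = a \<odot>\<^bsub>M\<^esub> s" "y = b \<odot>\<^bsub>M\<^esub> s" by blast
  then have "x \<oplus>\<^bsub>M\<^esub> y = (a \<oplus>\<^bsub>A\<^esub> b) \<odot>\<^bsub>M\<^esub> s" using KD(2) s by (simp add: smult_l_distr)
  then show "x \<oplus>\<^bsub>M\<^esub> y \<in> (\<lambda>a. a \<odot>\<^bsub>M\<^esub> s) ` K" using KD(4)[OF ab(1,2)] by simp
next
  note KD = A.left_idealD[OF K]
  fix a x assume a: "a \<in> carrier A" "x \<in> (\<lambda>a. a \<odot>\<^bsub>M\<^esub> s) ` K"
  then obtain b where b: "b \<in> K" "x = b \<odot>\<^bsub>M\<^esub> s" by blast
  then have "a \<odot>\<^bsub>M\<^esub> x = (a \<otimes>\<^bsub>A\<^esub> b) \<odot>\<^bsub>M\<^esub> s" using KD(2) a s by (simp add: smult_assoc)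
  then show "a \<odot>\<^bsub>M\<^esub> x \<in> (\<lambda>a. a \<odot>\<^bsub>M\<^esub> s) ` K" using KD(6)[OF a(1) b(1)] by simp
qed

end

section \<open>Simple modules as quotients by maximal one-sided ideals\<close>

context ring
begin

lemma carrier_left_ideal: "left_ideal (carrier R) R"
  by (rule left_idealI) auto

lemma simple_module_generated:
  assumes "simple_module R S" "s \<in> carrier S" "s \<noteq> \<zero>\<^bsub>S\<^esub>" "left_ideal K R" "k \<in> K" "k \<odot>\<^bsub>S\<^esub> s \<noteq> \<zero>\<^bsub>S\<^esub>"
  shows "(\<lambda>a. a \<odot>\<^bsub>S\<^esub> s) ` K = carrier S"
proof -
  interpret S: left_module R S using assms(1) by (simp add: simple_module_def)
  have "submodule ((\<lambda>a. a \<odot>\<^bsub>S\<^esub> s) ` K) R S" by (rule S.left_ideal_image_submodule[OF assms(4,2)])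
  moreover have "(\<lambda>a. a \<odot>\<^bsub>S\<^esub> s) ` K \<noteq> {\<zero>\<^bsub>S\<^esub>}" using assms(5,6) by blast
  ultimately show ?thesis using assms(1) unfolding simple_module_def by blast
qed

lemma simple_module_cyclic:
  assumes "simple_module R S" "s \<in> carrier S" "s \<noteq> \<zero>\<^bsub>S\<^esub>"
  shows "(\<lambda>a. a \<odot>\<^bsub>S\<^esub> s) ` carrier R = carrier S"
proof -
  interpret S: left_module R S using assms(1) by (simp add: simple_module_def)
  show ?thesis
    using simple_module_generated[OF assms carrier_left_ideal one_closed] assms S.smult_one by simp
qed

text \<open>An element of K outside N makes \<open>K s\<close> a nonzero submodule, hence all of S.
  So some b \<in> K fixes s, \<open>\<one> - b\<close> lies in N \<subseteq> K, and \<one> \<in> K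
  follows.\<close>

lemma simple_module_annihilator:
  assumes S: "simple_module R S" and s: "s \<in> carrier S" "s \<noteq> \<zero>\<^bsub>S\<^esub>"
  defines "N \<equiv> {a \<in> carrier R. a \<odot>\<^bsub>S\<^esub> s = \<zero>\<^bsub>S\<^esub>}"
  shows "left_ideal N R" "\<one> \<notin> N" "left_ideal K R \<Longrightarrow> N \<subseteq> K \<Longrightarrow> K = N \<or> K = carrier R"
proof -
  interpret S: left_module R S using S by (simp add: simple_module_def)
  show N: "left_ideal N R"
    by (rule left_idealI) (use s in \<open>auto simp: N_def S.smult_l_distr S.smult_assoc S.smult_zero_left S.smult_zero_right\<close>)
  show "\<one> \<notin> N" using s by (simp add: N_def S.smult_one)
  assume K: "left_ideal K R" "N \<subseteq> K"
  note KD = left_idealD[OF K(1)]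
  show "K = N \<or> K = carrier R"
  proof (rule disjCI)
    assume "K \<noteq> carrier R"
    have "k \<in> N" if "k \<in> K" for k
    proof (rule ccontr)
      assume "k \<notin> N"
      then have "(\<lambda>a. a \<odot>\<^bsub>S\<^esub> s) ` K = carrier S"
        using that KD(2)[OF that] by (intro simple_module_generated[OF S s K(1) that]) (auto simp: N_def)
      then obtain b where b: "b \<in> K" "b \<odot>\<^bsub>S\<^esub> s = \<one> \<odot>\<^bsub>S\<^esub> s" using s S.smult_one by (metis imageE)
      then have "\<one> \<ominus> b \<in> N" using S.smult_diff_eq_zero[of \<one> b s] s KD(2)[OF b(1)] by (simp add: N_def)
      then have "(\<one> \<ominus> b) \<oplus> b \<in> K" using K(2) b(1) KD(4) by (meson subsetD)
      then have "\<one> \<in> K" using KD(2)[OF b(1)] by (simp add: minus_add_cancel)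
      then have "K = carrier R" using KD(1) KD(6)[of _ \<one>] by auto
      then show False using \<open>K \<noteq> carrier R\<close> by blast
    qed
    then show "K = N" using K(2) by blast
  qed
qed

text \<open>S is R / N through a generator s. A functional f is determined by \<open>f s\<close>,
  which may be any element of l N; thus the dual of S is l N, and the double dual is Hom(l N, R).
  Evaluation at \<open>s c\<close> becomes right multiplication by c there, so surjectivity of the
  evaluation map is the last claim; its injectivity gives l N \<noteq> 0.\<close>

lemma reflexive_simple_module:
  assumes S: "simple_module (opposite_ring R) S" and refl: "reflexive (opposite_ring R) S"
  obtains N where "maximal_right_ideal N R" "left_annihilator R N \<noteq> {\<zero>}"
    "homs_are_right_multiplications (left_annihilator R N) R"
proof -
  let ?B = "opposite_ring R"
  interpret B: ring ?B by (rule ring_opposite)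
  interpret S: left_module ?B S using S by (simp add: simple_module_def)
  obtain s where s: "s \<in> carrier S" "s \<noteq> \<zero>\<^bsub>S\<^esub>"
    using S S.M.zero_closed by (auto simp: simple_module_def simp del: S.M.zero_closed)
  define N where "N = {a \<in> carrier R. a \<odot>\<^bsub>S\<^esub> s = \<zero>\<^bsub>S\<^esub>}"
  define P where "P = {x \<in> carrier R. \<forall>n\<in>N. x \<otimes> n = \<zero>}"
  note ann = B.simple_module_annihilator[OF S s, folded N_def, unfolded opposite_ring_simps, folded N_def]
  have max: "maximal_right_ideal N R"
    unfolding maximal_right_ideal_def using ann(1,3) ann(2) by (auto simp only: one_closed)
  have cyc: "\<exists>a\<in>carrier R. t = a \<odot>\<^bsub>S\<^esub> s" if "t \<in> carrier S" for t
    using B.simple_module_cyclic[OF S s] that by auto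
  have lin: "f (a \<odot>\<^bsub>S\<^esub> t) = f t \<otimes> a" if "f \<in> carrier (dual ?B S)" "a \<in> carrier R" "t \<in> carrier S" for f a t
    using that by (simp add: dual_def module_hom_def)
  have add: "f (t \<oplus>\<^bsub>S\<^esub> u) = f t \<oplus> f u" if "f \<in> carrier (dual ?B S)" "u \<in> carrier S" "t \<in> carrier S" for f u t
    using that by (simp add: dual_def module_hom_def)
  have clos: "f t \<in> carrier R" if "f \<in> carrier (dual ?B S)" "t \<in> carrier S" for f t
    using that by (auto simp add: dual_def module_hom_def)
  have zero: "f \<zero>\<^bsub>S\<^esub> = \<zero>" if "f \<in> carrier (dual ?B S)" for f
    using lin[OF that zero_closed s(1)] S.smult_zero_left[OF s(1)] clos[OF that s(1)] by simp
  have inP: "f s \<in> P" if "f \<in> carrier (dual ?B S)" for f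
    using clos[OF that s(1)] lin[OF that _ s(1)] zero[OF that] by (auto simp: P_def N_def) metis
  have ev: "evaluation ?B S \<in> module_hom ?B S (dual R (dual ?B S))"
    "bij_betw (evaluation ?B S) (carrier S) (carrier (dual R (dual ?B S)))"
    using refl by (auto simp: reflexive_def module_iso_def opposite_ring_opposite_ring)
  have evs: "evaluation ?B S t f = f t" if "t \<in> carrier S" "f \<in> carrier (dual ?B S)" for t f
    using that by (simp add: evaluation_def)
  \<comment> \<open>If P were zero, all functionals would vanish at s, and evaluation could not
    separate s from zero.\<close>
  have ne: "P \<noteq> {\<zero>}"
  proof
    assume P: "P = {\<zero>}"
    have "evaluation ?B S s = evaluation ?B S \<zero>\<^bsub>S\<^esub>"
      unfolding evaluation_def using s(1) inP zero P by (auto intro!: restrict_ext)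
    then show False using ev(2) s by (auto simp: bij_betw_def dest: inj_onD)
  qed
  have ext: "\<exists>c\<in>carrier R. \<forall>x\<in>P. \<phi> x = x \<otimes> c"
    if \<phi>: "\<phi> \<in> P \<rightarrow> carrier R" "\<And>x y. x \<in> P \<Longrightarrow> y \<in> P \<Longrightarrow> \<phi> (x \<oplus> y) = \<phi> x \<oplus> \<phi> y"
      "\<And>a x. a \<in> carrier R \<Longrightarrow> x \<in> P \<Longrightarrow> \<phi> (a \<otimes> x) = a \<otimes> \<phi> x" for \<phi>
  proof -
    \<comment> \<open>\<phi> read as an element of the double dual, along the identification of f
      with \<open>f s\<close>.\<close>
    define \<Phi> where "\<Phi> = (\<lambda>f\<in>carrier (dual ?B S). \<phi> (f s))"
    have dadd: "f \<oplus>\<^bsub>dual ?B S\<^esub> g \<in> carrier (dual ?B S) \<and> (f \<oplus>\<^bsub>dual ?B S\<^esub> g) s = f s \<oplus> g s"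
      if "f \<in> carrier (dual ?B S)" "g \<in> carrier (dual ?B S)" for f g
    proof -
      have "f \<oplus>\<^bsub>dual ?B S\<^esub> g = (\<lambda>m\<in>carrier S. f m \<oplus> g m)" by (simp add: dual_def)
      moreover have "(\<lambda>m\<in>carrier S. f m \<oplus> g m) \<in> module_hom ?B S (regular ?B)"
        unfolding module_hom_def
        using clos[OF that(1)] clos[OF that(2)] add[OF that(1)] add[OF that(2)] lin[OF that(1)] lin[OF that(2)]
        by (auto simp: S.smult_closed a_ac l_distr)
      ultimately show ?thesis using s by (simp add: dual_def)
    qed
    have dsmult: "a \<odot>\<^bsub>dual ?B S\<^esub> f \<in> carrier (dual ?B S) \<and> (a \<odot>\<^bsub>dual ?B S\<^esub> f) s = a \<otimes> f s"
      if "a \<in> carrier R" "f \<in> carrier (dual ?B S)" for a f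
    proof -
      have "a \<odot>\<^bsub>dual ?B S\<^esub> f = (\<lambda>m\<in>carrier S. a \<otimes> f m)" by (simp add: dual_def)
      moreover have "(\<lambda>m\<in>carrier S. a \<otimes> f m) \<in> module_hom ?B S (regular ?B)"
        unfolding module_hom_def
        using that(1) clos[OF that(2)] add[OF that(2)] lin[OF that(2)]
        by (auto simp: S.smult_closed r_distr m_assoc)
      ultimately show ?thesis using s by (simp add: dual_def)
    qed
    have "\<Phi> \<in> carrier (dual R (dual ?B S))"
      unfolding \<Phi>_def using \<phi> inP dadd dsmult
      by (auto simp: dual_def[of R "dual ?B S"] module_hom_def)
    then have "\<Phi> \<in> evaluation ?B S ` carrier S" using ev(2) by (simp add: bij_betw_imp_surj_on)
    then obtain t where t: "t \<in> carrier S" "evaluation ?B S t = \<Phi>" by blast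
    obtain c where c: "c \<in> carrier R" "t = c \<odot>\<^bsub>S\<^esub> s" using cyc[OF t(1)] by blast
    have "\<phi> x = x \<otimes> c" if x: "x \<in> P" for x
    proof -
      have xc: "x \<in> carrier R" using x by (simp add: P_def)
      \<comment> \<open>The functional with value x at s. The choice of a does not matter: two
        candidates differ by an element of N, and x annihilates N.\<close>
      define f where "f = (\<lambda>u\<in>carrier S. x \<otimes> (SOME a. a \<in> carrier R \<and> u = a \<odot>\<^bsub>S\<^esub> s))"
      have f: "f (a \<odot>\<^bsub>S\<^esub> s) = x \<otimes> a" if a: "a \<in> carrier R" for a
      proof -
        have ex: "\<exists>b. b \<in> carrier R \<and> a \<odot>\<^bsub>S\<^esub> s = b \<odot>\<^bsub>S\<^esub> s" using a by blast
        define b where "b = (SOME b. b \<in> carrier R \<and> a \<odot>\<^bsub>S\<^esub> s = b \<odot>\<^bsub>S\<^esub> s)"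
        have b: "b \<in> carrier R" "a \<odot>\<^bsub>S\<^esub> s = b \<odot>\<^bsub>S\<^esub> s"
          using someI_ex[OF ex] unfolding b_def by blast+
        have fb: "f (a \<odot>\<^bsub>S\<^esub> s) = x \<otimes> b" using a s S.smult_closed[of a s] by (simp add: f_def b_def)
        from b have "a \<ominus> b \<in> N" using a s S.smult_diff_eq_zero[of a b s] by (simp add: N_def)
        then have "x \<otimes> (a \<ominus> b) = \<zero>" using x by (simp add: P_def)
        moreover have "x \<otimes> ((a \<ominus> b) \<oplus> b) = x \<otimes> (a \<ominus> b) \<oplus> x \<otimes> b"
          using a b(1) xc by (simp add: r_distr)
        ultimately have "x \<otimes> a = x \<otimes> b" using a b(1) xc by (simp add: minus_add_cancel)
        then show ?thesis using fb by simp
      qed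
      have fd: "f \<in> carrier (dual ?B S)"
      proof -
        have "f (u \<oplus>\<^bsub>S\<^esub> v) = f u \<oplus> f v \<and> f u \<in> carrier R" if uv: "u \<in> carrier S" "v \<in> carrier S" for u v
        proof -
          obtain a b where "a \<in> carrier R" "b \<in> carrier R" "u = a \<odot>\<^bsub>S\<^esub> s" "v = b \<odot>\<^bsub>S\<^esub> s"
            using cyc[OF uv(1)] cyc[OF uv(2)] by blast
          then show ?thesis using f[of a] f[of b] f[of "a \<oplus> b"] s xc S.smult_l_distr[of a b s]
            by (simp add: r_distr)
        qed
        moreover have "f (b \<odot>\<^bsub>S\<^esub> u) = f u \<otimes> b" if bu: "b \<in> carrier R" "u \<in> carrier S" for u b
        proof -
          obtain a where "a \<in> carrier R" "u = a \<odot>\<^bsub>S\<^esub> s" using cyc[OF bu(2)] by blast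
          then show ?thesis using bu f[of a] f[of "a \<otimes> b"] s xc S.smult_assoc[of b a s]
            by (simp add: m_assoc)
        qed
        moreover have "f \<in> extensional (carrier S)" by (simp add: f_def)
        ultimately show ?thesis by (auto simp: dual_def module_hom_def PiE_def)
      qed
      have fs: "f s = x" using f[of \<one>] S.smult_one[OF s(1)] xc by simp
      have "\<phi> (f s) = f t" using evs[OF t(1) fd] t(2) fd by (simp add: \<Phi>_def)
      then show ?thesis using f[OF c(1)] c(2) fs by simp
    qed
    then show ?thesis using c(1) by blast
  qed
  have "homs_are_right_multiplications P R"
    unfolding homs_are_right_multiplications_def by (intro ballI impI ext) auto
  then show ?thesis using that[OF max] ne by (simp add: P_def left_annihilator_def)
qed

end

section \<open>Injectivity\<close>

text \<open>
  Partial extensions of a homomorphism are ordered by inclusion of their graphs. A graph that is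
  maximal has full domain, since for \<open>y\<close> outside the domain \<open>{a. a y \<in> domain}\<close> is a left ideal.
\<close>

lemma (in ring) Baer_criterion:
  fixes Q :: "('a, 'q, 'f) module_scheme" and TX :: "'x itself" and TY :: "'y itself"
  assumes Q: "left_module R Q"
    and ext: "\<And>I f. left_ideal I R \<Longrightarrow> f \<in> I \<rightarrow> carrier Q \<Longrightarrow>
      (\<And>x y. x \<in> I \<Longrightarrow> y \<in> I \<Longrightarrow> f (x \<oplus> y) = f x \<oplus>\<^bsub>Q\<^esub> f y) \<Longrightarrow>
      (\<And>a x. a \<in> carrier R \<Longrightarrow> x \<in> I \<Longrightarrow> f (a \<otimes> x) = a \<odot>\<^bsub>Q\<^esub> f x) \<Longrightarrow>
      \<exists>q\<in>carrier Q. \<forall>x\<in>I. f x = x \<odot>\<^bsub>Q\<^esub> q"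
  shows "injective_module TX TY R Q"
  unfolding injective_module_def
proof (intro conjI allI impI, rule Q)
  fix X :: "('a, 'x) module" and Y :: "('a, 'y) module" and i g
  assume "left_module R X \<and> left_module R Y \<and> i \<in> module_hom R X Y \<and> inj_on i (carrier X) \<and>
    g \<in> module_hom R X Q"
  then have XY: "left_module R X" "left_module R Y" and i: "i \<in> module_hom R X Y"
    and inj: "inj_on i (carrier X)" and g: "g \<in> module_hom R X Q" by auto
  interpret Q: left_module R Q by fact
  interpret X: left_module R X by fact
  interpret Y: left_module R Y by fact
  have iD: "i x \<in> carrier Y" "i (x \<oplus>\<^bsub>X\<^esub> x') = i x \<oplus>\<^bsub>Y\<^esub> i x'" "a \<in> carrier R \<Longrightarrow> i (a \<odot>\<^bsub>X\<^esub> x) = a \<odot>\<^bsub>Y\<^esub> i x"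
    and gD: "g x \<in> carrier Q" "g (x \<oplus>\<^bsub>X\<^esub> x') = g x \<oplus>\<^bsub>Q\<^esub> g x'" "a \<in> carrier R \<Longrightarrow> g (a \<odot>\<^bsub>X\<^esub> x) = a \<odot>\<^bsub>Q\<^esub> g x"
    if "x \<in> carrier X" "x' \<in> carrier X" for x x' a
    using i g that by (auto simp: module_hom_def)
  \<comment> \<open>Graphs of partial homomorphisms, as relations. Single-valuedness is required
    over zero only; \<open>Muniq\<close> recovers it everywhere by taking differences.\<close>
  define good where "good G \<longleftrightarrow> G \<subseteq> carrier Y \<times> carrier Q \<and> (\<forall>x\<in>carrier X. (i x, g x) \<in> G) \<and>
      (\<forall>y q y' q'. (y, q) \<in> G \<and> (y', q') \<in> G \<longrightarrow> (y \<oplus>\<^bsub>Y\<^esub> y', q \<oplus>\<^bsub>Q\<^esub> q') \<in> G) \<and>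
      (\<forall>a y q. a \<in> carrier R \<and> (y, q) \<in> G \<longrightarrow> (a \<odot>\<^bsub>Y\<^esub> y, a \<odot>\<^bsub>Q\<^esub> q) \<in> G) \<and>
      (\<forall>q. (\<zero>\<^bsub>Y\<^esub>, q) \<in> G \<longrightarrow> q = \<zero>\<^bsub>Q\<^esub>)" for G
  let ?G0 = "(\<lambda>x. (i x, g x)) ` carrier X"
  have G0: "good ?G0"
  proof -
    have z: "\<zero>\<^bsub>X\<^esub> \<in> carrier X" by simp
    have zero: "i \<zero>\<^bsub>X\<^esub> = \<zero>\<^bsub>Y\<^esub>" "g \<zero>\<^bsub>X\<^esub> = \<zero>\<^bsub>Q\<^esub>"
      using iD(3)[OF z z zero_closed] gD(3)[OF z z zero_closed]
      by (simp_all only: X.smult_zero_left[OF z] Y.smult_zero_left[OF iD(1)[OF z z]]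
          Q.smult_zero_left[OF gD(1)[OF z z]])
    show ?thesis
      unfolding good_def
    proof (intro conjI allI impI ballI)
      show "?G0 \<subseteq> carrier Y \<times> carrier Q" using iD(1) gD(1) by auto
      show "(i x, g x) \<in> ?G0" if "x \<in> carrier X" for x using that by auto
      show "q = \<zero>\<^bsub>Q\<^esub>" if zq: "(\<zero>\<^bsub>Y\<^esub>, q) \<in> ?G0" for q
      proof -
        obtain x where x: "x \<in> carrier X" "i x = i \<zero>\<^bsub>X\<^esub>" "q = g x" using zq zero(1) by auto
        then show ?thesis using inj_onD[OF inj x(2,1) z] zero(2) by simp
      qed
      show "(y \<oplus>\<^bsub>Y\<^esub> y', q \<oplus>\<^bsub>Q\<^esub> q') \<in> ?G0" if yq: "(y, q) \<in> ?G0 \<and> (y', q') \<in> ?G0" for y q y' q'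
      proof -
        obtain x x' where "x \<in> carrier X" "x' \<in> carrier X" "y = i x" "q = g x" "y' = i x'" "q' = g x'"
          using yq by blast
        then show ?thesis using iD(2)[of x x'] gD(2)[of x x'] by (intro image_eqI[of _ _ "x \<oplus>\<^bsub>X\<^esub> x'"]) auto
      qed
      show "(a \<odot>\<^bsub>Y\<^esub> y, a \<odot>\<^bsub>Q\<^esub> q) \<in> ?G0" if ay: "a \<in> carrier R \<and> (y, q) \<in> ?G0" for a y q
      proof -
        obtain x where "x \<in> carrier X" "y = i x" "q = g x" using ay by blast
        then show ?thesis using ay iD(3)[of x x a] gD(3)[of x x a] X.smult_closed
          by (intro image_eqI[of _ _ "a \<odot>\<^bsub>X\<^esub> x"]) auto
      qed
    qed
  qed
  have "\<Union>\<C> \<in> Collect good" if C: "\<C> \<noteq> {}" "subset.chain (Collect good) \<C>" for \<C>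
  proof -
    have g: "good G" if "G \<in> \<C>" for G using that C by (auto simp: subset_chain_def)
    have "good (\<Union>\<C>)"
      unfolding good_def[of "\<Union>\<C>"]
    proof (intro conjI allI impI ballI)
      show "\<Union>\<C> \<subseteq> carrier Y \<times> carrier Q" using g unfolding good_def by blast
      show "(i x, g x) \<in> \<Union>\<C>" if "x \<in> carrier X" for x using that C(1) g unfolding good_def by blast
      show "q = \<zero>\<^bsub>Q\<^esub>" if "(\<zero>\<^bsub>Y\<^esub>, q) \<in> \<Union>\<C>" for q using that g unfolding good_def by blast
      show "(y \<oplus>\<^bsub>Y\<^esub> y', q \<oplus>\<^bsub>Q\<^esub> q') \<in> \<Union>\<C>" if yq: "(y, q) \<in> \<Union>\<C> \<and> (y', q') \<in> \<Union>\<C>" for y q y' q'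
      proof -
        obtain G G' where G: "(y, q) \<in> G" "(y', q') \<in> G'" "G \<in> \<C>" "G' \<in> \<C>" using yq by blast
        then have "G \<subseteq> G' \<or> G' \<subseteq> G" using C by (auto simp: subset_chain_def)
        then obtain H where H: "H \<in> \<C>" "(y, q) \<in> H" "(y', q') \<in> H" using G by blast
        then have "(y \<oplus>\<^bsub>Y\<^esub> y', q \<oplus>\<^bsub>Q\<^esub> q') \<in> H" using g[OF H(1)] unfolding good_def by blast
        then show ?thesis using H(1) by blast
      qed
      show "(a \<odot>\<^bsub>Y\<^esub> y, a \<odot>\<^bsub>Q\<^esub> q) \<in> \<Union>\<C>" if ay: "a \<in> carrier R \<and> (y, q) \<in> \<Union>\<C>" for a y q
      proof -
        obtain H where H: "H \<in> \<C>" "(y, q) \<in> H" using ay by blast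
        then have "(a \<odot>\<^bsub>Y\<^esub> y, a \<odot>\<^bsub>Q\<^esub> q) \<in> H" using g[OF H(1)] ay unfolding good_def by blast
        then show ?thesis using H(1) by blast
      qed
    qed
    then show ?thesis by simp
  qed
  then have "\<exists>M\<in>Collect good. \<forall>G\<in>Collect good. M \<subseteq> G \<longrightarrow> G = M"
    using G0 by (intro subset_Zorn_nonempty) auto
  then obtain M where M: "good M" and Mmax: "\<And>G. good G \<Longrightarrow> M \<subseteq> G \<Longrightarrow> G = M" by blast
  note Msub = M[unfolded good_def, THEN conjunct1]
  have Mi: "\<And>x. x \<in> carrier X \<Longrightarrow> (i x, g x) \<in> M"
    and Madd: "\<And>y q y' q'. (y, q) \<in> M \<Longrightarrow> (y', q') \<in> M \<Longrightarrow> (y \<oplus>\<^bsub>Y\<^esub> y', q \<oplus>\<^bsub>Q\<^esub> q') \<in> M"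
    and Msm: "\<And>a y q. a \<in> carrier R \<Longrightarrow> (y, q) \<in> M \<Longrightarrow> (a \<odot>\<^bsub>Y\<^esub> y, a \<odot>\<^bsub>Q\<^esub> q) \<in> M"
    and M0: "\<And>q. (\<zero>\<^bsub>Y\<^esub>, q) \<in> M \<Longrightarrow> q = \<zero>\<^bsub>Q\<^esub>"
    using M unfolding good_def by blast+
  have Mneg: "(\<ominus>\<^bsub>Y\<^esub> y, \<ominus>\<^bsub>Q\<^esub> q) \<in> M" if "(y, q) \<in> M" for y q
    using Msm[OF _ that, of "\<ominus> \<one>"] that Msub by (auto simp: Y.smult_minus_one Q.smult_minus_one)
  have Muniq: "q = q'" if "(y, q) \<in> M" "(y, q') \<in> M" for y q q'
  proof -
    have c: "y \<in> carrier Y" "q \<in> carrier Q" "q' \<in> carrier Q" using that Msub by auto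
    have "(y \<oplus>\<^bsub>Y\<^esub> \<ominus>\<^bsub>Y\<^esub> y, q \<oplus>\<^bsub>Q\<^esub> \<ominus>\<^bsub>Q\<^esub> q') \<in> M" by (rule Madd[OF that(1) Mneg[OF that(2)]])
    then have "q \<oplus>\<^bsub>Q\<^esub> \<ominus>\<^bsub>Q\<^esub> q' = \<zero>\<^bsub>Q\<^esub>" using c by (intro M0) (simp add: Y.M.r_neg)
    then show ?thesis using c Q.M.minus_equality[of q "\<ominus>\<^bsub>Q\<^esub> q'"] by simp
  qed
  have dom: "\<exists>q. (y, q) \<in> M" if y: "y \<in> carrier Y" for y
  proof -
    define I where "I = {a \<in> carrier R. \<exists>q. (a \<odot>\<^bsub>Y\<^esub> y, q) \<in> M}"
    define f where "f a = (THE q. (a \<odot>\<^bsub>Y\<^esub> y, q) \<in> M)" for a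
    have f: "f a = q" if "(a \<odot>\<^bsub>Y\<^esub> y, q) \<in> M" for a q
      unfolding f_def using that Muniq by (intro the_equality) auto
    have fI: "(a \<odot>\<^bsub>Y\<^esub> y, f a) \<in> M" "a \<in> carrier R" if "a \<in> I" for a
      using that f by (auto simp: I_def)
    have zM: "(\<zero>\<^bsub>Y\<^esub>, \<zero>\<^bsub>Q\<^esub>) \<in> M"
      using Msm[OF zero_closed Mi[OF X.M.zero_closed]] iD(1)[of "\<zero>\<^bsub>X\<^esub>" "\<zero>\<^bsub>X\<^esub>"] gD(1)[of "\<zero>\<^bsub>X\<^esub>" "\<zero>\<^bsub>X\<^esub>"]
      by (simp add: Y.smult_zero_left Q.smult_zero_left)
    have addM: "((a \<oplus> b) \<odot>\<^bsub>Y\<^esub> y, f a \<oplus>\<^bsub>Q\<^esub> f b) \<in> M" if "a \<in> I" "b \<in> I" for a b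
      using Madd[OF fI(1)[OF that(1)] fI(1)[OF that(2)]] fI(2)[OF that(1)] fI(2)[OF that(2)] y
      by (simp add: Y.smult_l_distr)
    have smM: "((a \<otimes> b) \<odot>\<^bsub>Y\<^esub> y, a \<odot>\<^bsub>Q\<^esub> f b) \<in> M" if "a \<in> carrier R" "b \<in> I" for a b
      using Msm[OF that(1) fI(1)[OF that(2)]] fI(2)[OF that(2)] that(1) y by (simp add: Y.smult_assoc)
    have "left_ideal I R"
    proof (rule left_idealI)
      show "\<zero> \<in> I" using zM y by (auto simp: I_def Y.smult_zero_left)
      show "a \<oplus> b \<in> I" if "a \<in> I" "b \<in> I" for a b using addM[OF that] fI(2) that by (auto simp: I_def)
      show "a \<otimes> b \<in> I" if "a \<in> carrier R" "b \<in> I" for a b using smM[OF that] fI(2) that by (auto simp: I_def)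
    qed (auto simp: I_def)
    moreover have "f \<in> I \<rightarrow> carrier Q" using fI(1) Msub by blast
    \<comment> \<open>c is a possible value at y: on I, where \<open>a y\<close> already has an
      image, that image is \<open>a c\<close>.\<close>
    ultimately obtain c where c: "c \<in> carrier Q" "\<And>a. a \<in> I \<Longrightarrow> f a = a \<odot>\<^bsub>Q\<^esub> c"
      using ext[of I f] f[OF addM] f[OF smM] by blast
    define G where "G = {(z \<oplus>\<^bsub>Y\<^esub> a \<odot>\<^bsub>Y\<^esub> y, q \<oplus>\<^bsub>Q\<^esub> a \<odot>\<^bsub>Q\<^esub> c) |z q a. (z, q) \<in> M \<and> a \<in> carrier R}"
    have GI: "(z \<oplus>\<^bsub>Y\<^esub> a \<odot>\<^bsub>Y\<^esub> y, q \<oplus>\<^bsub>Q\<^esub> a \<odot>\<^bsub>Q\<^esub> c) \<in> G" if "(z, q) \<in> M" "a \<in> carrier R" for z q a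
      using that unfolding G_def by blast
    have GE: "\<exists>z q a. p = (z \<oplus>\<^bsub>Y\<^esub> a \<odot>\<^bsub>Y\<^esub> y, q \<oplus>\<^bsub>Q\<^esub> a \<odot>\<^bsub>Q\<^esub> c) \<and> (z, q) \<in> M \<and> a \<in> carrier R \<and>
        z \<in> carrier Y \<and> q \<in> carrier Q" if "p \<in> G" for p
      using that Msub unfolding G_def by blast
    have MG: "M \<subseteq> G"
    proof
      fix p assume p: "p \<in> M"
      obtain z q where zq: "p = (z, q)" by (cases p)
      then have "z \<in> carrier Y" "q \<in> carrier Q" using p Msub by auto
      then show "p \<in> G" using GI[of z q \<zero>] zq p y c(1) by (simp add: Y.smult_zero_left Q.smult_zero_left)
    qed
    have "good G"
      unfolding good_def
    proof (intro conjI allI impI ballI)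
      show "G \<subseteq> carrier Y \<times> carrier Q"
      proof
        fix p assume "p \<in> G"
        then show "p \<in> carrier Y \<times> carrier Q"
          using GE[of p] y c(1) Y.smult_closed Q.smult_closed by auto
      qed
      show "(i x, g x) \<in> G" if "x \<in> carrier X" for x using MG Mi[OF that] by blast
      show "(z \<oplus>\<^bsub>Y\<^esub> z', q \<oplus>\<^bsub>Q\<^esub> q') \<in> G" if zq: "(z, q) \<in> G \<and> (z', q') \<in> G" for z q z' q'
      proof -
        obtain u r a where u: "(z, q) = (u \<oplus>\<^bsub>Y\<^esub> a \<odot>\<^bsub>Y\<^esub> y, r \<oplus>\<^bsub>Q\<^esub> a \<odot>\<^bsub>Q\<^esub> c)" "(u, r) \<in> M" "a \<in> carrier R"
          "u \<in> carrier Y" "r \<in> carrier Q" using GE[of "(z, q)"] zq by blast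
        obtain v s b where v: "(z', q') = (v \<oplus>\<^bsub>Y\<^esub> b \<odot>\<^bsub>Y\<^esub> y, s \<oplus>\<^bsub>Q\<^esub> b \<odot>\<^bsub>Q\<^esub> c)" "(v, s) \<in> M" "b \<in> carrier R"
          "v \<in> carrier Y" "s \<in> carrier Q" using GE[of "(z', q')"] zq by blast
        have "z \<oplus>\<^bsub>Y\<^esub> z' = (u \<oplus>\<^bsub>Y\<^esub> v) \<oplus>\<^bsub>Y\<^esub> (a \<oplus> b) \<odot>\<^bsub>Y\<^esub> y"
          using u v y by (simp add: Y.smult_l_distr Y.smult_closed Y.M.a_ac)
        moreover have "q \<oplus>\<^bsub>Q\<^esub> q' = (r \<oplus>\<^bsub>Q\<^esub> s) \<oplus>\<^bsub>Q\<^esub> (a \<oplus> b) \<odot>\<^bsub>Q\<^esub> c"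
          using u v c(1) by (simp add: Q.smult_l_distr Q.smult_closed Q.M.a_ac)
        ultimately show ?thesis using GI[OF Madd[OF u(2) v(2)], of "a \<oplus> b"] u(3) v(3) by simp
      qed
      show "(b \<odot>\<^bsub>Y\<^esub> z, b \<odot>\<^bsub>Q\<^esub> q) \<in> G" if bz: "b \<in> carrier R \<and> (z, q) \<in> G" for b z q
      proof -
        obtain u r a where u: "(z, q) = (u \<oplus>\<^bsub>Y\<^esub> a \<odot>\<^bsub>Y\<^esub> y, r \<oplus>\<^bsub>Q\<^esub> a \<odot>\<^bsub>Q\<^esub> c)" "(u, r) \<in> M" "a \<in> carrier R"
          "u \<in> carrier Y" "r \<in> carrier Q" using GE[of "(z, q)"] bz by blast
        have "b \<odot>\<^bsub>Y\<^esub> z = b \<odot>\<^bsub>Y\<^esub> u \<oplus>\<^bsub>Y\<^esub> (b \<otimes> a) \<odot>\<^bsub>Y\<^esub> y" "b \<odot>\<^bsub>Q\<^esub> q = b \<odot>\<^bsub>Q\<^esub> r \<oplus>\<^bsub>Q\<^esub> (b \<otimes> a) \<odot>\<^bsub>Q\<^esub> c"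
          using u bz y c(1)
          by (simp_all add: Y.smult_r_distr Y.smult_closed Y.smult_assoc Q.smult_r_distr Q.smult_closed Q.smult_assoc)
        then show ?thesis using GI[OF Msm[OF _ u(2)], of b "b \<otimes> a"] u(3) bz by simp
      qed
      \<comment> \<open>If \<open>u + a y = 0\<close>, then \<open>a y = - u\<close> lies in the old
        domain, so a \<in> I, and the choice of c gives \<open>a c = - r\<close>.\<close>
      show "q = \<zero>\<^bsub>Q\<^esub>" if zq: "(\<zero>\<^bsub>Y\<^esub>, q) \<in> G" for q
      proof -
        obtain u r a where u: "\<zero>\<^bsub>Y\<^esub> = u \<oplus>\<^bsub>Y\<^esub> a \<odot>\<^bsub>Y\<^esub> y" "q = r \<oplus>\<^bsub>Q\<^esub> a \<odot>\<^bsub>Q\<^esub> c" "(u, r) \<in> M" "a \<in> carrier R"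
          "u \<in> carrier Y" "r \<in> carrier Q" using GE[OF zq] by auto
        have "a \<odot>\<^bsub>Y\<^esub> y = \<ominus>\<^bsub>Y\<^esub> u"
          using u y Y.smult_closed[OF u(4) y] by (metis Y.M.minus_equality Y.M.a_comm)
        then have "(a \<odot>\<^bsub>Y\<^esub> y, \<ominus>\<^bsub>Q\<^esub> r) \<in> M" using Mneg[OF u(3)] by simp
        moreover from this have "a \<in> I" using u(4) by (auto simp: I_def)
        ultimately have "a \<odot>\<^bsub>Q\<^esub> c = \<ominus>\<^bsub>Q\<^esub> r" using c(2)[of a] f[of a] by simp
        then show ?thesis using u by (simp add: Q.M.r_neg)
      qed
    qed
    then have "G = M" using Mmax MG by blast
    moreover have "(y, c) \<in> G" using GI[OF zM one_closed] y c(1) by (simp add: Y.smult_one Q.smult_one)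
    ultimately show ?thesis by blast
  qed
  define h where "h = (\<lambda>y\<in>carrier Y. THE q. (y, q) \<in> M)"
  have h: "h y = q" if "(y, q) \<in> M" for y q
    using that Muniq Msub by (auto simp: h_def intro!: the_equality)
  have hM: "(y, h y) \<in> M" if "y \<in> carrier Y" for y using dom[OF that] h by metis
  have "h \<in> module_hom R Y Q"
    unfolding module_hom_def
  proof (intro CollectI conjI ballI)
    show "h \<in> carrier Y \<rightarrow>\<^sub>E carrier Q" using hM Msub by (auto simp: h_def)
    show "h (y \<oplus>\<^bsub>Y\<^esub> y') = h y \<oplus>\<^bsub>Q\<^esub> h y'" if "y \<in> carrier Y" "y' \<in> carrier Y" for y y'
      by (rule h[OF Madd[OF hM[OF that(1)] hM[OF that(2)]]])
    show "h (a \<odot>\<^bsub>Y\<^esub> y) = a \<odot>\<^bsub>Q\<^esub> h y" if "a \<in> carrier R" "y \<in> carrier Y" for a y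
      by (rule h[OF Msm[OF that(1) hM[OF that(2)]]])
  qed
  then show "\<exists>h\<in>module_hom R Y Q. \<forall>x\<in>carrier X. h (i x) = g x" using h[OF Mi] by blast
qed

section \<open>Duals of reflexive simple modules\<close>

context ring
begin

lemma left_annihilator_left_ideal:
  assumes "N \<subseteq> carrier R"
  shows "left_ideal (left_annihilator R N) R"
  unfolding left_annihilator_def
proof (rule left_idealI)
  fix a x assume "a \<in> carrier R" "x \<in> {x \<in> carrier R. \<forall>n\<in>N. x \<otimes> n = \<zero>}"
  then show "a \<otimes> x \<in> {x \<in> carrier R. \<forall>n\<in>N. x \<otimes> n = \<zero>}" using assms by (auto simp: m_assoc subset_iff)
qed (use assms in \<open>auto simp: l_distr subset_iff\<close>)

text \<open>
  For \<open>y\<close> annihilated by \<open>M\<close>, the homomorphism \<open>k + a x \<mapsto> a y\<close> from \<open>P = K + A x\<close> to \<open>A\<close> is right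
  multiplication by some \<open>c\<close> with \<open>K c = 0\<close>. If \<open>y \<noteq> 0\<close>, then \<open>c \<notin> N\<close>, hence \<open>K = K (N + c A) = 0\<close>.
\<close>

lemma left_annihilator_simple:
  assumes art: "artinian_left (opposite_ring R)"
    and cpm: "\<And>N. maximal_right_ideal N R \<Longrightarrow> completely_prime_maximal N R"
    and N: "maximal_right_ideal N R"
  defines "P \<equiv> left_annihilator R N"
  assumes P: "P \<noteq> {\<zero>}" and ext: "homs_are_right_multiplications P R"
  shows "\<exists>M. maximal_right_ideal M R \<and>
    (\<forall>y\<in>carrier R. y \<noteq> \<zero> \<and> (\<forall>m\<in>M. m \<otimes> y = \<zero>) \<longrightarrow>
      (\<exists>x\<in>P. x \<noteq> \<zero> \<and> (\<forall>m\<in>M. m \<otimes> x = \<zero>) \<and> P = {a \<otimes> x |a. a \<in> carrier R} \<and>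
        (\<forall>z\<in>carrier R. (\<forall>m\<in>M. m \<otimes> z = \<zero>) \<longrightarrow> (\<exists>c\<in>carrier R. z = x \<otimes> c))))"
proof -
  have Nsub: "N \<subseteq> carrier R" by (rule right_idealD(1)[OF maximal_right_idealD(1)[OF N]])
  have Pl: "left_ideal P R" unfolding P_def by (rule left_annihilator_left_ideal[OF Nsub])
  note PD = left_idealD[OF Pl]
  obtain M K x where M: "maximal_right_ideal M R" and K: "left_ideal K R" "K \<subseteq> P" and x: "x \<in> P" "x \<notin> K"
    and MP: "\<And>n p. n \<in> M \<Longrightarrow> p \<in> P \<Longrightarrow> n \<otimes> p \<in> K"
    and PK: "P = {k \<oplus> a \<otimes> x |k a. k \<in> K \<and> a \<in> carrier R}"
    by (rule left_ideal_maximal_sub[OF art cpm Pl P]) (assumption | rule that)+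
  note KD = left_idealD[OF K(1)]
  note Mcp = cpm[OF M, unfolded completely_prime_maximal_def]
  have xc: "x \<in> carrier R" by (rule PD(2)[OF x(1)])
  have Msub: "M \<subseteq> carrier R" by (rule right_idealD(1)[OF maximal_right_idealD(1)[OF M]])
  \<comment> \<open>Together with M x \<subseteq> K this makes M the annihilator of x modulo K, so P
    / K is A / M.\<close>
  have xM: "a \<in> M" if a: "a \<in> carrier R" "a \<otimes> x \<in> K" for a
  proof (rule ccontr)
    assume "a \<notin> M"
    then obtain b where b: "b \<in> carrier R" "b \<otimes> a \<ominus> \<one> \<in> M" using Mcp a(1) by blast
    have "b \<otimes> (a \<otimes> x) \<ominus> (b \<otimes> a \<ominus> \<one>) \<otimes> x \<in> K"
      by (rule KD(5)[OF KD(6)[OF b(1) a(2)] MP[OF b(2) x(1)]])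
    moreover have "b \<otimes> (a \<otimes> x) \<ominus> (b \<otimes> a \<ominus> \<one>) \<otimes> x = x"
      using a(1) b(1) xc by (simp add: a_minus_def l_distr l_minus minus_add m_assoc[symmetric] r_neg1 r_neg2)
    ultimately show False using x(2) by simp
  qed
  \<comment> \<open>The map P \<rightarrow> P / K = A / M \<rightarrow> A determined by z is a right
    multiplication; its c annihilates K and takes x to z.\<close>
  have mult: "\<exists>c\<in>carrier R. (\<forall>k\<in>K. k \<otimes> c = \<zero>) \<and> x \<otimes> c = z"
    if z: "z \<in> carrier R" "\<And>m. m \<in> M \<Longrightarrow> m \<otimes> z = \<zero>" for z
  proof -
    \<comment> \<open>In \<open>p = k + a x\<close> the coefficient a is unique only modulo M, by
      \<open>xM\<close>; as M z = 0, the value \<open>a z\<close> is well defined.\<close>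
    define \<phi> where "\<phi> p = (SOME w. \<exists>k a. p = k \<oplus> a \<otimes> x \<and> k \<in> K \<and> a \<in> carrier R \<and> w = a \<otimes> z)" for p
    have \<phi>: "\<phi> (k \<oplus> a \<otimes> x) = a \<otimes> z" if ka: "k \<in> K" "a \<in> carrier R" for k a
    proof -
      have "\<exists>w l b. k \<oplus> a \<otimes> x = l \<oplus> b \<otimes> x \<and> l \<in> K \<and> b \<in> carrier R \<and> w = b \<otimes> z" using ka by blast
      from someI_ex[OF this] obtain l b where lb: "k \<oplus> a \<otimes> x = l \<oplus> b \<otimes> x" "l \<in> K" "b \<in> carrier R"
        "\<phi> (k \<oplus> a \<otimes> x) = b \<otimes> z" unfolding \<phi>_def by blast
      have "(a \<ominus> b) \<otimes> x = l \<ominus> k"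
      proof -
        have kc: "k \<in> carrier R" "l \<in> carrier R" using ka lb KD(2) by auto
        have "(a \<ominus> b) \<otimes> x = (k \<oplus> a \<otimes> x) \<ominus> k \<ominus> b \<otimes> x"
          using ka(2) lb(3) xc kc by (simp add: a_minus_def l_distr l_minus a_ac r_neg1 r_neg2)
        also have "\<dots> = l \<ominus> k" unfolding lb(1)
          using lb(3) xc kc by (simp add: a_minus_def a_ac r_neg1 r_neg2 r_neg)
        finally show ?thesis .
      qed
      then have "(a \<ominus> b) \<otimes> x \<in> K" using KD(5)[OF lb(2) ka(1)] by simp
      then have "(a \<ominus> b) \<otimes> z = \<zero>" using xM[of "a \<ominus> b"] z(2) ka lb by simp
      moreover have "((a \<ominus> b) \<oplus> b) \<otimes> z = (a \<ominus> b) \<otimes> z \<oplus> b \<otimes> z"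
        using ka(2) lb(3) z(1) by (simp add: l_distr)
      ultimately show ?thesis using lb(3,4) ka(2) z(1) by (simp add: minus_add_cancel)
    qed
    have PE: "\<exists>k a. p = k \<oplus> a \<otimes> x \<and> k \<in> K \<and> k \<in> carrier R \<and> a \<in> carrier R" if "p \<in> P" for p
      using that KD(2) PK by blast
    have "\<exists>c\<in>carrier R. \<forall>x\<in>P. \<phi> x = x \<otimes> c"
    proof (rule homs_are_right_multiplicationsD[OF ext])
      show "\<phi> \<in> P \<rightarrow> carrier R"
      proof
        fix p assume "p \<in> P"
        then obtain k a where "p = k \<oplus> a \<otimes> x" "k \<in> K" "a \<in> carrier R" using PE by blast
        then show "\<phi> p \<in> carrier R" using \<phi>[of k a] z(1) by simp
      qed
    next
      fix p q assume "p \<in> P" "q \<in> P"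
      then obtain k a l b where "p = k \<oplus> a \<otimes> x" "k \<in> K" "k \<in> carrier R" "a \<in> carrier R"
        "q = l \<oplus> b \<otimes> x" "l \<in> K" "l \<in> carrier R" "b \<in> carrier R" using PE by metis
      moreover from this have "p \<oplus> q = (k \<oplus> l) \<oplus> (a \<oplus> b) \<otimes> x" using xc by (simp add: l_distr a_ac)
      ultimately show "\<phi> (p \<oplus> q) = \<phi> p \<oplus> \<phi> q" using \<phi> KD(4)[of k l] z(1) by (simp add: l_distr)
    next
      fix b p assume b: "b \<in> carrier R" and "p \<in> P"
      then obtain k a where "p = k \<oplus> a \<otimes> x" "k \<in> K" "k \<in> carrier R" "a \<in> carrier R" using PE by blast
      moreover from this have "b \<otimes> p = b \<otimes> k \<oplus> (b \<otimes> a) \<otimes> x" using xc b by (simp add: r_distr m_assoc)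
      ultimately show "\<phi> (b \<otimes> p) = b \<otimes> \<phi> p" using \<phi> KD(6)[of b k] z(1) b by (simp add: m_assoc)
    qed
    then obtain c where c: "c \<in> carrier R" "\<And>p. p \<in> P \<Longrightarrow> \<phi> p = p \<otimes> c" by blast
    have "k \<otimes> c = \<zero>" if k: "k \<in> K" for k
      using c(2)[of k] \<phi>[OF k zero_closed] k K(2) KD(2)[OF k] z(1) xc by auto
    moreover have "x \<otimes> c = z" using c(2)[OF x(1)] \<phi>[OF KD(3) one_closed] xc z(1) by simp
    ultimately show ?thesis using c(1) by blast
  qed
  have "\<exists>x\<in>P. x \<noteq> \<zero> \<and> (\<forall>m\<in>M. m \<otimes> x = \<zero>) \<and> P = {a \<otimes> x |a. a \<in> carrier R} \<and>
        (\<forall>z\<in>carrier R. (\<forall>m\<in>M. m \<otimes> z = \<zero>) \<longrightarrow> (\<exists>c\<in>carrier R. z = x \<otimes> c))"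
    if y: "y \<in> carrier R" "y \<noteq> \<zero>" "\<And>m. m \<in> M \<Longrightarrow> m \<otimes> y = \<zero>" for y
  proof -
    obtain c where c: "c \<in> carrier R" "\<And>k. k \<in> K \<Longrightarrow> k \<otimes> c = \<zero>" "x \<otimes> c = y" using mult[OF y(1,3)] by blast
    define C where "C = {c \<in> carrier R. \<forall>k\<in>K. k \<otimes> c = \<zero>}"
    have "right_ideal C R"
      by (rule right_idealI) (use KD(2) in \<open>auto simp: C_def r_distr m_assoc[symmetric]\<close>)
    moreover have "N \<subseteq> C" using Nsub K(2) by (auto simp: C_def P_def left_annihilator_def)
    \<comment> \<open>c lies outside N because x annihilates N but \<open>x c = y\<close> is
      nonzero.\<close>
    moreover have "c \<in> C" "c \<notin> N" using c x(1) y(2) by (auto simp: C_def P_def left_annihilator_def)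
    ultimately have "C = carrier R" using N unfolding maximal_right_ideal_def by blast
    then have "\<one> \<in> C" by simp
    then have K0: "k = \<zero>" if "k \<in> K" for k using that KD(2)[OF that] by (auto simp: C_def)
    have "{k \<oplus> a \<otimes> x |k a. k \<in> K \<and> a \<in> carrier R} = {a \<otimes> x |a. a \<in> carrier R}"
      using K0 KD(3) xc by (force intro!: Collect_cong)
    then have "P = {a \<otimes> x |a. a \<in> carrier R}" using PK by simp
    moreover have "x \<noteq> \<zero>" using x(2) KD(3) by auto
    moreover have "\<forall>m\<in>M. m \<otimes> x = \<zero>" using MP[OF _ x(1)] K0 by blast
    moreover have "\<exists>c\<in>carrier R. z = x \<otimes> c" if "z \<in> carrier R" "\<forall>m\<in>M. m \<otimes> z = \<zero>" for z
      using mult[of z] that by blast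
    ultimately show ?thesis using x(1) by blast
  qed
  then show ?thesis using M by (intro exI[of _ M]) simp
qed

end

section \<open>Simple quotients\<close>

context ring
begin

text \<open>T is R / N and t the class of \<one>. Chosen representatives of the cosets form a module
  \<open>T0\<close> on the type \<open>'a\<close>; \<open>simple_representative\<close> then moves
  it to \<open>'a set\<close>, the type over which the theorem quantifies.\<close>

lemma simple_quotient:
  assumes N: "left_ideal N R" "\<one> \<notin> N"
    and max: "\<And>L. left_ideal L R \<Longrightarrow> N \<subseteq> L \<Longrightarrow> L = N \<or> L = carrier R"
  obtains T :: "('a, 'a set) module" and t where
    "simple_module R T" "t \<in> carrier T" "t \<noteq> \<zero>\<^bsub>T\<^esub>" "{a \<in> carrier R. a \<odot>\<^bsub>T\<^esub> t = \<zero>\<^bsub>T\<^esub>} = N"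
proof -
  note ND = left_idealD[OF N(1)]
  have diff_sym: "y \<ominus> x \<in> N" if "x \<in> carrier R" "y \<in> carrier R" "x \<ominus> y \<in> N" for x y
    using ND(5)[OF ND(3) that(3)] that(1,2) by (simp add: a_minus_def minus_add a_comm)
  have diff_trans: "x \<ominus> z \<in> N"
    if "x \<in> carrier R" "y \<in> carrier R" "z \<in> carrier R" "x \<ominus> y \<in> N" "y \<ominus> z \<in> N" for x y z
    using ND(4)[OF that(4,5)] that(1-3) by (simp add: a_minus_def a_assoc r_neg1)
  define rep where "rep x = (SOME y. y \<in> carrier R \<and> x \<ominus> y \<in> N)" for x
  have rep: "rep x \<in> carrier R" "x \<ominus> rep x \<in> N" if "x \<in> carrier R" for x
  proof -
    have "\<exists>y. y \<in> carrier R \<and> x \<ominus> y \<in> N" using that ND(3) by (intro exI[of _ x]) (simp add: a_minus_def r_neg)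
    from someI_ex[OF this] show "rep x \<in> carrier R" "x \<ominus> rep x \<in> N" unfolding rep_def by auto
  qed
  have rep_eq: "rep x = rep y \<longleftrightarrow> x \<ominus> y \<in> N" if "x \<in> carrier R" "y \<in> carrier R" for x y
  proof
    assume "rep x = rep y"
    then show "x \<ominus> y \<in> N"
      using diff_trans[of x "rep x" y] diff_sym[of y "rep y"] rep[OF that(1)] rep[OF that(2)] that by simp
  next
    assume "x \<ominus> y \<in> N"
    then have "x \<ominus> z \<in> N \<longleftrightarrow> y \<ominus> z \<in> N" if "z \<in> carrier R" for z
      using diff_trans[of x y z] diff_trans[of y x z] diff_sym[of x y] \<open>x \<in> carrier R\<close> \<open>y \<in> carrier R\<close> that
      by blast
    then have "(\<lambda>z. z \<in> carrier R \<and> x \<ominus> z \<in> N) = (\<lambda>z. z \<in> carrier R \<and> y \<ominus> z \<in> N)" by blast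
    then show "rep x = rep y" by (simp add: rep_def)
  qed
  have rep_rep: "rep (rep x) = rep x" if "x \<in> carrier R" for x
    using rep_eq[of "rep x" x] rep[OF that] diff_sym[of x "rep x"] that by simp
  \<comment> \<open>Inside an outer \<open>rep\<close>, inner occurrences of \<open>rep\<close> may
    be dropped; these rules reduce the module axioms of \<open>T0\<close> to the ring axioms of
    R.\<close>
  have rep_add: "rep (rep x \<oplus> y) = rep (x \<oplus> y)" "rep (y \<oplus> rep x) = rep (y \<oplus> x)"
    if "x \<in> carrier R" "y \<in> carrier R" for x y
  proof -
    have "(x \<oplus> y) \<ominus> (rep x \<oplus> y) = x \<ominus> rep x"
      using that rep[OF that(1)] by (simp add: a_minus_def minus_add a_ac r_neg1 r_neg2 r_neg)
    then show "rep (rep x \<oplus> y) = rep (x \<oplus> y)"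
      using rep_eq[of "x \<oplus> y" "rep x \<oplus> y"] rep[OF that(1)] that by simp
    then show "rep (y \<oplus> rep x) = rep (y \<oplus> x)" using that rep[OF that(1)] by (simp add: a_comm)
  qed
  have rep_mult: "rep (a \<otimes> rep x) = rep (a \<otimes> x)" if "a \<in> carrier R" "x \<in> carrier R" for a x
  proof -
    have "a \<otimes> x \<ominus> a \<otimes> rep x = a \<otimes> (x \<ominus> rep x)"
      using that rep[OF that(2)] by (simp add: a_minus_def r_distr r_minus)
    then show ?thesis using ND(6)[OF that(1) rep(2)[OF that(2)]] rep_eq[of "a \<otimes> x" "a \<otimes> rep x"]
        rep[OF that(2)] that by simp
  qed
  have rep_mult_mult: "rep (a \<otimes> (b \<otimes> rep x)) = rep (a \<otimes> (b \<otimes> x))"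
    if "a \<in> carrier R" "b \<in> carrier R" "x \<in> carrier R" for a b x
    using rep_mult[of "a \<otimes> b" x] rep that by (simp add: m_assoc)
  have rep_add_mult: "rep (a \<otimes> rep x \<oplus> b \<otimes> rep x) = rep (a \<otimes> x \<oplus> b \<otimes> x)"
    if "a \<in> carrier R" "b \<in> carrier R" "x \<in> carrier R" for a b x
    using rep_mult[of "a \<oplus> b" x] rep that by (simp add: l_distr)
  define T0 :: "('a, 'a) module" where
    "T0 = \<lparr>carrier = rep ` carrier R, mult = undefined, one = undefined, zero = rep \<zero>,
           add = (\<lambda>x y. rep (x \<oplus> y)), smult = (\<lambda>a x. rep (a \<otimes> x))\<rparr>"
  have T0: "carrier T0 = rep ` carrier R" "\<zero>\<^bsub>T0\<^esub> = rep \<zero>" "x \<oplus>\<^bsub>T0\<^esub> y = rep (x \<oplus> y)"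
    "a \<odot>\<^bsub>T0\<^esub> x = rep (a \<otimes> x)" for x y a by (simp_all add: T0_def)
  have "abelian_group T0"
  proof (rule abelian_groupI, goal_cases)
    case (3 x y z)
    then obtain x' y' z' where "x' \<in> carrier R" "y' \<in> carrier R" "z' \<in> carrier R"
      "x = rep x'" "y = rep y'" "z = rep z'" by (auto simp: T0)
    moreover from this have "rep ((x' \<oplus> y') \<oplus> rep z') = rep (x' \<oplus> (y' \<oplus> z'))"
      using rep_add(2)[of z' "x' \<oplus> y'"] by (simp add: a_assoc)
    ultimately show ?case by (simp add: T0 rep rep_add)
  next
    case (6 x)
    then obtain y where "y \<in> carrier R" "x = rep y" by (auto simp: T0)
    then show ?case by (intro bexI[of _ "rep (\<ominus> y)"]) (auto simp: T0 rep rep_add l_neg)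
  qed (auto simp: T0 rep rep_add rep_rep a_comm)
  then have T0_mod: "left_module R T0"
    unfolding left_module_def left_module_axioms_def
    by (auto simp: ring_axioms T0 rep rep_add rep_rep rep_mult rep_mult_mult rep_add_mult l_distr r_distr m_assoc)
  interpret T0: left_module R T0 by (rule T0_mod)
  have "H = {\<zero>\<^bsub>T0\<^esub>} \<or> H = carrier T0" if H: "submodule H R T0" for H
  proof -
    interpret H: submodule H R T0 by (rule H)
    have Hsub: "H \<subseteq> rep ` carrier R" using H.subset by (simp add: T0)
    define L where "L = {x \<in> carrier R. rep x \<in> H}"
    have HL: "H = rep ` L" using Hsub by (auto simp: L_def)
    have "left_ideal L R"
    proof (rule left_idealI)
      show "\<zero> \<in> L" using H.one_closed by (simp add: L_def T0)
      show "x \<oplus> y \<in> L" if "x \<in> L" "y \<in> L" for x y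
        using that H.m_closed[of "rep x" "rep y"] by (auto simp: L_def T0 rep rep_add)
      show "a \<otimes> x \<in> L" if "a \<in> carrier R" "x \<in> L" for a x
        using that H.smult_closed[of a "rep x"] by (auto simp: L_def T0 rep rep_mult)
    qed (auto simp: L_def)
    moreover have "N \<subseteq> L"
    proof
      fix x assume x: "x \<in> N"
      then have "rep x = rep \<zero>" using rep_eq[of x \<zero>] ND(2)[OF x] by (simp add: a_minus_def)
      then show "x \<in> L" using H.one_closed ND(2)[OF x] by (simp add: L_def T0)
    qed
    ultimately have "L = N \<or> L = carrier R" by (rule max)
    moreover have "rep ` N = {rep \<zero>}"
      using ND(3) rep_eq[of _ \<zero>] ND(2) by (auto simp: a_minus_def intro!: image_eqI[of _ _ \<zero>])
    ultimately show ?thesis using HL by (auto simp: T0)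
  qed
  moreover have one: "rep \<one> \<in> carrier T0" "rep \<one> \<noteq> \<zero>\<^bsub>T0\<^esub>"
    using N(2) rep_eq[of \<one> \<zero>] by (auto simp: T0 a_minus_def)
  ultimately have "simple_module R T0" using T0_mod unfolding simple_module_def by blast
  moreover have "{a \<in> carrier R. a \<odot>\<^bsub>T0\<^esub> rep \<one> = \<zero>\<^bsub>T0\<^esub>} = N"
    using ND(2) rep_eq[of _ \<zero>] rep_mult[of _ \<one>] by (auto simp: T0 a_minus_def)
  moreover obtain T :: "('a, 'a set) module" where T: "simple_module R T" "isomorphic R T0 T"
    using simple_representative \<open>simple_module R T0\<close> by metis
  moreover obtain \<psi> where \<psi>: "\<psi> \<in> module_hom R T0 T" "inj_on \<psi> (carrier T0)"
    using T(2) by (auto simp: isomorphic_def module_iso_def bij_betw_def)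
  interpret T: left_module R T using T(1) by (simp add: simple_module_def)
  have z: "\<zero>\<^bsub>T0\<^esub> \<in> carrier T0" by simp
  have \<psi>D: "\<psi> x \<in> carrier T" "a \<in> carrier R \<Longrightarrow> \<psi> (a \<odot>\<^bsub>T0\<^esub> x) = a \<odot>\<^bsub>T\<^esub> \<psi> x" if "x \<in> carrier T0" for a x
    using \<psi>(1) that by (auto simp: module_hom_def)
  have \<psi>0: "\<psi> \<zero>\<^bsub>T0\<^esub> = \<zero>\<^bsub>T\<^esub>"
    using \<psi>D(2)[OF z zero_closed] by (simp only: T0.smult_zero_left[OF z] T.smult_zero_left[OF \<psi>D(1)[OF z]])
  have \<psi>eq: "\<psi> x = \<zero>\<^bsub>T\<^esub> \<longleftrightarrow> x = \<zero>\<^bsub>T0\<^esub>" if "x \<in> carrier T0" for x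
    using inj_onD[OF \<psi>(2) _ that z] \<psi>0 by auto
  have "a \<odot>\<^bsub>T\<^esub> \<psi> (rep \<one>) = \<zero>\<^bsub>T\<^esub> \<longleftrightarrow> a \<odot>\<^bsub>T0\<^esub> rep \<one> = \<zero>\<^bsub>T0\<^esub>" if "a \<in> carrier R" for a
    using \<psi>eq[OF T0.smult_closed[OF that one(1)]] \<psi>D(2)[OF one(1) that] by simp
  ultimately show ?thesis
    using that[of T "\<psi> (rep \<one>)"] \<psi>D(1)[OF one(1)] \<psi>eq[OF one(1)] one(2) by auto
qed

text \<open>An embedding \<psi> of U \<oplus> U into R gives y = \<psi>(u, 0) and z = \<psi>(0, u).
  Linearity passes the annihilator of u on to both, and \<open>a z = \<psi>(0, a u)\<close> differs
  from y in the first coordinate.\<close>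

lemma square_in_regular_socle_pair:
  assumes U: "simple_module R U" and sq: "square_in_regular_socle R U"
    and u: "u \<in> carrier U" "u \<noteq> \<zero>\<^bsub>U\<^esub>"
  obtains y z where "y \<in> carrier R" "z \<in> carrier R" "y \<noteq> \<zero>"
    "\<And>a. a \<in> carrier R \<Longrightarrow> a \<odot>\<^bsub>U\<^esub> u = \<zero>\<^bsub>U\<^esub> \<Longrightarrow> a \<otimes> y = \<zero> \<and> a \<otimes> z = \<zero>"
    "\<And>a. a \<in> carrier R \<Longrightarrow> y \<noteq> a \<otimes> z" "z \<noteq> \<zero>"
proof -
  interpret U: left_module R U using U by (simp add: simple_module_def)
  let ?UU = "direct_sum U U"
  obtain H where H: "direct_summand H R (regular_socle R)"
    "isomorphic R ?UU ((regular_socle R)\<lparr>carrier := H\<rparr>)"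
    using sq by (auto simp: square_in_regular_socle_def)
  have "socle R (regular R) \<subseteq> carrier R"
  proof -
    have "carrier R \<in> {H. left_ideal H R \<and>
        (\<forall>S. left_ideal S R \<and> simple_module R ((regular R)\<lparr>carrier := S\<rparr>) \<longrightarrow> S \<subseteq> H)}"
      using carrier_left_ideal left_idealD(1) by blast
    then show ?thesis unfolding socle_def by (rule Inter_lower)
  qed
  moreover have "H \<subseteq> socle R (regular R)"
    using H(1) subgroup.subset[OF submodule.axioms(1)] by (fastforce simp: direct_summand_def regular_socle_def)
  ultimately have Hsub: "H \<subseteq> carrier R" by blast
  obtain \<psi> where \<psi>: "\<psi> \<in> module_hom R ?UU ((regular_socle R)\<lparr>carrier := H\<rparr>)" "inj_on \<psi> (carrier ?UU)"
    using H(2) by (auto simp: isomorphic_def module_iso_def bij_betw_def)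
  have car: "\<psi> (v, w) \<in> carrier R" if "v \<in> carrier U" "w \<in> carrier U" for v w
    using \<psi>(1) that Hsub by (auto simp: module_hom_def direct_sum_def)
  have lin: "\<psi> (a \<odot>\<^bsub>U\<^esub> v, a \<odot>\<^bsub>U\<^esub> w) = a \<otimes> \<psi> (v, w)"
    if "a \<in> carrier R" "v \<in> carrier U" "w \<in> carrier U" for a v w
    using \<psi>(1) that by (auto simp: module_hom_def direct_sum_def regular_socle_def)
  have inj: "v = v' \<and> w = w'" if "\<psi> (v, w) = \<psi> (v', w')" "v \<in> carrier U" "w \<in> carrier U"
    "v' \<in> carrier U" "w' \<in> carrier U" for v w v' w'
    using inj_onD[OF \<psi>(2) that(1)] that(2-) by (auto simp: direct_sum_def)
  have z: "\<zero>\<^bsub>U\<^esub> \<in> carrier U" by simp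
  have zero: "\<psi> (\<zero>\<^bsub>U\<^esub>, \<zero>\<^bsub>U\<^esub>) = \<zero>"
    using lin[OF zero_closed z z] car[OF z z] by (simp add: U.smult_zero_left)
  show ?thesis
  proof (rule that[of "\<psi> (u, \<zero>\<^bsub>U\<^esub>)" "\<psi> (\<zero>\<^bsub>U\<^esub>, u)"])
    show "\<psi> (u, \<zero>\<^bsub>U\<^esub>) \<noteq> \<zero>" using inj[OF _ u(1) z z z] u(2) zero by auto
    show "\<psi> (\<zero>\<^bsub>U\<^esub>, u) \<noteq> \<zero>" using inj[OF _ z u(1) z z] u(2) zero by auto
    show "a \<otimes> \<psi> (u, \<zero>\<^bsub>U\<^esub>) = \<zero> \<and> a \<otimes> \<psi> (\<zero>\<^bsub>U\<^esub>, u) = \<zero>"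
      if "a \<in> carrier R" "a \<odot>\<^bsub>U\<^esub> u = \<zero>\<^bsub>U\<^esub>" for a
      using lin[OF that(1) u(1) z] lin[OF that(1) z u(1)] that(2) zero U.smult_zero_right[OF that(1)] by simp
    show "\<psi> (u, \<zero>\<^bsub>U\<^esub>) \<noteq> a \<otimes> \<psi> (\<zero>\<^bsub>U\<^esub>, u)" if "a \<in> carrier R" for a
      using lin[OF that z u(1)] inj[of u "\<zero>\<^bsub>U\<^esub>" "a \<odot>\<^bsub>U\<^esub> \<zero>\<^bsub>U\<^esub>" "a \<odot>\<^bsub>U\<^esub> u"] u z that
      by (auto simp: U.smult_zero_right U.smult_closed)
  qed (use car u z in auto)
qed

text \<open>The dual of a reflexive simple module is simple, which leaves no room for a square in the socle.\<close>

lemma not_all_simple_reflexive: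
  assumes art: "artinian_left (opposite_ring R)"
    and cpm: "\<And>N. maximal_right_ideal N R \<Longrightarrow> completely_prime_maximal N R"
    and nz: "carrier R \<noteq> {\<zero>}"
    and sq: "\<And>U :: ('a, 'a set) module. simple_module R U \<Longrightarrow> square_in_regular_socle R U"
    and refl: "\<And>S :: ('a, 'a set) module. simple_module (opposite_ring R) S \<Longrightarrow> reflexive (opposite_ring R) S"
  shows False
proof -
  have "right_ideal {\<zero>} R" by (rule right_idealI) auto
  moreover have "\<one> \<noteq> \<zero>" using nz one_zeroD by auto
  ultimately obtain N0 where N0: "maximal_right_ideal N0 R"
    using maximal_right_ideal_exists[of "{\<zero>}"] by auto
  have "\<And>L. right_ideal L R \<Longrightarrow> N0 \<subseteq> L \<Longrightarrow> L = N0 \<or> L = carrier R"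
    using N0 unfolding maximal_right_ideal_def by blast
  then obtain S :: "('a, 'a set) module" where S: "simple_module (opposite_ring R) S"
    using ring.simple_quotient[OF ring_opposite maximal_right_idealD(1)[OF N0]] maximal_right_idealD(2)[OF N0]
    by (metis opposite_ring_simps(1,3))
  obtain N where N: "maximal_right_ideal N R" "left_annihilator R N \<noteq> {\<zero>}"
    "homs_are_right_multiplications (left_annihilator R N) R"
    using reflexive_simple_module[OF S refl[OF S]] .
  define P where "P = left_annihilator R N"
  obtain M where M: "maximal_right_ideal M R"
    "\<forall>y\<in>carrier R. y \<noteq> \<zero> \<and> (\<forall>m\<in>M. m \<otimes> y = \<zero>) \<longrightarrow>
      (\<exists>x\<in>P. x \<noteq> \<zero> \<and> (\<forall>m\<in>M. m \<otimes> x = \<zero>) \<and> P = {a \<otimes> x |a. a \<in> carrier R} \<and>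
        (\<forall>z\<in>carrier R. (\<forall>m\<in>M. m \<otimes> z = \<zero>) \<longrightarrow> (\<exists>c\<in>carrier R. z = x \<otimes> c)))"
    using left_annihilator_simple[OF art cpm N, folded P_def] by blast
  note MD = right_idealD[OF maximal_right_idealD(1)[OF M(1)]]
  note Mcp = cpm[OF M(1), unfolded completely_prime_maximal_def]
  note ND = right_idealD[OF maximal_right_idealD(1)[OF N(1)]]
  note Ncp = cpm[OF N(1), unfolded completely_prime_maximal_def]
  have Ml: "left_ideal M R" by (rule left_idealI) (use MD Mcp in auto)
  \<comment> \<open>M is given as a maximal right ideal. Inverses modulo M make it maximal as a left
    ideal too, so A / M is a simple left module and \<open>sq\<close> applies to it.\<close>
  have Mmax: "L = M \<or> L = carrier R" if L: "left_ideal L R" "M \<subseteq> L" for L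
  proof (cases "L = M")
    case False
    note LD = left_idealD[OF L(1)]
    obtain a where a: "a \<in> L" "a \<notin> M" using False L(2) by blast
    then obtain b where b: "b \<in> carrier R" "b \<otimes> a \<ominus> \<one> \<in> M" using Mcp LD(2) by blast
    have "b \<otimes> a \<ominus> (b \<otimes> a \<ominus> \<one>) \<in> L" using LD(5,6) a b L(2) by blast
    then have "\<one> \<in> L" using a b LD(2) by (simp add: a_minus_def minus_add r_neg1 r_neg2)
    then show ?thesis using LD(1) LD(6)[of _ \<one>] by auto
  qed simp
  obtain U :: "('a, 'a set) module" and u where U: "simple_module R U" "u \<in> carrier U" "u \<noteq> \<zero>\<^bsub>U\<^esub>"
    "{a \<in> carrier R. a \<odot>\<^bsub>U\<^esub> u = \<zero>\<^bsub>U\<^esub>} = M"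
    by (rule simple_quotient[OF Ml maximal_right_idealD(2)[OF M(1)] Mmax])
  obtain y z where yz: "y \<in> carrier R" "z \<in> carrier R" "y \<noteq> \<zero>"
    "\<And>a. a \<in> carrier R \<Longrightarrow> a \<odot>\<^bsub>U\<^esub> u = \<zero>\<^bsub>U\<^esub> \<Longrightarrow> a \<otimes> y = \<zero> \<and> a \<otimes> z = \<zero>"
    "\<And>a. a \<in> carrier R \<Longrightarrow> y \<noteq> a \<otimes> z" "z \<noteq> \<zero>"
    by (rule square_in_regular_socle_pair[OF U(1) sq[OF U(1)] U(2,3)]) (assumption | rule that)+
  have ann: "m \<otimes> y = \<zero>" "m \<otimes> z = \<zero>" if "m \<in> M" for m
    using that yz(4)[of m] unfolding U(4)[symmetric] by auto
  have "y \<noteq> \<zero> \<and> (\<forall>m\<in>M. m \<otimes> y = \<zero>)" using yz(3) ann(1) by blast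
  then obtain x where x: "x \<in> P" "x \<noteq> \<zero>" "\<forall>m\<in>M. m \<otimes> x = \<zero>" "P = {a \<otimes> x |a. a \<in> carrier R}"
    "\<forall>z\<in>carrier R. (\<forall>m\<in>M. m \<otimes> z = \<zero>) \<longrightarrow> (\<exists>c\<in>carrier R. z = x \<otimes> c)"
    using M(2)[rule_format, OF yz(1)] by blast
  have xc: "x \<in> carrier R" using x(1) by (simp add: P_def left_annihilator_def)
  \<comment> \<open>Here r M = x A is moved to the other side: \<open>x c\<close> still annihilates
    N, because c N \<subseteq> N, and so lies in P = A x.\<close>
  have mult: "\<exists>a\<in>carrier R. w = a \<otimes> x" if w: "w \<in> carrier R" "\<And>m. m \<in> M \<Longrightarrow> m \<otimes> w = \<zero>" for w
  proof -
    obtain c where c: "c \<in> carrier R" "w = x \<otimes> c" using x(5) w by blast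
    have "x \<otimes> c \<in> P" using x(1) c(1) Ncp ND(2) unfolding P_def left_annihilator_def by (auto simp: m_assoc)
    then show ?thesis using c(2) x(4) by blast
  qed
  obtain a where a: "a \<in> carrier R" "y = a \<otimes> x" using mult[OF yz(1) ann(1)] by blast
  obtain b where b: "b \<in> carrier R" "z = b \<otimes> x" using mult[OF yz(2) ann(2)] by blast
  \<comment> \<open>z \<noteq> 0 makes b invertible modulo M, and M x = 0 turns this into
    \<open>x = b' z\<close>. So y, a multiple of x, is a multiple of z.\<close>
  have "b \<notin> M" using b yz(6) x(3) by auto
  then obtain b' where b': "b' \<in> carrier R" "b' \<otimes> b \<ominus> \<one> \<in> M" using Mcp b(1) by blast
  have "(b' \<otimes> b \<ominus> \<one>) \<otimes> x = \<zero>" using x(3) b'(2) by blast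
  moreover have "((b' \<otimes> b \<ominus> \<one>) \<oplus> \<one>) \<otimes> x = (b' \<otimes> b \<ominus> \<one>) \<otimes> x \<oplus> x"
    using b b' xc by (simp add: l_distr)
  ultimately have "b' \<otimes> z = x" using b b' xc by (simp add: minus_add_cancel m_assoc)
  then have "y = (a \<otimes> b') \<otimes> z" using a b' yz(2) by (simp add: m_assoc)
  then show False using yz(5)[of "a \<otimes> b'"] a b' by blast
qed

end

section \<open>Local rings\<close>

context ring
begin

text \<open>For a outside M, the right ideal \<open>a R\<close> lies in no maximal right ideal, so a
  has a right inverse b. As M is also a left ideal, b is outside M and has a right inverse as well,
  which can only be a.\<close>

lemma local_ring_units:
  assumes "local_ring R"
  obtains M where "maximal_right_ideal M R" "\<And>N. maximal_right_ideal N R \<Longrightarrow> N = M"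
    "\<And>a m. a \<in> carrier R \<Longrightarrow> m \<in> M \<Longrightarrow> a \<otimes> m \<in> M"
    "\<And>a. a \<in> carrier R \<Longrightarrow> a \<notin> M \<Longrightarrow> \<exists>b\<in>carrier R. a \<otimes> b = \<one> \<and> b \<otimes> a = \<one>"
proof -
  obtain M where M: "maximal_right_ideal M R" "\<And>N. maximal_right_ideal N R \<Longrightarrow> N = M"
    using assms unfolding local_ring_def by blast
  note MD = right_idealD[OF maximal_right_idealD(1)[OF M(1)]]
  note one = maximal_right_idealD(2)[OF M(1)]
  have right: "\<exists>b\<in>carrier R. a \<otimes> b = \<one>" if a: "a \<in> carrier R" "a \<notin> M" for a
  proof (rule ccontr)
    assume none: "\<not> ?thesis"
    define I where "I = {a \<otimes> b |b. b \<in> carrier R}"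
    have "right_ideal I R" unfolding I_def by (rule right_ideal_principal[OF a(1)])
    moreover have "\<one> \<notin> I" using none unfolding I_def by auto
    ultimately obtain N where "maximal_right_ideal N R" "I \<subseteq> N" using maximal_right_ideal_exists by blast
    moreover have "a \<in> I" using a(1) r_one[OF a(1)] unfolding I_def by (metis (mono_tags, lifting) mem_Collect_eq one_closed)
    ultimately show False using M(2) a(2) by blast
  qed
  \<comment> \<open>Suppose \<open>a m b = \<one>\<close>. Since \<open>m b a\<close> lies in M, the
    element \<open>\<one> - m b a\<close> does not, and is right invertible; but a annihilates it
    from the left, so a = 0.\<close>
  have left: "a \<otimes> m \<in> M" if a: "a \<in> carrier R" "m \<in> M" for a m
  proof (rule ccontr)
    assume "a \<otimes> m \<notin> M"
    then obtain b where b: "b \<in> carrier R" "(a \<otimes> m) \<otimes> b = \<one>" using right[of "a \<otimes> m"] a MD(2) by auto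
    have mb: "m \<otimes> b \<in> M" "m \<otimes> b \<in> carrier R" using MD(2,6) a(2) b(1) by auto
    have e: "(m \<otimes> b) \<otimes> a \<in> M" by (rule MD(6)[OF a(1) mb(1)])
    have "\<one> \<ominus> (m \<otimes> b) \<otimes> a \<notin> M"
    proof
      assume "\<one> \<ominus> (m \<otimes> b) \<otimes> a \<in> M"
      from MD(4)[OF this e] show False using one a(1) mb(2) by (simp add: minus_add_cancel)
    qed
    then obtain c where c: "c \<in> carrier R" "(\<one> \<ominus> (m \<otimes> b) \<otimes> a) \<otimes> c = \<one>"
      using right[of "\<one> \<ominus> (m \<otimes> b) \<otimes> a"] a(1) mb(2) by auto
    have amb: "a \<otimes> (m \<otimes> b) = \<one>" using b a MD(2) by (simp add: m_assoc)
    have "a \<otimes> (\<one> \<ominus> (m \<otimes> b) \<otimes> a) = a \<ominus> (a \<otimes> (m \<otimes> b)) \<otimes> a"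
      using a(1) mb(2) by (simp add: a_minus_def r_distr r_minus m_assoc)
    also have "\<dots> = \<zero>" using a(1) by (simp add: amb a_minus_def r_neg)
    finally have "a \<otimes> ((\<one> \<ominus> (m \<otimes> b) \<otimes> a) \<otimes> c) = \<zero>"
      using a(1) mb(2) c(1) by (simp add: m_assoc[symmetric])
    then have "a = \<zero>" using a(1) c(2) by simp
    then show False using \<open>a \<otimes> m \<notin> M\<close> a(2) MD(2,3) by simp
  qed
  have "\<exists>b\<in>carrier R. a \<otimes> b = \<one> \<and> b \<otimes> a = \<one>" if a: "a \<in> carrier R" "a \<notin> M" for a
  proof -
    obtain b where b: "b \<in> carrier R" "a \<otimes> b = \<one>" using right[OF a] by blast
    have "b \<notin> M" using left[OF a(1), of b] b(2) one by auto
    then obtain c where c: "c \<in> carrier R" "b \<otimes> c = \<one>" using right b(1) by blast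
    have "c = (a \<otimes> b) \<otimes> c" using b(2) c(1) by simp
    also have "\<dots> = a" using a(1) b(1) c by (simp add: m_assoc)
    finally show ?thesis using b c by blast
  qed
  then show ?thesis using that M left by blast
qed

text \<open>Elements outside M are units, so every proper left ideal lies in M. This makes M
  available when earlier results are used over the opposite ring.\<close>

lemma maximal_left_ideal_eq:
  assumes M: "maximal_right_ideal M R"
    and left: "\<And>a m. a \<in> carrier R \<Longrightarrow> m \<in> M \<Longrightarrow> a \<otimes> m \<in> M"
    and unit: "\<And>a. a \<in> carrier R \<Longrightarrow> a \<notin> M \<Longrightarrow> \<exists>b\<in>carrier R. a \<otimes> b = \<one> \<and> b \<otimes> a = \<one>"
    and N: "maximal_right_ideal N (opposite_ring R)"
  shows "N = M"
proof -
  interpret op: ring "opposite_ring R" by (rule ring_opposite)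
  have N': "left_ideal N R" "\<one> \<notin> N"
    using op.maximal_right_idealD[OF N] by (simp_all add: opposite_ring_opposite_ring)
  note MD = right_idealD[OF maximal_right_idealD(1)[OF M]] and ND = left_idealD[OF N'(1)]
  have "N \<subseteq> M"
  proof
    fix a assume a: "a \<in> N"
    show "a \<in> M"
    proof (rule ccontr)
      assume "a \<notin> M"
      then obtain b where "b \<in> carrier R" "b \<otimes> a = \<one>" using unit ND(2)[OF a] by blast
      then show False using ND(6)[OF _ a, of b] N'(2) by simp
    qed
  qed
  moreover have "left_ideal M R" by (rule left_idealI) (use MD left in auto)
  ultimately have "M = N \<or> M = carrier R"
    using N unfolding maximal_right_ideal_def opposite_ring_opposite_ring by simp
  then show ?thesis using maximal_right_idealD(2)[OF M] by auto
qed

end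

text \<open>Both annihilators of the maximal ideal \<open>M\<close> are the simple module \<open>A x = x A\<close>.\<close>

locale local_artinian_simple_socle = ring R for R (structure) +
  fixes M x
  assumes artinian_left: "artinian_left R" and artinian_right: "artinian_left (opposite_ring R)"
    and maximal: "maximal_right_ideal M R"
    and left_closed: "\<And>a m. a \<in> carrier R \<Longrightarrow> m \<in> M \<Longrightarrow> a \<otimes> m \<in> M"
    and unit: "\<And>a. a \<in> carrier R \<Longrightarrow> a \<notin> M \<Longrightarrow> \<exists>b\<in>carrier R. a \<otimes> b = \<one> \<and> b \<otimes> a = \<one>"
    and x_closed: "x \<in> carrier R"
    and M_x: "\<And>m. m \<in> M \<Longrightarrow> m \<otimes> x = \<zero>"
    and left_socle: "\<And>y. y \<in> carrier R \<Longrightarrow> \<forall>m\<in>M. m \<otimes> y = \<zero> \<Longrightarrow> \<exists>a\<in>carrier R. y = x \<otimes> a"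
    and right_socle: "\<And>y. y \<in> carrier R \<Longrightarrow> \<forall>m\<in>M. y \<otimes> m = \<zero> \<Longrightarrow> \<exists>a\<in>carrier R. y = a \<otimes> x"
begin

text \<open>The mirror image of \<open>left_ideal_maximal_sub\<close>: the maximal right ideals of
  the opposite ring are the maximal left ideals of R, and M is the only one. The quotient I / K is a
  copy of R / M.\<close>

lemma right_ideal_maximal_sub:
  assumes I: "right_ideal I R" "I \<noteq> {\<zero>}"
  shows "\<exists>K z. right_ideal K R \<and> K \<subset> I \<and> z \<in> I \<and> z \<notin> K \<and> (\<forall>m\<in>M. z \<otimes> m \<in> K) \<and>
    I = {k \<oplus> z \<otimes> a |k a. k \<in> K \<and> a \<in> carrier R}"
proof -
  interpret op: ring "opposite_ring R" by (rule ring_opposite)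
  note MD = right_idealD[OF maximal_right_idealD(1)[OF maximal]]
  have eq: "N = M" if "maximal_right_ideal N (opposite_ring R)" for N
    by (rule maximal_left_ideal_eq[OF maximal left_closed unit that])
  have cpm: "completely_prime_maximal N (opposite_ring R)" if N: "maximal_right_ideal N (opposite_ring R)" for N
    unfolding completely_prime_maximal_def eq[OF N]
  proof (intro conjI ballI)
    show "a \<otimes>\<^bsub>opposite_ring R\<^esub> n \<in> M" if "a \<in> carrier (opposite_ring R)" "n \<in> M" for a n
      using MD(6)[of a n] that by simp
    show "\<exists>b\<in>carrier (opposite_ring R). b \<otimes>\<^bsub>opposite_ring R\<^esub> a \<ominus>\<^bsub>opposite_ring R\<^esub> \<one>\<^bsub>opposite_ring R\<^esub> \<in> M"
      if a: "a \<in> carrier (opposite_ring R) - M" for a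
    proof -
      obtain b where "b \<in> carrier R" "a \<otimes> b = \<one>" using unit a by auto
      then show ?thesis using MD(3) by (intro bexI[of _ b]) (simp_all add: a_minus_def r_neg)
    qed
  qed
  obtain N K z where "maximal_right_ideal N (opposite_ring R)"
    and K: "right_ideal K R" "K \<subseteq> I" "z \<in> I" "z \<notin> K" "\<And>n p. n \<in> N \<Longrightarrow> p \<in> I \<Longrightarrow> p \<otimes> n \<in> K"
      "I = {k \<oplus> z \<otimes> a |k a. k \<in> K \<and> a \<in> carrier R}"
    by (rule op.left_ideal_maximal_sub[of I, unfolded opposite_ring_opposite_ring opposite_ring_simps,
          OF artinian_left cpm I]) (assumption | rule that)+
  moreover from this have "N = M" by (intro eq)
  ultimately show ?thesis by (intro exI[of _ K] exI[of _ z]) blast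
qed

text \<open>Takes the place of induction on composition length: a minimal right ideal without Q is
  nonzero, and its maximal subideal K has Q. The inductive step goes from K to I with I / K
  simple.\<close>

lemma right_ideal_minimal_counterexample:
  assumes "right_ideal I R" "\<not> Q I" "Q {\<zero>}"
  obtains I K z where "right_ideal I R" "\<not> Q I" "right_ideal K R" "Q K" "z \<in> I" "z \<notin> K"
    "\<forall>m\<in>M. z \<otimes> m \<in> K" "I = {k \<oplus> z \<otimes> a |k a. k \<in> K \<and> a \<in> carrier R}"
proof -
  have "\<exists>I\<in>{I. right_ideal I R \<and> \<not> Q I}. \<forall>K\<in>{I. right_ideal I R \<and> \<not> Q I}. K \<subseteq> I \<longrightarrow> K = I"
    by (rule artinian_leftD[OF artinian_right]) (use assms in auto)
  then obtain J where J: "right_ideal J R" "\<not> Q J" "\<And>K. right_ideal K R \<Longrightarrow> K \<subset> J \<Longrightarrow> Q K" by blast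
  then have "J \<noteq> {\<zero>}" using assms(3) by auto
  from right_ideal_maximal_sub[OF J(1) this] obtain K z where "right_ideal K R" "K \<subset> J" "z \<in> J" "z \<notin> K"
    "\<forall>m\<in>M. z \<otimes> m \<in> K" "J = {k \<oplus> z \<otimes> a |k a. k \<in> K \<and> a \<in> carrier R}" by blast
  then show ?thesis using that[of J K z] J by blast
qed

text \<open>The nontrivial inclusion of the annihilator condition r (l I) = I known from
  quasi-Frobenius rings.\<close>

definition double_annihilator_closed :: "'a set \<Rightarrow> bool" where
  "double_annihilator_closed I \<longleftrightarrow>
     (\<forall>t\<in>carrier R. (\<forall>b\<in>left_annihilator R I. b \<otimes> t = \<zero>) \<longrightarrow> t \<in> I)"

text \<open>From z M \<subseteq> K one gets b z M \<subseteq> b K = 0, so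
  \<open>b \<mapsto> b z\<close> maps l K into l M, which lies in A x. The kernel of this map is l
  (K + z A), so the quotient of the two annihilators is at most simple.\<close>

lemma left_annihilator_socle:
  assumes K: "K \<subseteq> carrier R" and z: "z \<in> carrier R" "\<forall>m\<in>M. z \<otimes> m \<in> K" and b: "b \<in> left_annihilator R K"
  shows "\<exists>a\<in>carrier R. b \<otimes> z = a \<otimes> x"
proof (rule right_socle)
  have bc: "b \<in> carrier R" and bK: "\<And>k. k \<in> K \<Longrightarrow> b \<otimes> k = \<zero>" using b by (auto simp: left_annihilator_def)
  show "b \<otimes> z \<in> carrier R" using bc z(1) by simp
  show "\<forall>m\<in>M. (b \<otimes> z) \<otimes> m = \<zero>"
    using bc bK z right_idealD(2)[OF maximal_right_idealD(1)[OF maximal]] by (simp add: m_assoc)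
qed

text \<open>As K is closed and z \<notin> K, some b in l K has \<open>b z = a x \<noteq> 0\<close>.
  Then a is outside M, hence a unit, and dividing by it normalises the value to x.\<close>

lemma left_annihilator_witness:
  assumes K: "right_ideal K R" "double_annihilator_closed K"
    and z: "z \<in> carrier R" "z \<notin> K" "\<forall>m\<in>M. z \<otimes> m \<in> K"
  obtains b where "b \<in> left_annihilator R K" "b \<otimes> z = x"
proof -
  note KD = right_idealD[OF K(1)]
  obtain b where b: "b \<in> left_annihilator R K" "b \<otimes> z \<noteq> \<zero>"
    using K(2) z(1,2) by (auto simp: double_annihilator_closed_def)
  obtain a where a: "a \<in> carrier R" "b \<otimes> z = a \<otimes> x"
    using left_annihilator_socle[OF KD(1) z(1,3) b(1)] by blast
  have "a \<notin> M" using a(2) b(2) M_x by auto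
  then obtain a' where a': "a' \<in> carrier R" "a' \<otimes> a = \<one>" using unit a(1) by blast
  have bc: "b \<in> carrier R" using b by (simp add: left_annihilator_def)
  have "(a' \<otimes> b) \<otimes> z = a' \<otimes> (a \<otimes> x)" using a a'(1) bc z(1) by (simp add: m_assoc)
  also have "\<dots> = x" using a(1) a' x_closed m_assoc[of a' a x] by simp
  finally have "(a' \<otimes> b) \<otimes> z = x" .
  moreover have "a' \<otimes> b \<in> left_annihilator R K"
    by (rule left_idealD(6)[OF left_annihilator_left_ideal[OF KD(1)] a'(1) b(1)])
  ultimately show ?thesis using that by blast
qed

text \<open>
  If \<open>K\<close> is closed and \<open>I/K\<close> is simple, then so is \<open>l K/l I\<close>, hence also \<open>r (l I)/K\<close>, and \<open>I\<close> is closed.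
\<close>

lemma double_annihilator_closed:
  assumes "right_ideal I R"
  shows "double_annihilator_closed I"
proof (rule ccontr)
  assume neg: "\<not> double_annihilator_closed I"
  have "double_annihilator_closed {\<zero>}"
    by (auto simp: double_annihilator_closed_def left_annihilator_def dest: bspec[of _ _ \<one>])
  then obtain I K z where I: "right_ideal I R" "\<not> double_annihilator_closed I"
    and K: "right_ideal K R" "double_annihilator_closed K"
    and z: "z \<in> I" "z \<notin> K" "\<forall>m\<in>M. z \<otimes> m \<in> K"
    and IK: "I = {k \<oplus> z \<otimes> a |k a. k \<in> K \<and> a \<in> carrier R}"
    by (rule right_ideal_minimal_counterexample[where Q = double_annihilator_closed, OF assms neg])
  note ID = right_idealD[OF I(1)] and KD = right_idealD[OF K(1)]
  have zc: "z \<in> carrier R" by (rule ID(2)[OF z(1)])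
  obtain b where b: "b \<in> left_annihilator R K" "b \<otimes> z = x" by (rule left_annihilator_witness[OF K zc z(2,3)])
  have bc: "b \<in> carrier R" using b by (simp add: left_annihilator_def)
  note lK = left_idealD[OF left_annihilator_left_ideal[OF KD(1)]]
  have lI: "c \<in> left_annihilator R I" if c: "c \<in> left_annihilator R K" "c \<otimes> z = \<zero>" for c
  proof -
    have cc: "c \<in> carrier R" and cK: "\<And>k. k \<in> K \<Longrightarrow> c \<otimes> k = \<zero>" using c by (auto simp: left_annihilator_def)
    have "c \<otimes> (k \<oplus> z \<otimes> a) = \<zero>" if "k \<in> K" "a \<in> carrier R" for k a
    proof -
      have "c \<otimes> (k \<oplus> z \<otimes> a) = c \<otimes> k \<oplus> (c \<otimes> z) \<otimes> a" using that cc zc KD(2) by (simp add: r_distr m_assoc)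
      then show ?thesis using that cK c(2) by simp
    qed
    then show ?thesis unfolding IK left_annihilator_def using cc by blast
  qed
  have "t \<in> I" if t: "t \<in> carrier R" "\<forall>c\<in>left_annihilator R I. c \<otimes> t = \<zero>" for t
  proof -
    \<comment> \<open>M b annihilates K and also z, since M b z = M x = 0; hence M b \<subseteq> l
      I, which annihilates t. So \<open>b t\<close> lies in r M, and comparing
      \<open>b t = x d\<close> with \<open>b z = x\<close> suggests that t is z d modulo K.\<close>
    have "\<forall>m\<in>M. m \<otimes> (b \<otimes> t) = \<zero>"
    proof
      fix m assume m: "m \<in> M"
      then have mc: "m \<in> carrier R" using right_idealD(2)[OF maximal_right_idealD(1)[OF maximal]] by blast
      then have "(m \<otimes> b) \<otimes> z = \<zero>" using M_x[OF m] b(2) bc zc by (simp add: m_assoc)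
      then have "m \<otimes> b \<in> left_annihilator R I" using lI lK(6)[OF mc b(1)] by blast
      then show "m \<otimes> (b \<otimes> t) = \<zero>" using t mc bc by (simp add: m_assoc[symmetric])
    qed
    then obtain d where d: "d \<in> carrier R" "b \<otimes> t = x \<otimes> d" using left_socle[of "b \<otimes> t"] bc t(1) by auto
    \<comment> \<open>\<open>b t = b (z d)\<close> settles multiples of b. A general c in l K
      differs from some \<open>a b\<close> by an element of l I, which annihilates both t and
      z.\<close>
    have "c \<otimes> (t \<ominus> z \<otimes> d) = \<zero>" if c: "c \<in> left_annihilator R K" for c
    proof -
      have cc: "c \<in> carrier R" using c by (simp add: left_annihilator_def)
      obtain a where a: "a \<in> carrier R" "c \<otimes> z = a \<otimes> x" using left_annihilator_socle[OF KD(1) zc z(3) c] by blast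
      have "(c \<ominus> a \<otimes> b) \<otimes> z = c \<otimes> z \<ominus> a \<otimes> (b \<otimes> z)"
        using a(1) bc cc zc by (simp add: a_minus_def l_distr l_minus m_assoc)
      also have "\<dots> = \<zero>" using a b(2) x_closed by (simp add: a_minus_def r_neg)
      finally have "(c \<ominus> a \<otimes> b) \<otimes> z = \<zero>" .
      then have "c \<ominus> a \<otimes> b \<in> left_annihilator R I" using lI lK(5)[OF c lK(6)[OF a(1) b(1)]] by blast
      then have "(c \<ominus> a \<otimes> b) \<otimes> t = \<zero>" using t(2) by blast
      moreover have "((c \<ominus> a \<otimes> b) \<oplus> a \<otimes> b) \<otimes> t = (c \<ominus> a \<otimes> b) \<otimes> t \<oplus> a \<otimes> (b \<otimes> t)"
        using a(1) bc cc t(1) by (simp add: l_distr m_assoc)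
      ultimately have "c \<otimes> t = a \<otimes> (x \<otimes> d)" using a(1) bc cc t(1) d x_closed by (simp add: minus_add_cancel)
      also have "\<dots> = (c \<otimes> z) \<otimes> d" using a d(1) x_closed by (simp add: m_assoc)
      finally have "c \<otimes> t = c \<otimes> (z \<otimes> d)" using cc zc d(1) by (simp add: m_assoc)
      then show ?thesis using cc zc d(1) t(1) by (simp add: a_minus_def r_distr r_minus r_neg)
    qed
    then have "t \<ominus> z \<otimes> d \<in> K" using K(2) t(1) zc d(1) by (simp add: double_annihilator_closed_def)
    moreover have "t = (t \<ominus> z \<otimes> d) \<oplus> z \<otimes> d" using t(1) zc d(1) by (simp add: minus_add_cancel)
    ultimately show ?thesis unfolding IK using d(1) by blast
  qed
  then show False using I(2) by (simp add: double_annihilator_closed_def)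
qed

text \<open>On K the map \<phi> is left multiplication by some a. The defect
  \<open>\<phi> z - a z\<close> annihilates M, as z M \<subseteq> K, so it equals
  \<open>e x = e b z\<close> with the witness b. Since b annihilates K, replacing a by
  \<open>a + e b\<close> corrects the value at z and keeps those on K.\<close>

lemma right_ideal_homs:
  assumes "right_ideal I R"
  shows "homs_are_right_multiplications I (opposite_ring R)"
proof (rule ccontr)
  assume neg: "\<not> ?thesis"
  have "homs_are_right_multiplications {\<zero>} (opposite_ring R)"
    unfolding homs_are_right_multiplications_def
  proof (intro ballI impI)
    fix \<phi> assume "\<phi> \<in> {\<zero>} \<rightarrow> carrier (opposite_ring R)" and lin: "(\<forall>x\<in>{\<zero>}. \<forall>y\<in>{\<zero>}. \<phi> (x \<oplus>\<^bsub>opposite_ring R\<^esub> y) = \<phi> x \<oplus>\<^bsub>opposite_ring R\<^esub> \<phi> y) \<and>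
      (\<forall>a\<in>carrier (opposite_ring R). \<forall>x\<in>{\<zero>}. \<phi> (a \<otimes>\<^bsub>opposite_ring R\<^esub> x) = a \<otimes>\<^bsub>opposite_ring R\<^esub> \<phi> x)"
    then have c: "\<phi> \<zero> \<in> carrier R" by auto
    have "\<phi> (\<zero> \<otimes> \<zero>) = \<phi> \<zero> \<otimes> \<zero>" using lin by simp
    then have "\<phi> \<zero> = \<zero>" using c by simp
    then show "\<exists>c\<in>carrier (opposite_ring R). \<forall>x\<in>{\<zero>}. \<phi> x = x \<otimes>\<^bsub>opposite_ring R\<^esub> c"
      by (intro bexI[of _ \<zero>]) auto
  qed
  then obtain I K z where I: "right_ideal I R" "\<not> homs_are_right_multiplications I (opposite_ring R)"
    and K: "right_ideal K R" "homs_are_right_multiplications K (opposite_ring R)"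
    and z: "z \<in> I" "z \<notin> K" "\<forall>m\<in>M. z \<otimes> m \<in> K"
    and IK: "I = {k \<oplus> z \<otimes> a |k a. k \<in> K \<and> a \<in> carrier R}"
    by (rule right_ideal_minimal_counterexample[where Q = "\<lambda>I. homs_are_right_multiplications I (opposite_ring R)",
          OF assms neg])
  note ID = right_idealD[OF I(1)] and KD = right_idealD[OF K(1)]
  have zc: "z \<in> carrier R" by (rule ID(2)[OF z(1)])
  have KI: "K \<subseteq> I" unfolding IK by (rule right_ideal_add_principal_supset(2)[OF K(1) zc])
  obtain b where b: "b \<in> left_annihilator R K" "b \<otimes> z = x"
    by (rule left_annihilator_witness[OF K(1) double_annihilator_closed[OF K(1)] zc z(2,3)])
  have bc: "b \<in> carrier R" and bK: "\<And>k. k \<in> K \<Longrightarrow> b \<otimes> k = \<zero>" using b by (auto simp: left_annihilator_def)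
  have "homs_are_right_multiplications I (opposite_ring R)"
    unfolding homs_are_right_multiplications_def opposite_ring_simps
  proof (intro ballI impI)
    fix \<phi> assume "\<phi> \<in> I \<rightarrow> carrier R" and lin: "(\<forall>x\<in>I. \<forall>y\<in>I. \<phi> (x \<oplus> y) = \<phi> x \<oplus> \<phi> y) \<and>
      (\<forall>a\<in>carrier R. \<forall>x\<in>I. \<phi> (x \<otimes> a) = \<phi> x \<otimes> a)"
    then have \<phi>: "\<And>y. y \<in> I \<Longrightarrow> \<phi> y \<in> carrier R" by auto
    have "\<exists>c\<in>carrier (opposite_ring R). \<forall>x\<in>K. \<phi> x = x \<otimes>\<^bsub>opposite_ring R\<^esub> c"
      by (rule homs_are_right_multiplicationsD[OF K(2)]) (use \<phi> KI lin in \<open>auto simp: subset_iff\<close>)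
    then obtain a where a: "a \<in> carrier R" "\<And>k. k \<in> K \<Longrightarrow> \<phi> k = a \<otimes> k" by auto
    have "(\<phi> z \<ominus> a \<otimes> z) \<otimes> m = \<zero>" if m: "m \<in> M" for m
    proof -
      have mc: "m \<in> carrier R" using m right_idealD(2)[OF maximal_right_idealD(1)[OF maximal]] by blast
      have "\<phi> z \<otimes> m = \<phi> (z \<otimes> m)" using lin z(1) mc by simp
      also have "\<dots> = a \<otimes> (z \<otimes> m)" using a(2) z(3) m by simp
      finally show ?thesis using a(1) zc mc \<phi>[OF z(1)] by (simp add: a_minus_def l_distr l_minus m_assoc r_neg)
    qed
    then obtain e where e: "e \<in> carrier R" "\<phi> z \<ominus> a \<otimes> z = e \<otimes> x"
      using right_socle[of "\<phi> z \<ominus> a \<otimes> z"] \<phi>[OF z(1)] a(1) zc by auto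
    let ?c = "a \<oplus> e \<otimes> b"
    have cK: "?c \<otimes> k = \<phi> k" if k: "k \<in> K" for k
      using a e(1) bc KD(2)[OF k] bK[OF k] k by (simp add: l_distr m_assoc)
    have "?c \<otimes> z = e \<otimes> x \<oplus> a \<otimes> z" using a(1) e(1) bc zc b(2) x_closed by (simp add: l_distr m_assoc a_comm)
    then have cz: "?c \<otimes> z = \<phi> z" unfolding e(2)[symmetric] using \<phi>[OF z(1)] a(1) zc by (simp add: minus_add_cancel)
    have "\<phi> y = ?c \<otimes> y" if y: "y \<in> I" for y
    proof -
      obtain k d where kd: "y = k \<oplus> z \<otimes> d" "k \<in> K" "d \<in> carrier R" using y IK by blast
      have "\<phi> y = \<phi> k \<oplus> \<phi> z \<otimes> d" unfolding kd(1) using lin kd(2,3) KI z(1) ID(6) by auto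
      also have "\<dots> = ?c \<otimes> k \<oplus> (?c \<otimes> z) \<otimes> d" using cK[OF kd(2)] cz by simp
      also have "\<dots> = ?c \<otimes> y" unfolding kd(1) using a(1) e(1) bc zc kd(3) KD(2)[OF kd(2)] by (simp add: r_distr m_assoc)
      finally show ?thesis .
    qed
    then show "\<exists>c\<in>carrier R. \<forall>x\<in>I. \<phi> x = c \<otimes> x" using a(1) e(1) bc by blast
  qed
  then show False using I(2) by blast
qed

lemma selfinjective: "selfinjective TX TY R"
  unfolding selfinjective_def
proof (rule ring.Baer_criterion[OF ring_opposite ring.regular_module[OF ring_opposite]], goal_cases)
  case (1 I f)
  then show ?case
    using homs_are_right_multiplicationsD[OF right_ideal_homs[OF 1(1)], of f] by simp
qed

end

text \<open>The ideals N, from reflexivity, and \<open>M'\<close>, from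
  \<open>left_annihilator_simple\<close>, must both be M. To use the latter one needs y \<noteq> 0
  with M y = 0, and a generator of a minimal nonzero principal left ideal will do:
  \<open>m y \<noteq> 0\<close> would give \<open>y = c m y\<close>, where
  \<open>\<one> - c m\<close> is a unit annihilating y.\<close>

lemma (in ring) local_reflexive_selfinjective:
  assumes artl: "artinian_left R" and artr: "artinian_left (opposite_ring R)" and loc: "local_ring R"
    and S: "simple_module (opposite_ring R) S" "reflexive (opposite_ring R) S"
  shows "selfinjective TX TY R"
proof -
  obtain M where M: "maximal_right_ideal M R" "\<And>N. maximal_right_ideal N R \<Longrightarrow> N = M"
    and left: "\<And>a m. a \<in> carrier R \<Longrightarrow> m \<in> M \<Longrightarrow> a \<otimes> m \<in> M"
    and unit: "\<And>a. a \<in> carrier R \<Longrightarrow> a \<notin> M \<Longrightarrow> \<exists>b\<in>carrier R. a \<otimes> b = \<one> \<and> b \<otimes> a = \<one>"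
    by (rule local_ring_units[OF loc]) (assumption | rule that)+
  note MD = right_idealD[OF maximal_right_idealD(1)[OF M(1)]]
  have cpm: "completely_prime_maximal N R" if N: "maximal_right_ideal N R" for N
    unfolding completely_prime_maximal_def M(2)[OF N]
  proof (intro conjI ballI)
    show "\<exists>b\<in>carrier R. b \<otimes> a \<ominus> \<one> \<in> M" if a: "a \<in> carrier R - M" for a
    proof -
      obtain b where "b \<in> carrier R" "b \<otimes> a = \<one>" using unit a by auto
      then show ?thesis using MD(3) by (intro bexI[of _ b]) (simp_all add: a_minus_def r_neg)
    qed
  qed (rule left)
  obtain N where N: "maximal_right_ideal N R" "left_annihilator R N \<noteq> {\<zero>}"
    "homs_are_right_multiplications (left_annihilator R N) R"
    using reflexive_simple_module[OF S] .
  have NM: "N = M" by (rule M(2)[OF N(1)])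
  define P where "P = left_annihilator R M"
  have "\<exists>M'. maximal_right_ideal M' R \<and>
    (\<forall>y\<in>carrier R. y \<noteq> \<zero> \<and> (\<forall>m\<in>M'. m \<otimes> y = \<zero>) \<longrightarrow>
      (\<exists>x\<in>P. x \<noteq> \<zero> \<and> (\<forall>m\<in>M'. m \<otimes> x = \<zero>) \<and> P = {a \<otimes> x |a. a \<in> carrier R} \<and>
        (\<forall>z\<in>carrier R. (\<forall>m\<in>M'. m \<otimes> z = \<zero>) \<longrightarrow> (\<exists>c\<in>carrier R. z = x \<otimes> c))))"
    using left_annihilator_simple[OF artr cpm N] unfolding NM P_def by blast
  then obtain M' where M': "maximal_right_ideal M' R"
    "\<forall>y\<in>carrier R. y \<noteq> \<zero> \<and> (\<forall>m\<in>M'. m \<otimes> y = \<zero>) \<longrightarrow>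
      (\<exists>x\<in>P. x \<noteq> \<zero> \<and> (\<forall>m\<in>M'. m \<otimes> x = \<zero>) \<and> P = {a \<otimes> x |a. a \<in> carrier R} \<and>
        (\<forall>z\<in>carrier R. (\<forall>m\<in>M'. m \<otimes> z = \<zero>) \<longrightarrow> (\<exists>c\<in>carrier R. z = x \<otimes> c)))" by blast
  have M'M: "M' = M" by (rule M(2)[OF M'(1)])
  obtain y where y: "y \<in> carrier R" "y \<noteq> \<zero>" "\<forall>m\<in>M. m \<otimes> y = \<zero>"
  proof -
    have "\<one> \<in> carrier R - {\<zero>}" using maximal_right_idealD(2)[OF M(1)] MD(3) by auto
    then obtain y where y: "y \<in> carrier R - {\<zero>}"
      "\<forall>b\<in>carrier R. b \<otimes> y \<in> carrier R - {\<zero>} \<longrightarrow> (\<exists>c\<in>carrier R. y = c \<otimes> (b \<otimes> y))"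
      using artinian_principal_left[OF artl, of "carrier R - {\<zero>}"] by blast
    have yc: "y \<in> carrier R" using y(1) by simp
    have "m \<otimes> y = \<zero>" if m: "m \<in> M" for m
    proof (rule ccontr)
      assume "m \<otimes> y \<noteq> \<zero>"
      have mc: "m \<in> carrier R" by (rule MD(2)[OF m])
      obtain c where c: "c \<in> carrier R" "c \<otimes> (m \<otimes> y) = y"
        using y(2) mc yc \<open>m \<otimes> y \<noteq> \<zero>\<close> by (metis DiffI m_closed singletonD)
      have cm: "c \<otimes> m \<in> M" by (rule left[OF c(1) m])
      have "\<one> \<ominus> c \<otimes> m \<notin> M"
      proof
        assume "\<one> \<ominus> c \<otimes> m \<in> M"
        from MD(4)[OF this cm] show False
          using maximal_right_idealD(2)[OF M(1)] c(1) mc by (simp add: minus_add_cancel)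
      qed
      then obtain u where u: "u \<in> carrier R" "u \<otimes> (\<one> \<ominus> c \<otimes> m) = \<one>" using unit[of "\<one> \<ominus> c \<otimes> m"] c(1) mc by auto
      have "(\<one> \<ominus> c \<otimes> m) \<otimes> y = y \<ominus> c \<otimes> (m \<otimes> y)"
        using c(1) mc yc by (simp add: a_minus_def l_distr l_minus m_assoc)
      also have "\<dots> = \<zero>" using c(2) yc by (simp add: a_minus_def r_neg)
      finally have "u \<otimes> ((\<one> \<ominus> c \<otimes> m) \<otimes> y) = \<zero>" using u(1) by simp
      then have "(u \<otimes> (\<one> \<ominus> c \<otimes> m)) \<otimes> y = \<zero>" using u(1) c(1) mc yc by (simp add: m_assoc)
      then show False using u(2) y(1) by simp
    qed
    then show ?thesis using that[of y] y(1) by blast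
  qed
  obtain x where x: "x \<in> P" "\<forall>m\<in>M. m \<otimes> x = \<zero>" "P = {a \<otimes> x |a. a \<in> carrier R}"
    "\<forall>z\<in>carrier R. (\<forall>m\<in>M. m \<otimes> z = \<zero>) \<longrightarrow> (\<exists>c\<in>carrier R. z = x \<otimes> c)"
    using M'(2) y unfolding M'M by blast
  interpret local_artinian_simple_socle R M x
  proof (unfold_locales)
    show "\<exists>a\<in>carrier R. y = a \<otimes> x" if "y \<in> carrier R" "\<forall>m\<in>M. y \<otimes> m = \<zero>" for y
    proof -
      have "y \<in> P" using that by (simp add: P_def left_annihilator_def)
      then show ?thesis using x(3) by blast
    qed
    show "x \<in> carrier R" using x(1) by (simp add: P_def left_annihilator_def)
  qed (use artl artr M(1) left unit x in blast)+
  show ?thesis by (rule selfinjective)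
qed

section \<open>Chain conditions\<close>

context module
begin

text \<open>For a submodule F this is the descending chain condition of F. It is phrased with
  submodules of the fixed module M, so that F can grow by one generator at a time inside M.\<close>

definition stationary_on :: "'c set \<Rightarrow> bool" where
  "stationary_on F \<longleftrightarrow> (\<forall>I :: nat \<Rightarrow> 'c set. (\<forall>n. submodule (I n) R M \<and> I (Suc n) \<subseteq> I n) \<longrightarrow>
     (\<exists>n. \<forall>m\<ge>n. I n \<inter> F \<subseteq> I m))"

lemma submodule_zero: "submodule H R M \<Longrightarrow> \<zero>\<^bsub>M\<^esub> \<in> H"
  using subgroup.one_closed[OF submodule.axioms(1)] by fastforce

lemma submodule_diff:
  assumes "submodule H R M" "x \<in> H" "y \<in> H"
  shows "x \<ominus>\<^bsub>M\<^esub> y \<in> H"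
  unfolding a_minus_def using submoduleE[OF assms(1)] assms(2,3) by blast

text \<open>An extension of a cyclic module by F: a chain in R x + F is controlled by its traces on
  F and by the ideals of coefficients of x occurring in it. The traces stabilise by hypothesis, the
  coefficient ideals because R is artinian.\<close>

lemma stationary_on_add_generator:
  assumes art: "artinian_cring R" and F: "submodule F R M" "stationary_on F" and x: "x \<in> carrier M"
  defines "G \<equiv> {r \<odot>\<^bsub>M\<^esub> x \<oplus>\<^bsub>M\<^esub> f |r f. r \<in> carrier R \<and> f \<in> F}"
  shows "submodule G R M" "x \<in> G" "F \<subseteq> G" "stationary_on G"
proof -
  note FE = submoduleE[OF F(1)] and F0 = submodule_zero[OF F(1)]
  have Fc: "f \<in> carrier M" if "f \<in> F" for f using that FE(1) by blast
  have GI: "r \<odot>\<^bsub>M\<^esub> x \<oplus>\<^bsub>M\<^esub> f \<in> G" if "r \<in> carrier R" "f \<in> F" for r f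
    unfolding G_def using that by blast
  have G_add: "y \<oplus>\<^bsub>M\<^esub> z \<in> G" if yz: "y \<in> G" "z \<in> G" for y z
  proof -
    obtain r f s g where *: "r \<in> carrier R" "s \<in> carrier R" "f \<in> F" "g \<in> F"
      "y = r \<odot>\<^bsub>M\<^esub> x \<oplus>\<^bsub>M\<^esub> f" "z = s \<odot>\<^bsub>M\<^esub> x \<oplus>\<^bsub>M\<^esub> g" using yz unfolding G_def by blast
    then have "y \<oplus>\<^bsub>M\<^esub> z = (r \<oplus> s) \<odot>\<^bsub>M\<^esub> x \<oplus>\<^bsub>M\<^esub> (f \<oplus>\<^bsub>M\<^esub> g)"
      using x Fc by (simp add: smult_l_distr M.a_ac)
    then show ?thesis using GI[of "r \<oplus> s" "f \<oplus>\<^bsub>M\<^esub> g"] * FE(5) by simp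
  qed
  have G_smult: "a \<odot>\<^bsub>M\<^esub> y \<in> G" if ay: "a \<in> carrier R" "y \<in> G" for a y
  proof -
    obtain r f where *: "r \<in> carrier R" "f \<in> F" "y = r \<odot>\<^bsub>M\<^esub> x \<oplus>\<^bsub>M\<^esub> f" using ay unfolding G_def by blast
    then have "a \<odot>\<^bsub>M\<^esub> y = (a \<otimes> r) \<odot>\<^bsub>M\<^esub> x \<oplus>\<^bsub>M\<^esub> a \<odot>\<^bsub>M\<^esub> f"
      using x Fc ay(1) by (simp add: smult_r_distr smult_assoc1)
    then show ?thesis using GI[of "a \<otimes> r" "a \<odot>\<^bsub>M\<^esub> f"] * FE(4) ay(1) by simp
  qed
  have "x = \<one> \<odot>\<^bsub>M\<^esub> x \<oplus>\<^bsub>M\<^esub> \<zero>\<^bsub>M\<^esub>" using x by simp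
  then show xG: "x \<in> G" using GI[OF R.one_closed F0] by simp
  show FG: "F \<subseteq> G"
  proof
    fix f assume f: "f \<in> F"
    then have "f = \<zero> \<odot>\<^bsub>M\<^esub> x \<oplus>\<^bsub>M\<^esub> f" using x Fc by simp
    then show "f \<in> G" using GI[OF R.zero_closed f] by simp
  qed
  have Gsub: "G \<subseteq> carrier M" unfolding G_def using x Fc by auto
  show "submodule G R M"
  proof (rule submoduleI)
    show "\<ominus>\<^bsub>M\<^esub> y \<in> G" if "y \<in> G" for y
    proof -
      have "\<ominus>\<^bsub>M\<^esub> y = (\<ominus> \<one>) \<odot>\<^bsub>M\<^esub> y" using that Gsub smult_l_minus[of \<one> y] by auto
      then show ?thesis using G_smult[OF _ that, of "\<ominus> \<one>"] by simp
    qed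
  qed (use Gsub FG F0 G_add G_smult in auto)
  show "stationary_on G"
    unfolding stationary_on_def
  proof (intro allI impI)
    fix I :: "nat \<Rightarrow> 'c set" assume I: "\<forall>n. submodule (I n) R M \<and> I (Suc n) \<subseteq> I n"
    have anti: "I m \<subseteq> I n" if "n \<le> m" for n m
      by (rule lift_Suc_antimono_le[of I, OF _ that]) (use I in blast)
    have IE: "submodule (I n) R M" for n using I by blast
    \<comment> \<open>The coefficients at x of the elements of I n, taken modulo F.\<close>
    define J where "J n = {r \<in> carrier R. \<exists>f\<in>F. r \<odot>\<^bsub>M\<^esub> x \<oplus>\<^bsub>M\<^esub> f \<in> I n}" for n
    have J_mult: "a \<otimes> r \<in> J n" if ar: "a \<in> carrier R" "r \<in> J n" for a r n
    proof -
      obtain f where f: "f \<in> F" "r \<in> carrier R" "r \<odot>\<^bsub>M\<^esub> x \<oplus>\<^bsub>M\<^esub> f \<in> I n" using ar(2) unfolding J_def by blast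
      have "a \<odot>\<^bsub>M\<^esub> (r \<odot>\<^bsub>M\<^esub> x \<oplus>\<^bsub>M\<^esub> f) = (a \<otimes> r) \<odot>\<^bsub>M\<^esub> x \<oplus>\<^bsub>M\<^esub> a \<odot>\<^bsub>M\<^esub> f"
        using x Fc f ar(1) by (simp add: smult_r_distr smult_assoc1)
      then have "(a \<otimes> r) \<odot>\<^bsub>M\<^esub> x \<oplus>\<^bsub>M\<^esub> a \<odot>\<^bsub>M\<^esub> f \<in> I n" using submoduleE(4)[OF IE ar(1) f(3)] by simp
      then show ?thesis using FE(4)[OF ar(1) f(1)] ar(1) f(2) unfolding J_def by blast
    qed
    have J_add: "r \<oplus> s \<in> J n" if rs: "r \<in> J n" "s \<in> J n" for r s n
    proof -
      obtain f g where f: "f \<in> F" "r \<in> carrier R" "r \<odot>\<^bsub>M\<^esub> x \<oplus>\<^bsub>M\<^esub> f \<in> I n"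
        and g: "g \<in> F" "s \<in> carrier R" "s \<odot>\<^bsub>M\<^esub> x \<oplus>\<^bsub>M\<^esub> g \<in> I n" using rs unfolding J_def by blast
      have "(r \<odot>\<^bsub>M\<^esub> x \<oplus>\<^bsub>M\<^esub> f) \<oplus>\<^bsub>M\<^esub> (s \<odot>\<^bsub>M\<^esub> x \<oplus>\<^bsub>M\<^esub> g) = (r \<oplus> s) \<odot>\<^bsub>M\<^esub> x \<oplus>\<^bsub>M\<^esub> (f \<oplus>\<^bsub>M\<^esub> g)"
        using x Fc f g by (simp add: smult_l_distr M.a_ac)
      then have "(r \<oplus> s) \<odot>\<^bsub>M\<^esub> x \<oplus>\<^bsub>M\<^esub> (f \<oplus>\<^bsub>M\<^esub> g) \<in> I n" using submoduleE(5)[OF IE f(3) g(3)] by simp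
      then show ?thesis using FE(5)[OF f(1) g(1)] f(2) g(2) unfolding J_def by blast
    qed
    have J_ideal: "ideal (J n) R" for n
    proof (rule idealI[OF R.ring_axioms])
      have zero: "\<zero> \<in> J n"
        using F0 submodule_zero[OF IE] x by (auto simp: J_def intro!: bexI[of _ "\<zero>\<^bsub>M\<^esub>"])
      have neg: "\<ominus> r \<in> J n" if "r \<in> J n" for r
        using J_mult[OF _ that, of "\<ominus> \<one>"] that by (auto simp: J_def R.l_minus)
      show "subgroup (J n) (add_monoid R)"
        by (rule R.add.subgroupI) (use zero neg J_add in \<open>auto simp: J_def\<close>)
      show "a \<otimes> r \<in> J n" if "r \<in> J n" "a \<in> carrier R" for a r using J_mult that by blast
      then show "r \<otimes> a \<in> J n" if "r \<in> J n" "a \<in> carrier R" for a r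
        using that R.m_comm[of r a] by (auto simp: J_def)
    qed
    have "J (Suc n) \<subseteq> J n" for n using I unfolding J_def by blast
    then obtain n1 where n1: "\<And>m. m \<ge> n1 \<Longrightarrow> J m = J n1"
      using art J_ideal unfolding artinian_cring_def by metis
    obtain n2 where n2: "\<And>m. m \<ge> n2 \<Longrightarrow> I n2 \<inter> F \<subseteq> I m"
      using F(2) I unfolding stationary_on_def by metis
    have "I (max n1 n2) \<inter> G \<subseteq> I m" if m: "m \<ge> max n1 n2" for m
    proof
      fix z assume "z \<in> I (max n1 n2) \<inter> G"
      then obtain r f where z: "z \<in> I (max n1 n2)" "z = r \<odot>\<^bsub>M\<^esub> x \<oplus>\<^bsub>M\<^esub> f" "r \<in> carrier R" "f \<in> F"
        unfolding G_def by blast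
      then have "r \<in> J (max n1 n2)" unfolding J_def by blast
      then have "r \<in> J m" using n1[of "max n1 n2"] n1[of m] m by simp
      then obtain g where g: "g \<in> F" "r \<odot>\<^bsub>M\<^esub> x \<oplus>\<^bsub>M\<^esub> g \<in> I m" unfolding J_def by blast
      \<comment> \<open>z and \<open>r x + g\<close> have the same coefficient at x, so their
        difference \<open>f - g\<close> lies in F, where the chain is already constant. Thus it
        belongs to I m, and so does z.\<close>
      then have "z \<ominus>\<^bsub>M\<^esub> (r \<odot>\<^bsub>M\<^esub> x \<oplus>\<^bsub>M\<^esub> g) \<in> I (max n1 n2)" using submodule_diff[OF IE z(1)] anti[OF m] by blast
      moreover have eq: "z \<ominus>\<^bsub>M\<^esub> (r \<odot>\<^bsub>M\<^esub> x \<oplus>\<^bsub>M\<^esub> g) = f \<ominus>\<^bsub>M\<^esub> g"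
        unfolding z(2) using x z(3) Fc[OF z(4)] Fc[OF g(1)]
        by (simp add: a_minus_def M.minus_add M.a_ac M.r_neg1 M.r_neg2 M.r_neg)
      ultimately have "f \<ominus>\<^bsub>M\<^esub> g \<in> I n2 \<inter> F" using anti[of n2 "max n1 n2"] submodule_diff[OF F(1) z(4) g(1)] by auto
      then have "f \<ominus>\<^bsub>M\<^esub> g \<in> I m" using n2[of m] m by auto
      then have "(r \<odot>\<^bsub>M\<^esub> x \<oplus>\<^bsub>M\<^esub> g) \<oplus>\<^bsub>M\<^esub> (f \<ominus>\<^bsub>M\<^esub> g) \<in> I m" using submoduleE(5)[OF IE g(2)] by blast
      moreover have "(r \<odot>\<^bsub>M\<^esub> x \<oplus>\<^bsub>M\<^esub> g) \<oplus>\<^bsub>M\<^esub> (f \<ominus>\<^bsub>M\<^esub> g) = z"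
        unfolding z(2) using x z(3) Fc[OF z(4)] Fc[OF g(1)]
        by (simp add: a_minus_def M.a_ac M.r_neg1 M.r_neg2 M.r_neg)
      ultimately show "z \<in> I m" by simp
    qed
    then show "\<exists>n. \<forall>m\<ge>n. I n \<inter> G \<subseteq> I m" by blast
  qed
qed

lemma stationary_on_finitely_generated:
  assumes art: "artinian_cring R" and "finite X" "X \<subseteq> carrier M"
  shows "\<exists>F. submodule F R M \<and> X \<subseteq> F \<and> stationary_on F"
  using assms(2,3)
proof (induction rule: finite_induct)
  case empty
  have "submodule {\<zero>\<^bsub>M\<^esub>} R M" by (rule submoduleI) auto
  moreover have "stationary_on {\<zero>\<^bsub>M\<^esub>}" unfolding stationary_on_def using submodule_zero by blast
  ultimately show ?case by blast
next
  case (insert x X)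
  then obtain F where F: "submodule F R M" "X \<subseteq> F" "stationary_on F" by blast
  show ?case
    using stationary_on_add_generator[OF art F(1,3), of x] insert.prems F(2) by blast
qed

text \<open>A family without minimal member contains, by dependent choice, a strictly descending
  sequence; this contradicts stationarity on an F that contains the generators and hence all of
  M.\<close>

lemma minimal_submodule:
  assumes art: "artinian_cring R" and X: "finite X" "X \<subseteq> carrier M"
    and gen: "\<And>a. a \<in> carrier M \<Longrightarrow> \<exists>c\<in>X \<rightarrow> carrier R. a = (\<Oplus>\<^bsub>M\<^esub>x\<in>X. c x \<odot>\<^bsub>M\<^esub> x)"
    and S: "S \<noteq> {}" "\<And>I. I \<in> S \<Longrightarrow> submodule I R M"
  shows "\<exists>I\<in>S. \<forall>K\<in>S. K \<subseteq> I \<longrightarrow> K = I"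
proof (rule ccontr)
  assume no: "\<not> ?thesis"
  obtain F where F: "submodule F R M" "X \<subseteq> F" "stationary_on F"
    using stationary_on_finitely_generated[OF art X] by blast
  note FE = submoduleE[OF F(1)]
  have F_sum: "(\<Oplus>\<^bsub>M\<^esub>x\<in>Y. c x \<odot>\<^bsub>M\<^esub> x) \<in> F" if "Y \<subseteq> X" "c \<in> X \<rightarrow> carrier R" for Y c
    using finite_subset[OF that(1) X(1)] that(1)
  proof (induction rule: finite_induct)
    case empty
    then show ?case using submodule_zero[OF F(1)] by simp
  next
    case (insert x Y)
    have "c y \<odot>\<^bsub>M\<^esub> y \<in> F" if "y \<in> insert x Y" for y
      using that insert.prems F(2) FE(4)[of "c y" y] \<open>c \<in> X \<rightarrow> carrier R\<close> by auto
    moreover from this have "(\<lambda>y. c y \<odot>\<^bsub>M\<^esub> y) \<in> Y \<rightarrow> carrier M" "c x \<odot>\<^bsub>M\<^esub> x \<in> carrier M" using FE(1) by auto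
    ultimately show ?case using insert FE(5) by simp
  qed
  have carrier: "carrier M \<subseteq> F"
  proof
    fix a assume "a \<in> carrier M"
    then obtain c where c: "c \<in> X \<rightarrow> carrier R" "a = (\<Oplus>\<^bsub>M\<^esub>x\<in>X. c x \<odot>\<^bsub>M\<^esub> x)" using gen by blast
    then show "a \<in> F" using F_sum[OF subset_refl c(1)] by simp
  qed
  have "\<exists>f. \<forall>n. f n \<in> S \<and> f (Suc n) \<subset> f n"
  proof (rule dependent_nat_choice)
    show "\<exists>I. I \<in> S" using S(1) by blast
    show "\<exists>K. K \<in> S \<and> K \<subset> I" if "I \<in> S" for I using no that by blast
  qed
  then obtain f :: "nat \<Rightarrow> 'c set" where f: "\<And>n. f n \<in> S" "\<And>n. f (Suc n) \<subset> f n" by blast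
  then have "\<forall>n. submodule (f n) R M \<and> f (Suc n) \<subseteq> f n" using S(2) by blast
  then obtain n where n: "\<And>m. m \<ge> n \<Longrightarrow> f n \<inter> F \<subseteq> f m"
    using F(3)[unfolded stationary_on_def] by blast
  have "f n \<subseteq> F" using submoduleE(1)[OF S(2)[OF f(1)]] carrier by blast
  then show False using n[of "Suc n"] f(2)[of n] by auto
qed

end

section \<open>One-sided ideals of an Artin algebra\<close>

context artin_algebra
begin

text \<open>A scalar r acts as multiplication by the element \<open>r \<odot> \<one>\<close> of A.
  This passes the minimum condition from submodules over the commutative base ring to left
  ideals.\<close>

lemma left_ideal_submodule:
  assumes "left_ideal I A"
  shows "submodule I R A"
proof (rule submoduleI)
  note I = A.left_idealD[OF assms]
  show "\<ominus>\<^bsub>A\<^esub> x \<in> I" if "x \<in> I" for x using I(5)[OF I(3) that] I(2)[OF that] by (simp add: a_minus_def)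
  show "r \<odot>\<^bsub>A\<^esub> x \<in> I" if "r \<in> carrier R" "x \<in> I" for r x
    using I(6)[of "r \<odot>\<^bsub>A\<^esub> \<one>\<^bsub>A\<^esub>" x] smult_mult_left[of r "\<one>\<^bsub>A\<^esub>" x] that I(2)[OF that(2)] by simp
qed (use A.left_idealD[OF assms] in auto)

lemma right_ideal_submodule:
  assumes "right_ideal I A"
  shows "submodule I R A"
proof (rule submoduleI)
  note I = A.right_idealD[OF assms]
  show "\<ominus>\<^bsub>A\<^esub> x \<in> I" if "x \<in> I" for x using I(5)[OF I(3) that] I(2)[OF that] by (simp add: a_minus_def)
  show "r \<odot>\<^bsub>A\<^esub> x \<in> I" if "r \<in> carrier R" "x \<in> I" for r x
    using I(6)[of "r \<odot>\<^bsub>A\<^esub> \<one>\<^bsub>A\<^esub>" x] smult_mult_right[of r x "\<one>\<^bsub>A\<^esub>"] that I(2)[OF that(2)] by simp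
qed (use A.right_idealD[OF assms] in auto)

lemma artinian_left_right: "artinian_left A" "artinian_left (opposite_ring A)"
proof -
  obtain X where X: "finite X" "X \<subseteq> carrier A"
    "\<And>a. a \<in> carrier A \<Longrightarrow> \<exists>c\<in>X \<rightarrow> carrier R. a = (\<Oplus>\<^bsub>A\<^esub>x\<in>X. c x \<odot>\<^bsub>A\<^esub> x)"
    using finitely_generated by blast
  show "artinian_left A" "artinian_left (opposite_ring A)"
    unfolding artinian_left_def
    using minimal_submodule[OF artinian X] left_ideal_submodule right_ideal_submodule by simp_all
qed

end

section \<open>Basic rings\<close>

context ring
begin

lemma right_ideal_finsum:
  assumes I: "right_ideal I R" and "finite P" "\<And>i. i \<in> P \<Longrightarrow> f i \<in> I"
  shows "(\<Oplus>i\<in>P. f i) \<in> I"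
  using assms(2,3)
proof (induction rule: finite_induct)
  case (insert i P)
  then have "f \<in> P \<rightarrow> carrier R" "f i \<in> carrier R" using right_idealD(2)[OF I] by auto
  then show ?case using insert right_idealD(4)[OF I] by simp
qed (use right_idealD(3)[OF I] in simp)

lemma finsum_regular_opposite: "finsum (regular (opposite_ring R)) f P = finsum R f P"
  by (simp add: finsum_def finprod_def regular_def opposite_ring_def)

text \<open>e collects the components of \<one>. Multiplying \<one> by h on the right decomposes h
  into components \<open>e K \<otimes> h\<close>; h alone, placed at H, is another decomposition,
  and uniqueness compares the components at H.\<close>

lemma internal_direct_sum_idempotents:
  assumes P: "internal_direct_sum (opposite_ring R) (regular (opposite_ring R)) P"
  obtains e where "\<And>H. H \<in> P \<Longrightarrow> e H \<in> H" "\<one> = (\<Oplus>H\<in>P. e H)"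
    "\<And>H h. H \<in> P \<Longrightarrow> h \<in> H \<Longrightarrow> e H \<otimes> h = h"
proof -
  have fin: "finite P" and ri: "\<And>H. H \<in> P \<Longrightarrow> right_ideal H R"
    and uni: "\<And>x. x \<in> carrier R \<Longrightarrow> \<exists>!p. p \<in> (\<Pi>\<^sub>E H\<in>P. H) \<and> x = (\<Oplus>H\<in>P. p H)"
    using P by (auto simp: internal_direct_sum_def finsum_regular_opposite)
  obtain e where e: "e \<in> (\<Pi>\<^sub>E H\<in>P. H)" "\<one> = (\<Oplus>H\<in>P. e H)" using uni[OF one_closed] by blast
  have eH: "e H \<in> H" "e H \<in> carrier R" if "H \<in> P" for H
    using e(1) that right_idealD(2)[OF ri[OF that]] by auto
  have "e H \<otimes> h = h" if H: "H \<in> P" "h \<in> H" for H h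
  proof -
    have hc: "h \<in> carrier R" by (rule right_idealD(2)[OF ri[OF H(1)] H(2)])
    define p where "p = (\<lambda>K\<in>P. e K \<otimes> h)"
    define q where "q = (\<lambda>K\<in>P. if K = H then h else \<zero>)"
    have p: "p \<in> (\<Pi>\<^sub>E K\<in>P. K)" using eH right_idealD(6)[OF ri hc] by (auto simp: p_def)
    have q: "q \<in> (\<Pi>\<^sub>E K\<in>P. K)" using H(2) right_idealD(3)[OF ri] by (auto simp: q_def)
    have "h = (\<Oplus>K\<in>P. e K) \<otimes> h" using hc by (simp add: e(2)[symmetric])
    also have "\<dots> = (\<Oplus>K\<in>P. e K \<otimes> h)" using fin hc eH(2) by (intro finsum_ldistr) auto
    also have "\<dots> = (\<Oplus>K\<in>P. p K)" using eH(2) hc by (intro finsum_cong') (auto simp: p_def)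
    finally have hp: "h = (\<Oplus>K\<in>P. p K)" .
    have "(\<Oplus>K\<in>P. q K) = (\<Oplus>K\<in>P. if H = K then h else \<zero>)"
      using hc by (intro finsum_cong') (auto simp: q_def)
    also have "\<dots> = h" using add.finprod_singleton[OF H(1) fin, of "\<lambda>_. h"] hc by simp
    finally have hq: "h = (\<Oplus>K\<in>P. q K)" by simp
    have "p = q" using uni[OF hc] p q hp hq by blast
    from fun_cong[OF this, of H] show ?thesis using H(1) by (simp add: p_def q_def)
  qed
  then show ?thesis using that[OF eH(1) e(2)] by blast
qed

text \<open>For an idempotent e this is the ring \<open>e R e\<close> with identity e, which is the
  endomorphism ring of the right module \<open>e R\<close>.\<close>

definition corner :: "'a \<Rightarrow> 'a set" where
  "corner e = {c \<in> carrier R. e \<otimes> c = c \<and> c \<otimes> e = c}"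

text \<open>An idempotent f of the corner splits H = e R into f R and (e - f) R, and one of these
  must vanish.\<close>

lemma indecomposable_idempotent:
  assumes H: "right_ideal H R"
    and ind: "indecomposable (opposite_ring R) ((regular (opposite_ring R))\<lparr>carrier := H\<rparr>)"
    and e: "e \<in> H" "\<And>h. h \<in> H \<Longrightarrow> e \<otimes> h = h"
    and f: "f \<in> corner e" "f \<otimes> f = f"
  shows "f = \<zero> \<or> f = e"
proof -
  let ?M = "(regular (opposite_ring R))\<lparr>carrier := H\<rparr>"
  interpret M: left_module "opposite_ring R" ?M using ind by (simp add: indecomposable_def)
  have M: "carrier ?M = H" "\<zero>\<^bsub>?M\<^esub> = \<zero>" "a \<oplus>\<^bsub>?M\<^esub> b = a \<oplus> b" "a \<odot>\<^bsub>?M\<^esub> b = b \<otimes> a" for a b by simp_all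
  note HD = right_idealD[OF H]
  have ec: "e \<in> carrier R" by (rule HD(2)[OF e(1)])
  have fc: "f \<in> carrier R" and fe: "e \<otimes> f = f" "f \<otimes> e = f" using f(1) by (auto simp: corner_def)
  have fH: "f \<in> H" using HD(6)[OF fc e(1)] fe by simp
  have sub: "submodule {g \<otimes> a |a. a \<in> carrier R} (opposite_ring R) ?M" if g: "g \<in> H" for g
  proof (rule M.submoduleI, unfold M)
    note D = right_idealD[OF right_ideal_principal[OF HD(2)[OF g]]]
    show "{g \<otimes> a |a. a \<in> carrier R} \<subseteq> H" using HD(6) g by blast
    show "\<zero> \<in> {g \<otimes> a |a. a \<in> carrier R}" by (rule D(3))
    show "x \<oplus> y \<in> {g \<otimes> a |a. a \<in> carrier R}"
      if "x \<in> {g \<otimes> a |a. a \<in> carrier R}" "y \<in> {g \<otimes> a |a. a \<in> carrier R}" for x y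
      by (rule D(4)[OF that])
    show "x \<otimes> a \<in> {g \<otimes> a |a. a \<in> carrier R}"
      if "a \<in> carrier (opposite_ring R)" "x \<in> {g \<otimes> a |a. a \<in> carrier R}" for x a
      by (rule D(6)) (use that in simp_all)
  qed
  define D where "D = {f \<otimes> a |a. a \<in> carrier R}"
  define K where "K = {(e \<ominus> f) \<otimes> a |a. a \<in> carrier R}"
  have efH: "e \<ominus> f \<in> H" by (rule HD(5)[OF e(1) fH])
  have Dsub: "submodule D (opposite_ring R) ?M" and Ksub: "submodule K (opposite_ring R) ?M"
    unfolding D_def K_def by (rule sub[OF fH], rule sub[OF efH])
  have fD: "f \<otimes> d = d" if "d \<in> D" for d using that f(2) fc by (auto simp: D_def m_assoc[symmetric])
  have fef: "f \<otimes> (e \<ominus> f) = \<zero>" using fc ec fe f(2) by (simp add: a_minus_def r_distr r_minus r_neg)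
  have fK: "f \<otimes> k = \<zero>" if "k \<in> K" for k
    using that fef fc ec by (auto simp: K_def m_assoc[symmetric])
  have "D \<inter> K = {\<zero>}"
  proof -
    have "\<zero> \<in> D" "\<zero> \<in> K"
      unfolding D_def K_def using right_idealD(3)[OF right_ideal_principal] fc ec by auto
    moreover have "d = \<zero>" if "d \<in> D \<inter> K" for d using fD[of d] fK[of d] that by auto
    ultimately show ?thesis by blast
  qed
  moreover have "D <+>\<^bsub>?M\<^esub> K = H"
  proof
    have sum: "D <+>\<^bsub>?M\<^esub> K = {d \<oplus> k |d k. d \<in> D \<and> k \<in> K}"
      by (auto simp: set_add_def set_mult_def)
    have "D \<subseteq> H" "K \<subseteq> H" unfolding D_def K_def using HD(6) fH efH by auto
    then show "D <+>\<^bsub>?M\<^esub> K \<subseteq> H" unfolding sum using HD(4) by auto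
    show "H \<subseteq> D <+>\<^bsub>?M\<^esub> K"
    proof
      fix h assume h: "h \<in> H"
      have hc: "h \<in> carrier R" by (rule HD(2)[OF h])
      have "h = f \<otimes> h \<oplus> (e \<ominus> f) \<otimes> h"
        using hc fc ec e(2)[OF h] by (simp add: a_minus_def l_distr l_minus a_ac r_neg1 r_neg2 r_neg)
      moreover have "f \<otimes> h \<in> D" "(e \<ominus> f) \<otimes> h \<in> K" unfolding D_def K_def using hc by blast+
      ultimately show "h \<in> D <+>\<^bsub>?M\<^esub> K" unfolding sum by blast
    qed
  qed
  ultimately have "direct_summand D (opposite_ring R) ?M"
    unfolding direct_summand_def using Dsub Ksub by auto
  then have "D = {\<zero>} \<or> D = H" using ind by (auto simp: indecomposable_def)
  then show ?thesis
  proof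
    assume "D = {\<zero>}"
    moreover have "f \<otimes> f \<in> D" unfolding D_def using fc by blast
    ultimately show ?thesis using f(2) by simp
  next
    assume "D = H"
    then have "f \<otimes> e = e" using fD[of e] e(1) by simp
    then show ?thesis using fe by simp
  qed
qed

text \<open>Fitting's lemma: \<open>c\<^sup>N A = c\<^sup>2\<^sup>N A\<close> and \<open>A c\<^sup>N = A c\<^sup>2\<^sup>N\<close> produce an idempotent.\<close>

lemma corner_nilpotent_or_unit:
  assumes artl: "artinian_left R" and artr: "artinian_left (opposite_ring R)"
    and e: "e \<in> carrier R" "e \<otimes> e = e"
    and idem: "\<And>f. f \<in> corner e \<Longrightarrow> f \<otimes> f = f \<Longrightarrow> f = \<zero> \<or> f = e"
    and c: "c \<in> corner e"
  shows "(\<exists>n::nat. c [^] n = \<zero>) \<or> (\<exists>d\<in>corner e. c \<otimes> d = e \<and> d \<otimes> c = e)"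
proof -
  have cc: "c \<in> carrier R" and ce: "e \<otimes> c = c" "c \<otimes> e = c" using c by (auto simp: corner_def)
  let ?X = "range (\<lambda>n::nat. c [^] n)"
  have X: "?X \<noteq> {}" "?X \<subseteq> carrier R" using cc by auto
  obtain n :: nat where n: "\<And>b. b \<in> carrier R \<Longrightarrow> c [^] n \<otimes> b \<in> ?X \<Longrightarrow> \<exists>d\<in>carrier R. c [^] n = (c [^] n \<otimes> b) \<otimes> d"
    using artinian_principal_right[OF artr X] by auto
  obtain m :: nat where m: "\<And>b. b \<in> carrier R \<Longrightarrow> b \<otimes> c [^] m \<in> ?X \<Longrightarrow> \<exists>d\<in>carrier R. c [^] m = d \<otimes> (b \<otimes> c [^] m)"
    using artinian_principal_left[OF artl X] by auto
  \<comment> \<open>N is at least n and m, so that the relations found for these exponents both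
    extend to g. It is a successor so that \<open>c\<close> can be split off g on either side, which
    later yields the inverse of c.\<close>
  define N where "N = Suc (n + m)"
  define g where "g = c [^] N"
  have gc: "g \<in> carrier R" using cc by (simp add: g_def)
  have pow: "c [^] i \<otimes> c [^] j = c [^] (i + j)" for i j :: nat using cc by (simp add: nat_pow_mult)
  obtain d where d: "d \<in> carrier R" "g = (g \<otimes> g) \<otimes> d"
  proof -
    obtain d where d: "d \<in> carrier R" "c [^] n = (c [^] n \<otimes> g) \<otimes> d"
      using n[OF gc] unfolding g_def pow by blast
    have "g = c [^] Suc m \<otimes> c [^] n" unfolding g_def pow N_def by (simp add: add.commute)
    also have "\<dots> = c [^] Suc m \<otimes> ((c [^] n \<otimes> g) \<otimes> d)" using d(2) by simp
    also have "\<dots> = ((c [^] Suc m \<otimes> c [^] n) \<otimes> g) \<otimes> d" using cc gc d(1) by (simp add: m_assoc del: nat_pow_Suc)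
    also have "c [^] Suc m \<otimes> c [^] n = g" unfolding g_def pow N_def by (simp add: add.commute)
    finally show ?thesis using that d(1) by blast
  qed
  obtain d' where d': "d' \<in> carrier R" "g = d' \<otimes> (g \<otimes> g)"
  proof -
    obtain d where d: "d \<in> carrier R" "c [^] m = d \<otimes> (g \<otimes> c [^] m)"
      using m[OF gc] unfolding g_def pow by blast
    have "g = c [^] m \<otimes> c [^] Suc n" unfolding g_def pow N_def by (simp add: add.commute)
    also have "\<dots> = (d \<otimes> (g \<otimes> c [^] m)) \<otimes> c [^] Suc n" using d(2) by simp
    also have "\<dots> = d \<otimes> (g \<otimes> (c [^] m \<otimes> c [^] Suc n))" using cc gc d(1) by (simp add: m_assoc del: nat_pow_Suc)
    also have "c [^] m \<otimes> c [^] Suc n = g" unfolding g_def pow N_def by (simp add: add.commute)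
    finally show ?thesis using that d(1) by blast
  qed
  have gl: "g = c \<otimes> c [^] (n + m)" and gr: "g = c [^] (n + m) \<otimes> c"
    using pow[of 1 "n + m"] pow[of "n + m" 1] cc by (simp_all add: g_def N_def nat_pow_Suc2)
  have ge: "e \<otimes> g = g" unfolding gl using ce e cc by (simp add: m_assoc[symmetric])
  have ge': "g \<otimes> e = g" unfolding gr using ce e cc by (simp add: m_assoc)
  \<comment> \<open>d and \<open>d'\<close> cut down to the corner; since e fixes g on both sides,
    \<open>g g b = g\<close> and \<open>b' g g = g\<close> remain true.\<close>
  define b where "b = e \<otimes> d \<otimes> e"
  define b' where "b' = e \<otimes> d' \<otimes> e"
  have bc: "b \<in> carrier R" "b' \<in> carrier R" using e d(1) d'(1) by (auto simp: b_def b'_def)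
  have be: "e \<otimes> b = b" "b \<otimes> e = b" "e \<otimes> b' = b'" "b' \<otimes> e = b'"
    using e d(1) d'(1) by (auto simp: b_def b'_def m_assoc) (metis m_assoc m_closed)+
  have gb: "g \<otimes> (g \<otimes> b) = g"
  proof -
    have "g \<otimes> (g \<otimes> b) = (g \<otimes> (g \<otimes> e)) \<otimes> d \<otimes> e" using e d(1) gc by (simp add: b_def m_assoc)
    also have "\<dots> = g \<otimes> e" using d(2) ge' by simp
    finally show ?thesis using ge' by simp
  qed
  have gb': "(b' \<otimes> g) \<otimes> g = g"
  proof -
    have "(b' \<otimes> g) \<otimes> g = e \<otimes> (d' \<otimes> ((e \<otimes> g) \<otimes> g))" using e d'(1) gc by (simp add: b'_def m_assoc)
    also have "\<dots> = e \<otimes> g" using d'(2) ge by simp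
    finally show ?thesis using ge by simp
  qed
  \<comment> \<open>Both \<open>g b\<close> and \<open>b' g\<close> equal \<open>b' g g b\<close>.
    The two expressions for f give \<open>f g = g\<close> and then \<open>f f = f\<close>.\<close>
  define f where "f = g \<otimes> b"
  have fc: "f \<in> carrier R" using gc bc by (simp add: f_def)
  have f': "f = b' \<otimes> g"
  proof -
    have "b' \<otimes> g = b' \<otimes> (g \<otimes> (g \<otimes> b))" using gb by simp
    also have "\<dots> = ((b' \<otimes> g) \<otimes> g) \<otimes> b" using bc gc by (simp add: m_assoc)
    finally show ?thesis using gb' by (simp add: f_def)
  qed
  have fg: "f \<otimes> g = g" using gb' f' by simp
  have ff: "f \<otimes> f = f"
  proof -
    have "f \<otimes> f = (f \<otimes> g) \<otimes> b" using fc gc bc by (simp add: f_def m_assoc)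
    then show ?thesis using fg by (simp add: f_def)
  qed
  have "f \<in> corner e"
  proof -
    have "e \<otimes> f = (e \<otimes> g) \<otimes> b" "f \<otimes> e = g \<otimes> (b \<otimes> e)" using e gc bc by (simp_all add: f_def m_assoc)
    then show ?thesis using fc ge be by (simp add: corner_def f_def)
  qed
  then have "f = \<zero> \<or> f = e" using idem ff by blast
  then show ?thesis
  proof
    assume "f = \<zero>"
    then have "g = \<zero>" using fg gc by simp
    then show ?thesis unfolding g_def by blast
  next
    assume "f = e"
    define h where "h = c [^] (n + m)"
    have hc: "h \<in> carrier R" using cc by (simp add: h_def)
    \<comment> \<open>With \<open>g = c h = h c\<close>, the equations \<open>g b = e\<close> and
      \<open>b' g = e\<close> exhibit \<open>h b\<close> and \<open>b' h\<close> as inverses of c on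
      the two sides; the factors e put them into the corner.\<close>
    define u where "u = e \<otimes> h \<otimes> b"
    define v where "v = b' \<otimes> h \<otimes> e"
    have uc: "u \<in> carrier R" and vc: "v \<in> carrier R" using e hc bc by (auto simp: u_def v_def)
    have cu: "c \<otimes> u = e"
    proof -
      have "c \<otimes> u = (c \<otimes> e) \<otimes> h \<otimes> b" using cc e hc bc by (simp add: u_def m_assoc)
      then show ?thesis using ce gl \<open>f = e\<close> by (simp add: f_def h_def)
    qed
    have vc': "v \<otimes> c = e"
    proof -
      have "v \<otimes> c = b' \<otimes> (h \<otimes> (e \<otimes> c))" using cc e hc bc by (simp add: v_def m_assoc)
      then show ?thesis using ce gr \<open>f = e\<close> f' by (simp add: h_def)
    qed
    have eu: "e \<otimes> u = u"
    proof -
      have "e \<otimes> u = (e \<otimes> e) \<otimes> h \<otimes> b" using e(1) hc bc by (simp add: u_def m_assoc)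
      then show ?thesis using e(2) by (simp add: u_def)
    qed
    have ue: "u \<otimes> e = u" using e(1) hc bc be(2) by (simp add: u_def m_assoc)
    have ve: "v \<otimes> e = v" using e hc bc by (simp add: v_def m_assoc)
    have "u = (v \<otimes> c) \<otimes> u" using vc' eu by simp
    also have "\<dots> = v \<otimes> (c \<otimes> u)" using vc uc cc by (simp add: m_assoc)
    also have "\<dots> = v" using cu ve by simp
    finally have "u \<otimes> c = e" using vc' by simp
    moreover have "u \<in> corner e" using uc eu ue by (simp add: corner_def)
    ultimately show ?thesis using cu by blast
  qed
qed

text \<open>Left multiplication by y is the isomorphism. It is injective because
  \<open>z x y = e\<close> acts as the identity on H, and surjective because k is the image of
  \<open>x w k\<close>, where \<open>y x w = e'\<close> acts as the identity on K.\<close>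

lemma right_ideals_isomorphic:
  assumes H: "right_ideal H R" and K: "right_ideal K R"
    and e: "e \<in> H" "\<And>h. h \<in> H \<Longrightarrow> e \<otimes> h = h" and e': "e' \<in> K" "\<And>k. k \<in> K \<Longrightarrow> e' \<otimes> k = k"
    and x: "x \<in> carrier R" "e \<otimes> x = x" and y: "y \<in> carrier R" "e' \<otimes> y = y"
    and z: "z \<in> carrier R" "z \<otimes> (x \<otimes> y) = e" and w: "w \<in> carrier R" "(y \<otimes> x) \<otimes> w = e'"
  shows "isomorphic (opposite_ring R) ((regular (opposite_ring R))\<lparr>carrier := H\<rparr>)
    ((regular (opposite_ring R))\<lparr>carrier := K\<rparr>)"
proof -
  note HD = right_idealD[OF H] and KD = right_idealD[OF K]
  have yK: "y \<otimes> a \<in> K" if "a \<in> carrier R" for a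
    using KD(6)[OF _ e'(1), of "y \<otimes> a"] that y KD(2)[OF e'(1)] by (simp add: m_assoc[symmetric])
  have xH: "x \<otimes> a \<in> H" if "a \<in> carrier R" for a
    using HD(6)[OF _ e(1), of "x \<otimes> a"] that x HD(2)[OF e(1)] by (simp add: m_assoc[symmetric])
  define f where "f = (\<lambda>h\<in>H. y \<otimes> h)"
  have "f \<in> module_hom (opposite_ring R) ((regular (opposite_ring R))\<lparr>carrier := H\<rparr>)
    ((regular (opposite_ring R))\<lparr>carrier := K\<rparr>)"
    unfolding module_hom_def
  proof (intro CollectI conjI ballI, goal_cases)
    case 1
    then show ?case using yK HD(2) by (auto simp: f_def)
  next
    case (2 h h')
    then show ?case using HD(4)[of h h'] HD(2) y(1) by (simp add: f_def r_distr)
  next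
    case (3 a h)
    then show ?case using HD(6)[of a h] HD(2)[of h] y(1) by (simp add: f_def m_assoc)
  qed
  moreover have "inj_on f H"
  proof (rule inj_onI)
    fix h h' assume h: "h \<in> H" "h' \<in> H" "f h = f h'"
    have "h = z \<otimes> (x \<otimes> (y \<otimes> h))" if "h \<in> H" for h
    proof -
      have "h = (z \<otimes> (x \<otimes> y)) \<otimes> h" using z(2) e(2)[OF that] by simp
      then show ?thesis using z(1) x(1) y(1) HD(2)[OF that] by (simp add: m_assoc)
    qed
    then show "h = h'" using h by (metis f_def restrict_apply')
  qed
  moreover have "f ` H = K"
  proof
    show "f ` H \<subseteq> K" using yK HD(2) by (auto simp: f_def)
    show "K \<subseteq> f ` H"
    proof
      fix k assume k: "k \<in> K"
      have kc: "k \<in> carrier R" by (rule KD(2)[OF k])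
      have "k = ((y \<otimes> x) \<otimes> w) \<otimes> k" using w(2) e'(2)[OF k] by simp
      also have "\<dots> = y \<otimes> (x \<otimes> (w \<otimes> k))" using y(1) x(1) w(1) kc by (simp add: m_assoc)
      finally have "k = f (x \<otimes> (w \<otimes> k))" using xH[of "w \<otimes> k"] w(1) kc by (simp add: f_def)
      then show "k \<in> f ` H" using xH[of "w \<otimes> k"] w(1) kc by blast
    qed
  qed
  ultimately show ?thesis by (auto simp: isomorphic_def module_iso_def bij_betw_def)
qed

text \<open>
  On a simple right module exactly one \<open>e H\<close> acts non-trivially, and then as the identity; nilpotent
  elements of the corresponding corner act as zero. Note that \<open>a \<odot> v\<close> below stands for \<open>v a\<close>.
\<close>

lemma basic_completely_prime_maximal:
  assumes basic: "basic_ring R" and artl: "artinian_left R" and artr: "artinian_left (opposite_ring R)"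
    and N: "maximal_right_ideal N R"
  shows "completely_prime_maximal N R"
proof -
  let ?B = "opposite_ring R"
  let ?M = "\<lambda>H. (regular ?B)\<lparr>carrier := H\<rparr>"
  obtain P where "internal_direct_sum ?B (regular ?B) P \<and> (\<forall>H\<in>P. indecomposable ?B (?M H)) \<and>
      (\<forall>H\<in>P. \<forall>K\<in>P. H \<noteq> K \<longrightarrow> \<not> isomorphic ?B (?M H) (?M K))"
    using basic unfolding basic_ring_def by (elim exE)
  then have P: "internal_direct_sum ?B (regular ?B) P" "\<And>H. H \<in> P \<Longrightarrow> indecomposable ?B (?M H)"
    "\<And>H K. H \<in> P \<Longrightarrow> K \<in> P \<Longrightarrow> H \<noteq> K \<Longrightarrow> \<not> isomorphic ?B (?M H) (?M K)"
    by simp_all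
  have fin: "finite P" and ri: "\<And>H. H \<in> P \<Longrightarrow> right_ideal H R"
    using P(1) by (auto simp: internal_direct_sum_def)
  obtain e where e: "\<And>H. H \<in> P \<Longrightarrow> e H \<in> H" "\<one> = (\<Oplus>H\<in>P. e H)"
    and eh: "\<And>H h. H \<in> P \<Longrightarrow> h \<in> H \<Longrightarrow> e H \<otimes> h = h"
    by (rule internal_direct_sum_idempotents[OF P(1)]) (assumption | rule that)+
  have ec: "e H \<in> carrier R" and ee: "e H \<otimes> e H = e H" if "H \<in> P" for H
    using right_idealD(2)[OF ri[OF that] e(1)[OF that]] eh[OF that e(1)[OF that]] by auto
  have fitting: "(\<exists>n::nat. c [^] n = \<zero>) \<or> (\<exists>d\<in>corner (e H). c \<otimes> d = e H \<and> d \<otimes> c = e H)"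
    if "H \<in> P" "c \<in> corner (e H)" for H c
    by (rule corner_nilpotent_or_unit[OF artl artr ec[OF that(1)] ee[OF that(1)] _ that(2)])
      (rule indecomposable_idempotent[OF ri[OF that(1)] P(2)[OF that(1)] e(1)[OF that(1)] eh[OF that(1)]])
  note ND = right_idealD[OF maximal_right_idealD(1)[OF N]]
  have Nmax: "L = N \<or> L = carrier ?B" if "right_ideal L R" "N \<subseteq> L" for L
    using N that unfolding maximal_right_ideal_def by simp
  obtain T :: "('a, 'a set) module" and t where T: "simple_module ?B T" and t: "t \<in> carrier T" "t \<noteq> \<zero>\<^bsub>T\<^esub>"
    and ann: "{a \<in> carrier ?B. a \<odot>\<^bsub>T\<^esub> t = \<zero>\<^bsub>T\<^esub>} = N"
    by (rule ring.simple_quotient[OF ring_opposite maximal_right_idealD(1)[OF N] _ Nmax])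
      (use maximal_right_idealD(2)[OF N] in simp_all)
  interpret T: left_module ?B T using T by (simp add: simple_module_def)
  have act: "(b \<otimes> a) \<odot>\<^bsub>T\<^esub> v = a \<odot>\<^bsub>T\<^esub> (b \<odot>\<^bsub>T\<^esub> v)" if "a \<in> carrier R" "b \<in> carrier R" "v \<in> carrier T" for a b v
    using T.smult_assoc[of a b v] that by simp
  have cl: "a \<odot>\<^bsub>T\<^esub> v \<in> carrier T" if "a \<in> carrier R" "v \<in> carrier T" for a v
    using T.smult_closed that by simp
  have z: "\<zero> \<odot>\<^bsub>T\<^esub> v = \<zero>\<^bsub>T\<^esub>" if "v \<in> carrier T" for v using T.smult_zero_left that by simp
  have z': "a \<odot>\<^bsub>T\<^esub> \<zero>\<^bsub>T\<^esub> = \<zero>\<^bsub>T\<^esub>" if "a \<in> carrier R" for a using T.smult_zero_right that by simp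
  have one: "\<one> \<odot>\<^bsub>T\<^esub> v = v" if "v \<in> carrier T" for v using T.smult_one that by simp
  have trans: "\<exists>a\<in>carrier R. w = a \<odot>\<^bsub>T\<^esub> v" if "v \<in> carrier T" "v \<noteq> \<zero>\<^bsub>T\<^esub>" "w \<in> carrier T" for v w
    using ring.simple_module_cyclic[OF ring_opposite T that(1,2)] that(3) by auto
  have pow: "c [^] n \<odot>\<^bsub>T\<^esub> v = v" if "c \<in> carrier R" "v \<in> carrier T" "c \<odot>\<^bsub>T\<^esub> v = v" for c v and n :: nat
    by (induction n) (use that in \<open>simp_all add: one act\<close>)
  have ann_ri: "right_ideal {a \<in> carrier R. a \<odot>\<^bsub>T\<^esub> v = \<zero>\<^bsub>T\<^esub>} R" if v: "v \<in> carrier T" for v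
  proof (rule right_idealI)
    show "x \<oplus> y \<in> {a \<in> carrier R. a \<odot>\<^bsub>T\<^esub> v = \<zero>\<^bsub>T\<^esub>}"
      if "x \<in> {a \<in> carrier R. a \<odot>\<^bsub>T\<^esub> v = \<zero>\<^bsub>T\<^esub>}" "y \<in> {a \<in> carrier R. a \<odot>\<^bsub>T\<^esub> v = \<zero>\<^bsub>T\<^esub>}" for x y
      using that v T.smult_l_distr[of x y v] by simp
  qed (use v in \<open>auto simp: z z' act\<close>)
  \<comment> \<open>A corner element fixing a nonzero vector has no vanishing power, so Fitting's
    alternative makes it a unit.\<close>
  have unit: "\<exists>d\<in>corner (e H). c \<otimes> d = e H \<and> d \<otimes> c = e H"
    if "H \<in> P" "c \<in> corner (e H)" "v \<in> carrier T" "v \<noteq> \<zero>\<^bsub>T\<^esub>" "c \<odot>\<^bsub>T\<^esub> v = v" for H c v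
  proof -
    have "c [^] n \<noteq> \<zero>" for n :: nat using pow[of c v n] that z[of v] by (auto simp: corner_def)
    then show ?thesis using fitting[OF that(1,2)] by blast
  qed
  have some: "\<exists>H\<in>P. e H \<odot>\<^bsub>T\<^esub> v \<noteq> \<zero>\<^bsub>T\<^esub>" if v: "v \<in> carrier T" "v \<noteq> \<zero>\<^bsub>T\<^esub>" for v
  proof (rule ccontr)
    assume "\<not> ?thesis"
    then have "(\<Oplus>H\<in>P. e H) \<in> {a \<in> carrier R. a \<odot>\<^bsub>T\<^esub> v = \<zero>\<^bsub>T\<^esub>}"
      using ec by (intro right_ideal_finsum[OF ann_ri[OF v(1)] fin]) auto
    then show False using e(2) one[OF v(1)] v(2) by simp
  qed
  \<comment> \<open>If \<open>e H\<close> and \<open>e K\<close> both act non-trivially, simplicity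
    of T connects fixed vectors \<open>v1\<close> and \<open>w1\<close> by elements x and y between
    the two summands. Then \<open>x y\<close> fixes \<open>v1\<close> and \<open>y x\<close> fixes
    \<open>w1\<close>, so both are units in their corners and H, K are isomorphic, which basicness
    forbids for H \<noteq> K.\<close>
  have unique: "H = K" if HK: "H \<in> P" "K \<in> P" and v: "v \<in> carrier T" "e H \<odot>\<^bsub>T\<^esub> v \<noteq> \<zero>\<^bsub>T\<^esub>"
    and w: "w \<in> carrier T" "e K \<odot>\<^bsub>T\<^esub> w \<noteq> \<zero>\<^bsub>T\<^esub>" for H K v w
  proof (rule ccontr)
    assume "H \<noteq> K"
    note c = ec[OF HK(1)] ec[OF HK(2)] and i = ee[OF HK(1)] ee[OF HK(2)]
    define v1 where "v1 = e H \<odot>\<^bsub>T\<^esub> v"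
    define w1 where "w1 = e K \<odot>\<^bsub>T\<^esub> w"
    have v1: "v1 \<in> carrier T" "v1 \<noteq> \<zero>\<^bsub>T\<^esub>" "e H \<odot>\<^bsub>T\<^esub> v1 = v1"
      using v c i act[OF c(1) c(1) v(1)] by (simp_all add: v1_def cl)
    have w1: "w1 \<in> carrier T" "w1 \<noteq> \<zero>\<^bsub>T\<^esub>" "e K \<odot>\<^bsub>T\<^esub> w1 = w1"
      using w c i act[OF c(2) c(2) w(1)] by (simp_all add: w1_def cl)
    obtain a where a: "a \<in> carrier R" "w1 = a \<odot>\<^bsub>T\<^esub> v1" using trans[OF v1(1,2) w1(1)] by blast
    obtain b where b: "b \<in> carrier R" "v1 = b \<odot>\<^bsub>T\<^esub> w1" using trans[OF w1(1,2) v1(1)] by blast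
    define x where "x = e H \<otimes> (a \<otimes> e K)"
    define y where "y = e K \<otimes> (b \<otimes> e H)"
    have xc: "x \<in> carrier R" and yc: "y \<in> carrier R" using c a b by (auto simp: x_def y_def)
    have ex: "e H \<otimes> x = x" "e K \<otimes> y = y" using i c a(1) b(1) by (simp_all add: x_def y_def m_assoc[symmetric])
    have xe: "x \<otimes> e K = x" "y \<otimes> e H = y" using i c a(1) b(1) by (simp_all add: x_def y_def m_assoc)
    have xv: "x \<odot>\<^bsub>T\<^esub> v1 = w1" using c a v1 w1(3) by (simp add: x_def act cl)
    have yw: "y \<odot>\<^bsub>T\<^esub> w1 = v1" using c b w1 v1(3) by (simp add: y_def act cl)
    have "x \<otimes> y \<in> corner (e H)"
      using xc yc c xe by (simp add: corner_def m_assoc) (simp add: ex m_assoc[symmetric])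
    moreover have "(x \<otimes> y) \<odot>\<^bsub>T\<^esub> v1 = v1" using xc yc v1(1) xv yw by (simp add: act)
    ultimately obtain d where d: "d \<in> corner (e H)" "d \<otimes> (x \<otimes> y) = e H" using unit[OF HK(1) _ v1(1,2)] by blast
    have "y \<otimes> x \<in> corner (e K)"
      using xc yc c xe by (simp add: corner_def m_assoc) (simp add: ex m_assoc[symmetric])
    moreover have "(y \<otimes> x) \<odot>\<^bsub>T\<^esub> w1 = w1" using xc yc w1(1) xv yw by (simp add: act)
    ultimately obtain d' where d': "d' \<in> corner (e K)" "(y \<otimes> x) \<otimes> d' = e K" using unit[OF HK(2) _ w1(1,2)] by blast
    have "isomorphic ?B (?M H) (?M K)"
      by (rule right_ideals_isomorphic[OF ri[OF HK(1)] ri[OF HK(2)] e(1)[OF HK(1)] eh[OF HK(1)]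
            e(1)[OF HK(2)] eh[OF HK(2)] xc ex(1) yc ex(2) _ d(2) _ d'(2)])
        (use d(1) d'(1) in \<open>auto simp: corner_def\<close>)
    then show False using P(3)[OF HK \<open>H \<noteq> K\<close>] by blast
  qed
  obtain H where H: "H \<in> P" "e H \<odot>\<^bsub>T\<^esub> t \<noteq> \<zero>\<^bsub>T\<^esub>" using some[OF t] by blast
  define E where "E = e H"
  have Ec: "E \<in> carrier R" and EE: "E \<otimes> E = E" using ec[OF H(1)] ee[OF H(1)] by (auto simp: E_def)
  \<comment> \<open>Apply \<one>, the sum of all \<open>e K\<close>, to v: every term except that of
    H acts as zero.\<close>
  have id: "E \<odot>\<^bsub>T\<^esub> v = v" if v: "v \<in> carrier T" for v
  proof -
    have zero: "e K \<odot>\<^bsub>T\<^esub> v = \<zero>\<^bsub>T\<^esub>" if "K \<in> P - {H}" for K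
      using unique[OF H(1) _ t(1) H(2) v, of K] that by auto
    define s where "s = (\<Oplus>K\<in>P - {H}. e K)"
    have s: "s \<in> {a \<in> carrier R. a \<odot>\<^bsub>T\<^esub> v = \<zero>\<^bsub>T\<^esub>}"
      unfolding s_def using ec zero fin by (intro right_ideal_finsum[OF ann_ri[OF v]]) auto
    have "\<one> = (\<Oplus>K\<in>insert H (P - {H}). e K)" using e(2) H(1) by (simp add: insert_absorb)
    also have "\<dots> = E \<oplus> s" unfolding E_def s_def using fin ec H(1) by (intro finsum_insert) auto
    finally have "v = (E \<oplus> s) \<odot>\<^bsub>T\<^esub> v" using one[OF v] by simp
    also have "\<dots> = E \<odot>\<^bsub>T\<^esub> v" using s Ec v T.smult_l_distr[of E s v] cl[OF Ec v] by simp
    finally show ?thesis by simp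
  qed
  have corner: "E \<otimes> (a \<otimes> E) \<in> corner (e H)" if "a \<in> carrier R" for a
    using that Ec EE unfolding E_def[symmetric] corner_def by (simp add: m_assoc) (simp add: m_assoc[symmetric])
  have EaE: "(E \<otimes> (a \<otimes> E)) \<odot>\<^bsub>T\<^esub> v = a \<odot>\<^bsub>T\<^esub> v" if "a \<in> carrier R" "v \<in> carrier T" for a v
    using that Ec by (simp add: act cl id)
  \<comment> \<open>T becomes a module on which each a acts as zero or invertibly: a acts as the
    corner element \<open>E a E\<close>, and it suffices to show that this element is not
    nilpotent.\<close>
  have inv: "\<exists>d\<in>carrier R. \<forall>w\<in>carrier T. d \<odot>\<^bsub>T\<^esub> (a \<odot>\<^bsub>T\<^esub> w) = w \<and> a \<odot>\<^bsub>T\<^esub> (d \<odot>\<^bsub>T\<^esub> w) = w"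
    if a: "a \<in> carrier R" and v: "v \<in> carrier T" "a \<odot>\<^bsub>T\<^esub> v \<noteq> \<zero>\<^bsub>T\<^esub>" for a v
  proof -
    let ?c = "E \<otimes> (a \<otimes> E)"
    have cc: "?c \<in> carrier R" using a Ec by simp
    have "v \<noteq> \<zero>\<^bsub>T\<^esub>" using v(2) z'[OF a] by auto
    obtain b where b: "b \<in> carrier R" "v = b \<odot>\<^bsub>T\<^esub> (a \<odot>\<^bsub>T\<^esub> v)" using trans[OF cl[OF a v(1)] v(2) v(1)] by blast
    define g where "g = ?c \<otimes> (b \<otimes> E)"
    have "g = E \<otimes> ((a \<otimes> (E \<otimes> b)) \<otimes> E)" using a b(1) Ec by (simp add: g_def m_assoc)
    then have "g \<in> corner (e H)" using corner[of "a \<otimes> (E \<otimes> b)"] a b(1) Ec by simp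
    moreover have "g \<odot>\<^bsub>T\<^esub> v = v" using a b Ec v(1) cc by (simp add: g_def act cl id EaE b(2)[symmetric])
    ultimately obtain h where h: "h \<in> corner (e H)" "g \<otimes> h = E"
      using unit[OF H(1) _ v(1) \<open>v \<noteq> \<zero>\<^bsub>T\<^esub>\<close>] unfolding E_def by blast
    define y where "y = b \<otimes> (E \<otimes> h)"
    have hc: "h \<in> carrier R" using h(1) by (simp add: corner_def)
    have yc: "y \<in> carrier R" using b(1) Ec hc by (simp add: y_def)
    have cy: "?c \<otimes> y = E" using h(2) a b(1) Ec hc by (simp add: y_def g_def m_assoc)
    \<comment> \<open>A right inverse y of \<open>?c\<close> up to E excludes nilpotence, as every
      power times a suitable w gives E. Since y need not lie in the corner, the condition
      \<open>E \<otimes> w = w\<close> is carried through the induction.\<close>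
    have "?c [^] n \<noteq> \<zero>" for n :: nat
    proof
      assume n: "?c [^] n = \<zero>"
      have "\<exists>w\<in>carrier R. E \<otimes> w = w \<and> ?c [^] k \<otimes> w = E" for k :: nat
      proof (induction k)
        case 0
        then show ?case using Ec EE by (intro bexI[of _ E]) simp_all
      next
        case (Suc k)
        then obtain w where w: "w \<in> carrier R" "E \<otimes> w = w" "?c [^] k \<otimes> w = E" by blast
        have "?c [^] Suc k \<otimes> (E \<otimes> (y \<otimes> w)) = ?c [^] k \<otimes> ((?c \<otimes> E) \<otimes> (y \<otimes> w))"
          using w(1) yc cc Ec by (simp add: m_assoc)
        also have "?c \<otimes> E = ?c" using a Ec EE by (simp add: m_assoc)
        also have "?c [^] k \<otimes> (?c \<otimes> (y \<otimes> w)) = ?c [^] k \<otimes> ((?c \<otimes> y) \<otimes> w)"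
          using w(1) yc cc by (simp add: m_assoc)
        also have "\<dots> = E" using w cy by simp
        finally have "?c [^] Suc k \<otimes> (E \<otimes> (y \<otimes> w)) = E" .
        moreover have "E \<otimes> (E \<otimes> (y \<otimes> w)) = E \<otimes> (y \<otimes> w)" using Ec EE yc w(1) by (simp add: m_assoc[symmetric])
        ultimately show ?case using Ec yc w(1) by blast
      qed
      then obtain w where "w \<in> carrier R" "?c [^] n \<otimes> w = E" by blast
      then have "E = \<zero>" using n by simp
      then show False using id[OF v(1)] z[OF v(1)] \<open>v \<noteq> \<zero>\<^bsub>T\<^esub>\<close> by simp
    qed
    then obtain d where d: "d \<in> corner (e H)" "?c \<otimes> d = E" "d \<otimes> ?c = E"
      using fitting[OF H(1) corner[OF a]] unfolding E_def by blast
    have dc: "d \<in> carrier R" using d(1) by (simp add: corner_def)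
    have "d \<odot>\<^bsub>T\<^esub> (a \<odot>\<^bsub>T\<^esub> w) = w \<and> a \<odot>\<^bsub>T\<^esub> (d \<odot>\<^bsub>T\<^esub> w) = w" if w: "w \<in> carrier T" for w
      using act[OF dc cc w] act[OF cc dc w] EaE[OF a] cl[OF dc w] w d(2,3) id[OF w] by simp
    then show ?thesis using dc by blast
  qed
  have NT: "a \<in> N \<longleftrightarrow> a \<odot>\<^bsub>T\<^esub> t = \<zero>\<^bsub>T\<^esub>" if "a \<in> carrier R" for a using ann that by auto
  show ?thesis
    unfolding completely_prime_maximal_def
  proof (intro conjI ballI)
    fix a n assume a: "a \<in> carrier R" and n: "n \<in> N"
    have nc: "n \<in> carrier R" by (rule ND(2)[OF n])
    \<comment> \<open>n annihilates t, so it is not invertible on T; by \<open>inv\<close> it acts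
      as zero on every vector. This makes N closed under left multiplication.\<close>
    have "n \<odot>\<^bsub>T\<^esub> (a \<odot>\<^bsub>T\<^esub> t) = \<zero>\<^bsub>T\<^esub>"
    proof (rule ccontr)
      assume "n \<odot>\<^bsub>T\<^esub> (a \<odot>\<^bsub>T\<^esub> t) \<noteq> \<zero>\<^bsub>T\<^esub>"
      from inv[OF nc cl[OF a t(1)] this] obtain d where d: "d \<in> carrier R"
        "\<forall>w\<in>carrier T. d \<odot>\<^bsub>T\<^esub> (n \<odot>\<^bsub>T\<^esub> w) = w \<and> n \<odot>\<^bsub>T\<^esub> (d \<odot>\<^bsub>T\<^esub> w) = w" by blast
      then have "d \<odot>\<^bsub>T\<^esub> (n \<odot>\<^bsub>T\<^esub> t) = t" using t(1) by simp
      then show False using NT[OF nc] n z'[OF d(1)] t(2) by simp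
    qed
    then show "a \<otimes> n \<in> N" using NT[of "a \<otimes> n"] a nc act[OF nc a t(1)] by simp
  next
    fix a assume a: "a \<in> carrier R - N"
    then have ac: "a \<in> carrier R" and "a \<odot>\<^bsub>T\<^esub> t \<noteq> \<zero>\<^bsub>T\<^esub>" using NT[of a] by auto
    from inv[OF ac t(1) this(2)] obtain d where d: "d \<in> carrier R"
      "\<forall>w\<in>carrier T. d \<odot>\<^bsub>T\<^esub> (a \<odot>\<^bsub>T\<^esub> w) = w \<and> a \<odot>\<^bsub>T\<^esub> (d \<odot>\<^bsub>T\<^esub> w) = w" by blast
    then have "(d \<otimes> a) \<odot>\<^bsub>T\<^esub> t = \<one> \<odot>\<^bsub>T\<^esub> t" using ac d act[OF ac d(1) t(1)] t(1) one by simp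
    then have "(d \<otimes> a \<ominus> \<one>) \<odot>\<^bsub>T\<^esub> t = \<zero>\<^bsub>T\<^esub>" using T.smult_diff_eq_zero[of "d \<otimes> a" \<one> t] a d(1) t(1) by simp
    then have "d \<otimes> a \<ominus> \<one> \<in> N" using NT[of "d \<otimes> a \<ominus> \<one>"] a d(1) by simp
    then show "\<exists>b\<in>carrier R. b \<otimes> a \<ominus> \<one> \<in> N" using d(1) by blast
  qed
qed

end

text \<open>Non-semisimplicity thus gives \<one> \<noteq> \<zero>, from which the first part obtains
  a maximal right ideal and a simple module.\<close>

lemma (in ring) zero_ring_semisimple:
  assumes "carrier R = {\<zero>}"
  shows "semisimple_ring R"
proof -
  interpret op: ring "opposite_ring R" by (rule ring_opposite)
  have "\<zero> \<in> socle (opposite_ring R) (regular (opposite_ring R))"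
    unfolding socle_def using right_idealD(3) by blast
  moreover have "right_ideal (carrier R) R" by (rule right_idealI) auto
  then have "socle (opposite_ring R) (regular (opposite_ring R)) \<subseteq> carrier R"
    unfolding socle_def using right_idealD(1) by (intro Inter_lower) auto
  ultimately show ?thesis
    using assms op.regular_module by (auto simp: semisimple_ring_def semisimple_module_def)
qed

text \<open>The local part asks for one reflexive simple module, of an arbitrary type
  \<open>'s\<close>: with a single maximal right ideal all simple right modules are
  isomorphic.\<close>

theorem proposition3p14:
  fixes R :: "('r, 'k) ring_scheme" and A :: "('r, 'a, 'l) module_scheme"
  assumes "artin_algebra R A" and "basic_ring A" and "\<not> semisimple_ring A"
  shows "((\<forall>U :: ('a, 'a set) module. simple_module A U \<longrightarrow> square_in_regular_socle A U) \<and>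
          (\<forall>S :: ('a, 'a set) module. simple_module (opposite_ring A) S \<longrightarrow>
             square_in_regular_socle (opposite_ring A) S) \<and>
          (\<forall>S :: ('a, 'a set) module. simple_module (opposite_ring A) S \<longrightarrow>
             reflexive (opposite_ring A) S)
          \<longrightarrow> selfinjective TYPE('x) TYPE('y) A)
       \<and> (local_ring A \<longrightarrow>
          (\<forall>S :: ('a, 's) module. simple_module (opposite_ring A) S \<and> reflexive (opposite_ring A) S
             \<longrightarrow> selfinjective TYPE('x) TYPE('y) A))"
proof (intro conjI impI allI)
  interpret A: artin_algebra R A by fact
  interpret A: ring A by (rule A.A.ring_axioms)
  note art = A.artinian_left_right
  {
    assume hyp: "(\<forall>U :: ('a, 'a set) module. simple_module A U \<longrightarrow> square_in_regular_socle A U) \<and>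
          (\<forall>S :: ('a, 'a set) module. simple_module (opposite_ring A) S \<longrightarrow>
             square_in_regular_socle (opposite_ring A) S) \<and>
          (\<forall>S :: ('a, 'a set) module. simple_module (opposite_ring A) S \<longrightarrow>
             reflexive (opposite_ring A) S)"
    have "carrier A \<noteq> {\<zero>\<^bsub>A\<^esub>}" using A.zero_ring_semisimple assms(3) by blast
    with A.not_all_simple_reflexive[OF art(2)] A.basic_completely_prime_maximal[OF assms(2) art]
    have False using hyp by blast
    then show "selfinjective TYPE('x) TYPE('y) A" ..
  next
    fix S :: "('a, 's) module"
    assume "local_ring A" "simple_module (opposite_ring A) S \<and> reflexive (opposite_ring A) S"
    then show "selfinjective TYPE('x) TYPE('y) A"
      using A.local_reflexive_selfinjective[OF art] by blast
  }
qed

end
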